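(* Let $p\in(0,1)$, $L>0$, $a>0$ be constants and consider the one-dimensional problem $$-u''=\lambda u-a|u|^{p-1}u\ \text{ in }[0,L],\qquad u(0)=u(L)=0. \qquad ( * )$$ The set of nonnegative nontrivial solutions $(\lambda,u)$ of $( * )$ consists of a countable set of disjoint components $\mathscr{D}_j^+$, $j\ge1$, with the following properties: (i) For every $j\ge1$ and $(\lambda,u)\in\mathscr{D}_j^+$, $u$ has exactly $j$ bumps in the interval $(0,L)$, the bumps occurring at some points $x_i$, $1\le i\le j$, at which $$u(x_i)\ge\Big(\tfrac{2a}{(p+1)\lambda}\Big)^{\frac1{1-p}}.$$ (ii) $\mathcal{P}_\lambda(\mathscr{D}_1^+)=(\sigma_1,\infty)$, and $\mathcal{P}_\lambda(\mathscr{D}_j^+)=[\Sigma_j,\infty)$ for all $j\ge2$. (iii) $\mathscr{D}_i^+\cap\mathscr{D}_j^+=\emptyset$ if $i\ne j$. (iv) In the interval $(\sigma_1,\Sigma_1]$, $\mathscr{D}_1^+$ is a curve $(\lambda,u_\lambda)$ such that $\lim_{\lambda\downarrow\sigma_1}\|u_\lambda\|_\infty=\infty$. Moreover, for every fixed $\lambda>\Sigma_1$, the slice $\{u:(\lambda,u)\in\mathscr{D}_1^+\}$ is a one-dimensional simplex, i.e. a line segment, which expands as $\lambda$ increases. (v) For every $j\ge2$ and $\lambda>\Sigma_j$, the slice $\{u:(\lambda,u)\in\mathscr{D}_j^+\}$ is a $j$-dimensional simplex, which expands as $\lambda$ increases.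
   Context: Solutions are classical, $(\lambda,u)\in\mathbb{R}\times C^2[0,L]$, and solution sets carry the topology of $\mathbb{R}\times C^1[0,L]$; a component is a maximal connected subset. $\mathcal{P}_\lambda(\lambda,u):=\lambda$. For $j\ge1$, $$\sigma_j:=\Big(\frac{j\pi}{L}\Big)^2,\qquad \Sigma_j:=\Big(\frac{2}{1-p}\Big)^2\sigma_j .$$ A bump of a nonnegative solution $u$ is a connected component of the set $\{x\in(0,L):u(x)>0\}$; it "occurs at" the point of that interval where $u$ attains its maximum over it. Meaning of "simplex" and "expands": set $T_H(\lambda):=\frac{\pi}{\sqrt\lambda(1-p)}$ (so $2jT_H(\lambda)\le L$ if and only if $\lambda\ge\Sigma_j$). For $j\geq 1$ and $\lambda>\Sigma_j$, the map sending $u$ to the vector $(x_1,\dots,x_j)$, $x_1<\dots<x_j$, of points where its bumps occur is a homeomorphism from the slice $\{u:(\lambda,u)\in\mathscr{D}_j^+\}$ onto the $j$-dimensional simplex $$\{(x_1,\dots,x_j): x_1\ge T_H(\lambda),\ x_i-x_{i-1}\ge 2T_H(\lambda)\ (2\le i\le j),\ x_j\le L-T_H(\lambda)\}\subset\mathbb{R}^j,$$ and these simplices increase with respect to inclusion as $\lambda$ increases. This homeomorphism and monotonicity are part of what is asserted in (iv) and (v). *)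

theory Defs
  imports "HOL-Analysis.Analysis"
begin

section \<open>The spaces \<open>C\<^sup>0[0,L]\<close>, \<open>C\<^sup>1[0,L]\<close>, \<open>C\<^sup>2[0,L]\<close>\<close>

text \<open>Functions on \<open>[0,L]\<close> are represented by elements of \<^term>\<open>extensional {0..L}\<close>, so that
  equality of HOL functions is equality on \<open>[0,L]\<close>.  Derivatives are one-sided at the endpoints.\<close>

abbreviation C0_metric :: "real \<Rightarrow> (real \<Rightarrow> real) metric" where
  "C0_metric L \<equiv> cfunspace (top_of_set {0..L}) euclidean_metric"

definition D_on :: "real \<Rightarrow> (real \<Rightarrow> real) \<Rightarrow> real \<Rightarrow> real" where
  "D_on L u = (\<lambda>x\<in>{0..L}. vector_derivative u (at x within {0..L}))"

definition C1_space :: "real \<Rightarrow> (real \<Rightarrow> real) set" where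
  "C1_space L = {u \<in> mspace (C0_metric L).
     u differentiable_on {0..L} \<and> D_on L u \<in> mspace (C0_metric L)}"

definition C2_space :: "real \<Rightarrow> (real \<Rightarrow> real) set" where
  "C2_space L = {u \<in> C1_space L. D_on L u \<in> C1_space L}"

definition C1_dist :: "real \<Rightarrow> (real \<Rightarrow> real) \<Rightarrow> (real \<Rightarrow> real) \<Rightarrow> real" where
  "C1_dist L u v = mdist (C0_metric L) u v + mdist (C0_metric L) (D_on L u) (D_on L v)"

lemma Metric_space_C1: "Metric_space (C1_space L) (C1_dist L)"
proof
  fix u v
  show "0 \<le> C1_dist L u v" "C1_dist L u v = C1_dist L v u"
    by (simp_all add: C1_dist_def mdist_commute)
next
  fix u v assume "u \<in> C1_space L" "v \<in> C1_space L"
  then have "u \<in> mspace (C0_metric L)" "v \<in> mspace (C0_metric L)"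
    "D_on L u \<in> mspace (C0_metric L)" "D_on L v \<in> mspace (C0_metric L)"
    by (simp_all only: C1_space_def mem_Collect_eq)
  then show "C1_dist L u v = 0 \<longleftrightarrow> u = v"
    unfolding C1_dist_def
    by (metis add_nonneg_eq_0_iff mdist_nonneg mdist_zero add.right_neutral)
next
  fix u v w assume "u \<in> C1_space L" "v \<in> C1_space L" "w \<in> C1_space L"
  then have "mdist (C0_metric L) u w \<le> mdist (C0_metric L) u v + mdist (C0_metric L) v w"
    "mdist (C0_metric L) (D_on L u) (D_on L w)
      \<le> mdist (C0_metric L) (D_on L u) (D_on L v) + mdist (C0_metric L) (D_on L v) (D_on L w)"
    by (simp_all only: C1_space_def mem_Collect_eq mdist_triangle)
  then show "C1_dist L u w \<le> C1_dist L u v + C1_dist L v w"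
    unfolding C1_dist_def by linarith
qed

definition C1_metric :: "real \<Rightarrow> (real \<Rightarrow> real) metric" where
  "C1_metric L = metric (C1_space L, C1_dist L)"

lemma mspace_C1_metric: "mspace (C1_metric L) = C1_space L"
  and mdist_C1_metric: "mdist (C1_metric L) = C1_dist L"
  by (simp_all add: C1_metric_def Metric_space.mspace_metric[OF Metric_space_C1]
      Metric_space.mdist_metric[OF Metric_space_C1])

abbreviation C1_topology :: "real \<Rightarrow> (real \<Rightarrow> real) topology" where
  "C1_topology L \<equiv> mtopology_of (C1_metric L)"

definition sup_norm :: "real \<Rightarrow> (real \<Rightarrow> real) \<Rightarrow> real" where
  "sup_norm L u = (SUP x\<in>{0..L}. \<bar>u x\<bar>)"


section \<open>Solutions and bumps\<close>

text \<open>The nonlinearity \<open>|u|\<^sup>p\<^sup>-\<^sup>1 u\<close> is \<open>0\<close> at \<open>u = 0\<close>, in agreement with its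
  continuous extension for \<open>p > 0\<close>.\<close>

definition is_solution :: "real \<Rightarrow> real \<Rightarrow> real \<Rightarrow> real \<Rightarrow> (real \<Rightarrow> real) \<Rightarrow> bool" where
  "is_solution p L a lam u \<longleftrightarrow> u \<in> C2_space L
     \<and> (\<forall>x\<in>{0..L}. - D_on L (D_on L u) x = lam * u x - a * (\<bar>u x\<bar> powr (p - 1) * u x))
     \<and> u 0 = 0 \<and> u L = 0"

definition nonneg_solutions :: "real \<Rightarrow> real \<Rightarrow> real \<Rightarrow> (real \<times> (real \<Rightarrow> real)) set" where
  "nonneg_solutions p L a = {(lam, u). is_solution p L a lam u
     \<and> (\<forall>x\<in>{0..L}. 0 \<le> u x) \<and> (\<exists>x\<in>{0..L}. u x \<noteq> 0)}"

text \<open>The set of nonnegative nontrivial solutions as a subspace of \<open>\<real> \<times> C\<^sup>1[0,L]\<close>.\<close>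

definition nonneg_solution_space ::
  "real \<Rightarrow> real \<Rightarrow> real \<Rightarrow> (real \<times> (real \<Rightarrow> real)) topology" where
  "nonneg_solution_space p L a =
     subtopology (prod_topology euclideanreal (C1_topology L)) (nonneg_solutions p L a)"

definition slice :: "(real \<times> 'a) set \<Rightarrow> real \<Rightarrow> 'a set" where
  "slice D lam = {u. (lam, u) \<in> D}"

definition bumps :: "real \<Rightarrow> (real \<Rightarrow> real) \<Rightarrow> real set set" where
  "bumps L u = components {x\<in>{0<..<L}. 0 < u x}"

definition occurs_at :: "(real \<Rightarrow> real) \<Rightarrow> real set \<Rightarrow> real \<Rightarrow> bool" where
  "occurs_at u I x \<longleftrightarrow> x \<in> I \<and> (\<forall>y\<in>I. u y \<le> u x)"

definition bump_point :: "(real \<Rightarrow> real) \<Rightarrow> real set \<Rightarrow> real" where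
  "bump_point u I = (THE x. occurs_at u I x)"

text \<open>The vector \<open>(x\<^sub>1,\<dots>,x\<^sub>j)\<close>, \<open>x\<^sub>1 < \<dots> < x\<^sub>j\<close>, of bump points of a function with exactly \<open>j\<close> bumps.
  Points of \<open>\<real>\<^sup>j\<close> are functions in \<^term>\<open>extensional {1..j}\<close>.\<close>

definition bump_vector :: "real \<Rightarrow> nat \<Rightarrow> (real \<Rightarrow> real) \<Rightarrow> nat \<Rightarrow> real" where
  "bump_vector L j u = (\<lambda>i\<in>{1..j}. sorted_list_of_set (bump_point u ` bumps L u) ! (i - 1))"


section \<open>Thresholds and simplices\<close>

definition sigma_thr :: "real \<Rightarrow> nat \<Rightarrow> real" where
  "sigma_thr L j = (real j * pi / L)\<^sup>2"

definition Sigma_thr :: "real \<Rightarrow> real \<Rightarrow> nat \<Rightarrow> real" where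
  "Sigma_thr p L j = (2 / (1 - p))\<^sup>2 * sigma_thr L j"

definition T_H :: "real \<Rightarrow> real \<Rightarrow> real" where
  "T_H p lam = pi / (sqrt lam * (1 - p))"

definition bump_simplex :: "real \<Rightarrow> real \<Rightarrow> nat \<Rightarrow> real \<Rightarrow> (nat \<Rightarrow> real) set" where
  "bump_simplex p L j lam = {x \<in> extensional {1..j}.
     T_H p lam \<le> x 1 \<and> (\<forall>i\<in>{2..j}. 2 * T_H p lam \<le> x i - x (i - 1)) \<and> x j \<le> L - T_H p lam}"

end

theory Submission
  imports Defs
begin

text \<open>The theorem rests on energy conservation together with a change of variables that makes the
zero energy level explicit.  Along a nonnegative solution the quantity
\<open>u'\<^sup>2 + \<lambda>u\<^sup>2 - 2a/(p+1) u\<^sup>p\<^sup>+\<^sup>1\<close> is constant, and evaluated at the left end point it is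
\<open>u'(0)\<^sup>2 \<ge> 0\<close>.  Since \<open>p < 1\<close> the nonlinearity is not Lipschitz at \<open>0\<close>, so a solution of zero energy may
reach \<open>0\<close> with slope \<open>0\<close>, rest there, and leave again.

Put \<open>k = 2/(1-p) > 2\<close>.  On an interval of positivity with left end \<open>\<alpha>\<close> and maximum \<open>M\<close>, write
\<open>u = M sin\<^sup>k \<psi>\<close> and \<open>b = 2a/((p+1)\<lambda>M\<^sup>1\<^sup>-\<^sup>p)\<close>.  Conservation of energy turns into the statement that
\<open>b \<in> (0,1]\<close> and \<open>S\<^sub>b(\<psi>(x)) = \<surd>\<lambda> (x - \<alpha>)\<close>, where \<open>S\<^sub>b(t) = \<integral>\<^sub>0\<^sup>t K\<^sub>b\<close> and the kernel \<open>K\<^sub>b\<close> is explicit and takes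
values in \<open>[0,k]\<close> (\<open>positive_interval_profile\<close>).  Hence \<open>M\<close> determines the solution on the interval,
and the length of the interval is \<open>S\<^sub>b(\<pi>)/\<surd>\<lambda>\<close>.

If \<open>b = 1\<close> (zero energy), then \<open>K\<^sub>1 = k\<close>: the bump is a power of a cosine of the fixed width \<open>2T\<^sub>H(\<lambda>)\<close>, and
since \<open>k > 2\<close> its extension by zero is of class \<open>C\<^sup>2\<close>.  A solution of zero energy is therefore a sum of
translates of one bump with disjoint supports, and the set of its centres is a point of the simplex
(\<open>flat_solution_is_superposition\<close>).  If \<open>b < 1\<close>, the slope is nonzero at the ends of the bump, so one
bump fills \<open>(0,L)\<close> and \<open>S\<^sub>b(\<pi>) = \<surd>\<lambda> L\<close>.  As \<open>b\<close> runs through \<open>[0,1]\<close>, the length \<open>S\<^sub>b(\<pi>)\<close> increases strictly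
and continuously from \<open>\<pi>\<close> to \<open>k\<pi>\<close> (\<open>quad_strict_mono_param\<close>, \<open>continuous_on_quad_param\<close>, \<open>quad_zero\<close>,
\<open>quad_one\<close>), so there is exactly one such solution for \<open>\<lambda>\<close> strictly between \<open>\<sigma>\<^sub>1\<close> and \<open>\<Sigma>\<^sub>1\<close>; at \<open>\<Sigma>\<^sub>1\<close> the
same formula gives the bump of zero energy that fills \<open>[0,L]\<close>.  As \<open>\<lambda>\<close> decreases to \<open>\<sigma>\<^sub>1\<close>, the
parameter \<open>b\<close> tends to \<open>0\<close> and \<open>M\<close> to infinity.

The components are then the sets of solutions with exactly \<open>j\<close> bumps.  Each is connected, because the
simplices depend on \<open>\<lambda>\<close> only through \<open>T\<^sub>H(\<lambda>)\<close> and the pairs of \<open>T\<^sub>H\<close> and centres form a convex set, and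
because for \<open>j = 1\<close> the curve below \<open>\<Sigma>\<^sub>1\<close> meets the bumps above \<open>\<Sigma>\<^sub>1\<close> at \<open>\<Sigma>\<^sub>1\<close> (\<open>connectedin_branch\<close>).
Each is open, because for \<open>\<lambda> > \<Sigma>\<^sub>1\<close> the quotient of \<open>\<integral>u\<close> by the integral of one bump is a continuous
function whose value is the number of bumps (\<open>openin_branch\<close>).  On a slice, the map from centres to
solutions is a continuous bijection of a compact simplex onto a Hausdorff space, hence a
homeomorphism, and its inverse is the vector of bump points (\<open>homeomorphic_map_bump_vector\<close>).\<close>

section \<open>One-variable calculus\<close>

lemma has_integral_finite_exceptions:
  fixes f g :: "real \<Rightarrow> real"
  assumes "finite E" "continuous_on {a..b} f"
    and der: "\<And>x. x \<in> {a<..<b} - E \<Longrightarrow> (f has_real_derivative g x) (at x)"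
    and y: "y \<in> {a..b}"
  shows "(g has_integral (f y - f a)) {a..y}"
proof (rule fundamental_theorem_of_calculus_interior_strong[OF \<open>finite E\<close>])
  show "a \<le> y" using y by simp
  show "(f has_vector_derivative g x) (at x)" if "x \<in> {a<..<y} - E" for x
    using der[of x] that y by (auto simp: has_real_derivative_iff_has_vector_derivative)
  show "continuous_on {a..y} f"
    using assms(2) by (rule continuous_on_subset) (use y in auto)
qed

text \<open>Used to pass through the points where a formula for the derivative degenerates: the ends and the
peak of a bump.  The fundamental theorem of calculus identifies \<open>f\<close> with an antiderivative of the
continuous function \<open>g\<close>.\<close>

lemma has_derivative_finite_exceptions:
  fixes f g :: "real \<Rightarrow> real"
  assumes "finite E" "continuous_on {a..b} f" "continuous_on {a..b} g"
    and der: "\<And>x. x \<in> {a<..<b} - E \<Longrightarrow> (f has_real_derivative g x) (at x)"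
    and x: "x \<in> {a..b}"
  shows "(f has_real_derivative g x) (at x within {a..b})"
proof -
  have "((\<lambda>u. integral {a..u} g) has_vector_derivative g x) (at x within {a..b})"
    using integral_has_vector_derivative[OF assms(3) x] .
  then have "((\<lambda>y. f a + integral {a..y} g) has_vector_derivative g x) (at x within {a..b})"
    by (auto intro!: derivative_eq_intros)
  moreover have "f a + integral {a..y} g = f y" if "y \<in> {a..b}" for y
    using integral_unique[OF has_integral_finite_exceptions[OF assms(1,2) der that]] by simp
  ultimately have "(f has_vector_derivative g x) (at x within {a..b})"
    using has_vector_derivative_transform[OF x] by (metis (no_types, lifting))
  then show ?thesis
    by (simp add: has_real_derivative_iff_has_vector_derivative)
qed

lemma constant_finite_exceptions:
  fixes f :: "real \<Rightarrow> real"
  assumes "finite E" "continuous_on {a..b} f"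
    and "\<And>x. x \<in> {a<..<b} - E \<Longrightarrow> (f has_real_derivative 0) (at x)"
    and "x \<in> {a..b}"
  shows "f x = f a"
proof -
  have "((\<lambda>_. 0) has_integral (f x - f a)) {a..x}"
    by (rule has_integral_finite_exceptions[OF assms])
  then show ?thesis
    using has_integral_unique has_integral_0 by (metis eq_iff_diff_eq_0)
qed

lemma continuous_on_powr_const:
  fixes f :: "'a::topological_space \<Rightarrow> real"
  assumes "continuous_on S f" "\<And>x. x \<in> S \<Longrightarrow> 0 \<le> f x" "0 < q"
  shows "continuous_on S (\<lambda>x. f x powr q)"
  using assms by (intro continuous_on_powr' continuous_on_const) auto

text \<open>Exponents larger than \<open>1\<close> make the power differentiable also at \<open>0\<close>; energy conservation needs this
at the zeros of a solution.\<close>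

lemma has_real_derivative_powr_nonneg:
  fixes q x :: real
  assumes "1 < q" "0 \<le> x"
  shows "((\<lambda>s. s powr q) has_real_derivative q * x powr (q - 1)) (at x within {0..})"
proof (cases "x = 0")
  case False
  then have "((\<lambda>s. s powr q) has_real_derivative q * x powr (q - 1)) (at x)"
    using assms by (intro has_real_derivative_powr) simp
  then show ?thesis by (rule has_field_derivative_at_within)
next
  case True
  have "continuous_on {0..} (\<lambda>s::real. s powr (q - 1))"
    using assms by (intro continuous_on_powr' continuous_intros) auto
  then have "((\<lambda>s. s powr (q - 1)) \<longlongrightarrow> 0 powr (q - 1)) (at (0::real) within {0..})"
    unfolding continuous_on_def by (rule bspec) simp
  then have "((\<lambda>s. s powr (q - 1)) \<longlongrightarrow> 0) (at (0::real) within {0..})"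
    by simp
  then have "((\<lambda>s. (s powr q - 0 powr q) / (s - 0)) \<longlongrightarrow> 0) (at (0::real) within {0..})"
  proof (rule Lim_transform_eventually)
    show "\<forall>\<^sub>F s in at 0 within {0..}. s powr (q - 1) = (s powr q - 0 powr q) / (s - 0)"
      by (auto simp: eventually_at_filter powr_diff)
  qed
  then show ?thesis
    using True assms by (simp add: has_field_derivative_iff)
qed

section \<open>The phase integral\<close>

text \<open>The slope of the chord of \<open>s\<^sup>k\<close> from \<open>s\<close> to \<open>1\<close>, completed continuously at \<open>s = 1\<close>.\<close>

definition chord_slope :: "real \<Rightarrow> real \<Rightarrow> real" where
  "chord_slope k s = (if s = 1 then k else (1 - s powr k) / (1 - s))"

text \<open>With \<open>s = sin\<^sup>2 \<psi>\<close>, the rescaled equation for \<open>v = sin\<^sup>k \<psi>\<close> reads \<open>v'\<^sup>2 = (1 - s) speed_sq k b s\<close>; see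
\<open>profile_energy_sin\<close>.  The factor \<open>1 - s\<close>, which vanishes at the peak, has been split off.\<close>

definition speed_sq :: "real \<Rightarrow> real \<Rightarrow> real \<Rightarrow> real" where
  "speed_sq k b s = b * s powr (k - 1) + (1 - b) * chord_slope k s"

text \<open>The reciprocal of the phase velocity \<open>\<psi>'\<close>.  At \<open>\<psi> = 0\<close> and \<open>\<psi> = \<pi>\<close> the value is \<open>0\<close> for every \<open>b\<close>, also for
\<open>b = 1\<close> where the denominator vanishes too; these points do not affect the integral, and with this
convention the kernel converges at every point when \<open>b\<close> converges.\<close>

definition quad_kernel :: "real \<Rightarrow> real \<Rightarrow> real \<Rightarrow> real" where
  "quad_kernel k b t = k * ((sin t)\<^sup>2) powr ((k - 1) / 2) / sqrt (speed_sq k b ((sin t)\<^sup>2))"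

definition quad :: "real \<Rightarrow> real \<Rightarrow> real \<Rightarrow> real" where
  "quad k b t = integral {0..t} (quad_kernel k b)"

lemma continuous_chord_slope:
  assumes "0 < k" shows "continuous_on {0..} (chord_slope k)"
proof -
  have "continuous (at s within {0..}) (chord_slope k)" if "0 \<le> s" for s
  proof (cases "s = 1")
    case False
    have "continuous (at s within {0..}) (\<lambda>s. (1 - s powr k) / (1 - s))"
      unfolding continuous_within
    proof (rule tendsto_divide)
      have "continuous_on {0..} (\<lambda>s::real. s powr k)"
        using assms by (intro continuous_on_powr_const continuous_on_id) auto
      then have "((\<lambda>s::real. s powr k) \<longlongrightarrow> s powr k) (at s within {0..})"
        using that unfolding continuous_on_def by simp
      then show "((\<lambda>s::real. 1 - s powr k) \<longlongrightarrow> 1 - s powr k) (at s within {0..})"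
        by (rule tendsto_diff[OF tendsto_const])
    qed (use False in \<open>auto intro!: tendsto_intros\<close>)
    then show ?thesis
    proof (rule continuous_transform_within)
      show "0 < dist s 1" "s \<in> {0..}" using False that by auto
      show "(1 - t powr k) / (1 - t) = chord_slope k t" if "t \<in> {0..}" "dist t s < dist s 1" for t
        using that by (auto simp: chord_slope_def dist_commute)
    qed
  next
    case True
    have "((\<lambda>s. s powr k) has_real_derivative k * 1 powr (k - 1)) (at (1::real))"
      by (rule has_real_derivative_powr) simp
    then have "((\<lambda>s. (s powr k - 1) / (s - 1)) \<longlongrightarrow> k) (at (1::real))"
      by (simp add: has_field_derivative_iff)
    then have "((\<lambda>s. chord_slope k s) \<longlongrightarrow> k) (at 1)"
    proof (rule Lim_transform_eventually)
      show "\<forall>\<^sub>F s in at 1. (s powr k - 1) / (s - 1) = chord_slope k s"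
        by (auto simp: eventually_at_filter chord_slope_def field_simps)
    qed
    then have "isCont (chord_slope k) 1"
      unfolding isCont_def by (simp add: chord_slope_def[of k 1])
    then show ?thesis using True continuous_at_imp_continuous_within by blast
  qed
  then show ?thesis by (simp add: continuous_on_eq_continuous_within)
qed

lemma chord_slope_ge_1:
  assumes "1 < k" "0 \<le> s" "s \<le> 1" shows "1 \<le> chord_slope k s"
proof (cases "s = 1")
  case False
  have "s powr k \<le> s powr 1" using assms by (intro powr_mono') auto
  then show ?thesis using False assms by (simp add: chord_slope_def field_simps)
qed (use assms in \<open>auto simp: chord_slope_def\<close>)

text \<open>This strict inequality is the reason why both the positivity of the speed and the strict
monotonicity of the length in \<open>b\<close> hold: \<open>speed_sq\<close> is a convex combination of its two sides.\<close>

lemma powr_less_chord_slope: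
  assumes "1 < k" "0 \<le> s" "s \<le> 1" shows "s powr (k - 1) < chord_slope k s"
proof (cases "s = 1")
  case False
  have "s powr (k-1) < 1 powr (k-1)" using assms False by (intro powr_less_mono2) auto
  then show ?thesis using chord_slope_ge_1[OF assms] by simp
qed (use assms in \<open>auto simp: chord_slope_def\<close>)

lemma one_minus_mult_speed_sq:
  assumes "1 < k" "0 \<le> s"
  shows "(1 - s) * speed_sq k b s = (1 - b) + b * s powr (k - 1) - s powr k"
proof (cases "s = 1")
  case False
  have "s powr k = s * s powr (k - 1)"
    using assms powr_add[of s 1 "k-1"] by (cases "s = 0") auto
  then show ?thesis using False
    by (simp add: speed_sq_def chord_slope_def field_simps)
qed simp

lemma powr_le_speed_sq:
  assumes "1 < k" "0 \<le> s" "s \<le> 1" "0 \<le> b" "b \<le> 1"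
  shows "s powr (k - 1) \<le> speed_sq k b s"
proof -
  have "(1 - b) * s powr (k - 1) \<le> (1 - b) * chord_slope k s"
    using powr_less_chord_slope[OF assms(1-3)] assms by (intro mult_left_mono) auto
  then show ?thesis by (simp add: speed_sq_def algebra_simps)
qed

lemma speed_sq_pos:
  assumes "1 < k" "0 < s" "s \<le> 1" "0 \<le> b" "b \<le> 1"
  shows "0 < speed_sq k b s"
  using powr_le_speed_sq[of k s b] assms powr_gt_zero[of s "k-1"] by linarith

lemma speed_sq_nonneg:
  assumes "1 < k" "0 \<le> s" "s \<le> 1" "0 \<le> b" "b \<le> 1"
  shows "0 \<le> speed_sq k b s"
  using powr_le_speed_sq[of k s b] assms powr_ge_zero[of s "k-1"] by linarith

lemma continuous_on_speed_sq:
  assumes "1 < k" 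
  shows "continuous_on (UNIV \<times> {0..}) (\<lambda>(b, s). speed_sq k b s)"
proof -
  have "continuous_on (UNIV \<times> {0..}) (\<lambda>q::real \<times> real. chord_slope k (snd q))"
    by (rule continuous_on_compose2[OF continuous_chord_slope])
       (use assms in \<open>auto intro!: continuous_intros\<close>)
  then have "continuous_on (UNIV \<times> {0..})
     (\<lambda>q::real \<times> real. fst q * snd q powr (k - 1) + (1 - fst q) * chord_slope k (snd q))"
    using assms by (intro continuous_on_add continuous_on_mult continuous_on_powr_const
        continuous_on_diff continuous_on_fst continuous_on_snd continuous_on_const continuous_on_id) auto
  then show ?thesis by (simp add: speed_sq_def case_prod_unfold)
qed

text \<open>The bound is uniform in \<open>b\<close> and serves as the dominating function for \<open>b \<rightarrow> 1\<close>.  In this limit the kernel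
behaves badly at the ends of the bump: it tends to \<open>0\<close> there for each \<open>b < 1\<close>, and is equal to \<open>k\<close> in the
interior for \<open>b = 1\<close>.\<close>

lemma quad_kernel_bounds:
  assumes "1 < k" "0 \<le> b" "b \<le> 1"
  shows "0 \<le> quad_kernel k b t" "quad_kernel k b t \<le> k"
proof -
  define s where "s = (sin t)\<^sup>2"
  have s: "0 \<le> s" "s \<le> 1" by (auto simp: s_def abs_square_le_1)
  have sp: "s powr (k - 1) \<le> speed_sq k b s" "0 \<le> speed_sq k b s"
    using powr_le_speed_sq speed_sq_nonneg assms s by auto
  have "s powr ((k - 1)/2) = sqrt (s powr (k - 1))"
    by (simp add: powr_half_sqrt[symmetric] powr_powr)
  also have "\<dots> \<le> sqrt (speed_sq k b s)" using sp by simp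
  finally have "s powr ((k - 1)/2) / sqrt (speed_sq k b s) \<le> 1"
    using sp by (cases "speed_sq k b s = 0") (auto simp: divide_le_eq_1)
  then have "k * (s powr ((k - 1)/2) / sqrt (speed_sq k b s)) \<le> k * 1"
    using assms by (intro mult_left_mono) auto
  then show "quad_kernel k b t \<le> k" by (simp add: quad_kernel_def s_def)
  show "0 \<le> quad_kernel k b t" using sp assms by (simp add: quad_kernel_def s_def[symmetric])
qed

lemma integrable_quad_kernel:
  assumes "1 < k" "0 \<le> b" "b \<le> 1"
  shows "quad_kernel k b integrable_on {c..d}"
proof (rule measurable_bounded_by_integrable_imp_integrable_real)
  have "quad_kernel k b \<in> borel_measurable borel"
    unfolding quad_kernel_def speed_sq_def chord_slope_def by measurable
  then show "quad_kernel k b \<in> borel_measurable (lebesgue_on {c..d})"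
    by (intro measurable_restrict_space1 measurable_completion) auto
  show "(\<lambda>_. k) integrable_on {c..d}" by (rule integrable_const_ivl)
qed (use quad_kernel_bounds[OF assms] in auto)

lemma isCont_quad_kernel:
  assumes "1 < k" "0 \<le> b" "b \<le> 1" "0 < t" "t < pi"
  shows "isCont (quad_kernel k b) t" "0 < quad_kernel k b t"
proof -
  have s: "0 < (sin x)\<^sup>2" "(sin x)\<^sup>2 \<le> 1" if "0 < x" "x < pi" for x
    using sin_gt_zero[OF that] by (auto simp: abs_square_le_1)
  have "continuous_on {0<..<pi} (\<lambda>t. speed_sq k b ((sin t)\<^sup>2))"
    by (rule continuous_on_compose2[OF continuous_on_speed_sq[OF assms(1)],
          of _ "\<lambda>t. (b, (sin t)\<^sup>2)", simplified])
       (auto intro!: continuous_intros)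
  then have "continuous_on {0<..<pi} (quad_kernel k b)"
    unfolding quad_kernel_def
    using s speed_sq_pos[OF assms(1) _ _ assms(2,3)] assms
    by (intro continuous_on_divide continuous_on_mult continuous_on_powr_const continuous_on_real_sqrt
         continuous_on_power continuous_on_const continuous_on_sin continuous_on_id) 
       (auto simp: less_imp_neq[THEN not_sym])
  then show "isCont (quad_kernel k b) t"
    using assms by (simp add: continuous_on_eq_continuous_at)
  show "0 < quad_kernel k b t"
    using s[of t] speed_sq_pos[OF assms(1) _ _ assms(2,3), of "(sin t)\<^sup>2"] assms
    by (simp add: quad_kernel_def)
qed

lemma continuous_on_quad:
  assumes "1 < k" "0 \<le> b" "b \<le> 1"
  shows "continuous_on {0..pi} (quad k b)"
  unfolding quad_def by (rule indefinite_integral_continuous_1[OF integrable_quad_kernel[OF assms]])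

lemma DERIV_quad:
  assumes "1 < k" "0 \<le> b" "b \<le> 1" "0 < t" "t < pi"
  shows "(quad k b has_real_derivative quad_kernel k b t) (at t)"
proof -
  have "((\<lambda>u. integral {0..u} (quad_kernel k b)) has_vector_derivative quad_kernel k b t)
     (at t within {0..pi})"
    by (rule integral_has_vector_derivative_continuous_at[where S="{}", simplified])
       (use assms integrable_quad_kernel
          continuous_at_imp_continuous_at_within[OF isCont_quad_kernel(1)[OF assms]] in auto)
  then have "(quad k b has_real_derivative quad_kernel k b t) (at t within {0..pi})"
    unfolding quad_def[abs_def] has_real_derivative_iff_has_vector_derivative .
  then show ?thesis
    using assms at_within_Icc_at[of 0 t pi] by simp
qed

lemma quad_0 [simp]: "quad k b 0 = 0"
  by (simp add: quad_def)

lemma quad_strict_mono: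
  assumes "1 < k" "0 \<le> b" "b \<le> 1" "0 \<le> x" "x < y" "y \<le> pi"
  shows "quad k b x < quad k b y"
proof (rule DERIV_pos_imp_increasing_open[OF \<open>x < y\<close>])
  show "continuous_on {x..y} (quad k b)"
    using continuous_on_quad[OF assms(1-3)] by (rule continuous_on_subset) (use assms in auto)
qed (use DERIV_quad isCont_quad_kernel assms in \<open>meson less_le_trans le_less_trans\<close>)

text \<open>Dominated convergence with the constant \<open>k\<close>; uniform convergence of the kernels fails as \<open>b \<rightarrow> 1\<close>.\<close>

lemma continuous_on_quad_param:
  assumes "1 < k" "0 \<le> t" "t \<le> pi"
  shows "continuous_on {0..1} (\<lambda>b. quad k b t)"
  unfolding continuous_on_sequentially
proof (intro ballI allI impI)
  fix X :: "nat \<Rightarrow> real" and b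
  assume b: "b \<in> {0..1}" and X: "(\<forall>n. X n \<in> {0..1}) \<and> X \<longlonglongrightarrow> b"
  have lim: "(\<lambda>n. quad_kernel k (X n) r) \<longlonglongrightarrow> quad_kernel k b r" for r
  proof (cases "sin r = 0")
    case True
    then show ?thesis by (simp add: quad_kernel_def)
  next
    case False
    then have s: "0 < (sin r)\<^sup>2" "(sin r)\<^sup>2 \<le> 1" by (auto simp: abs_square_le_1)
    have "(\<lambda>n. speed_sq k (X n) ((sin r)\<^sup>2)) \<longlonglongrightarrow> speed_sq k b ((sin r)\<^sup>2)"
      unfolding speed_sq_def using X by (auto intro!: tendsto_intros)
    then show ?thesis
      unfolding quad_kernel_def using speed_sq_pos[OF assms(1) s] b
      by (intro tendsto_intros) (auto simp: less_imp_neq[THEN not_sym])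
  qed
  have "(\<lambda>n. integral {0..t} (quad_kernel k (X n))) \<longlonglongrightarrow> integral {0..t} (quad_kernel k b)"
    by (rule dominated_convergence(2)[where h="\<lambda>_. k"])
       (use X assms lim integrable_quad_kernel quad_kernel_bounds in auto)
  then show "((\<lambda>b. quad k b t) \<circ> X) \<longlonglongrightarrow> quad k b t"
    by (simp add: o_def quad_def)
qed

lemma quad_kernel_strict_mono_param:
  assumes "1 < k" "0 \<le> b" "b < c" "c \<le> 1" "0 < t" "t < pi"
  shows "quad_kernel k b t < quad_kernel k c t"
proof -
  define s where "s = (sin t)\<^sup>2"
  have s: "0 < s" "s \<le> 1" using sin_gt_zero[of t] assms by (auto simp: s_def abs_square_le_1)
  have "(c - b) * s powr (k - 1) < (c - b) * chord_slope k s"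
    using powr_less_chord_slope[of k s] assms s by (intro mult_strict_left_mono) auto
  then have "speed_sq k c s < speed_sq k b s"
    by (simp add: speed_sq_def algebra_simps)
  moreover have "0 < speed_sq k c s" using speed_sq_pos[of k s c] assms s by auto
  ultimately show ?thesis
    unfolding quad_kernel_def s_def[symmetric] using assms s
    by (intro divide_strict_left_mono) auto
qed

lemma quad_strict_mono_param:
  assumes "1 < k" "0 \<le> b" "b < c" "c \<le> 1"
  shows "quad k b pi < quad k c pi"
proof -
  have "quad k c 0 - quad k b 0 < quad k c pi - quad k b pi"
  proof (rule DERIV_pos_imp_increasing_open[where f="\<lambda>t. quad k c t - quad k b t"])
    show "continuous_on {0..pi} (\<lambda>t. quad k c t - quad k b t)"
      using assms by (intro continuous_on_diff continuous_on_quad) auto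
    show "\<exists>y. ((\<lambda>t. quad k c t - quad k b t) has_real_derivative y) (at t) \<and> 0 < y"
      if "0 < t" "t < pi" for t
    proof (intro exI conjI)
      show "((\<lambda>t. quad k c t - quad k b t) has_real_derivative
              (quad_kernel k c t - quad_kernel k b t)) (at t)"
        using assms that by (intro DERIV_diff DERIV_quad) auto
    qed (use quad_kernel_strict_mono_param[OF assms that] in simp)
  qed simp
  then show ?thesis by simp
qed

lemma quad_one:
  assumes "1 < k" "0 \<le> t" "t \<le> pi"
  shows "quad k 1 t = k * t"
proof -
  have "quad k 1 t - k * t = quad k 1 0 - k * 0"
  proof (rule constant_finite_exceptions[of "{}" 0 pi "\<lambda>t. quad k 1 t - k * t"])
    show "continuous_on {0..pi} (\<lambda>t. quad k 1 t - k * t)"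
      using assms by (intro continuous_intros continuous_on_quad) auto
    show "((\<lambda>t. quad k 1 t - k * t) has_real_derivative 0) (at x)" if "x \<in> {0<..<pi} - {}" for x
    proof -
      have "0 < (sin x)\<^sup>2" using that sin_gt_zero[of x] by auto
      then have "quad_kernel k 1 x = k"
        by (simp add: quad_kernel_def speed_sq_def powr_half_sqrt[symmetric] powr_powr)
      then show ?thesis
        using DERIV_quad[of k 1 x] assms that by (auto intro!: derivative_eq_intros)
    qed
  qed (use assms in auto)
  then show ?thesis by simp
qed

section \<open>From a profile to its phase\<close>

text \<open>The right-hand side of \<open>v'\<^sup>2 = \<lambda> profile_energy k b v\<close> for the solution \<open>u = M v\<close> scaled to maximum \<open>1\<close>;
the exponent \<open>2 - 2/k\<close> is \<open>p + 1\<close>.\<close>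

definition profile_energy :: "real \<Rightarrow> real \<Rightarrow> real \<Rightarrow> real" where
  "profile_energy k b v = (1 - b) + b * v powr (2 - 2 / k) - v\<^sup>2"

lemma profile_energy_sin:
  assumes "1 < k" "0 \<le> w"
  shows "profile_energy k b (w powr k) = (1 - w\<^sup>2) * speed_sq k b (w\<^sup>2)"
proof -
  have e: "k * (2 - 2 / k) = 2 * (k - 1)" using assms by (simp add: field_simps)
  have sq: "w\<^sup>2 = w powr 2" using assms by simp
  have "(w powr k) powr (2 - 2 / k) = (w\<^sup>2) powr (k - 1)"
    by (simp only: sq powr_powr e)
  moreover have "(w powr k)\<^sup>2 = (w\<^sup>2) powr k"
  proof -
    have "(w powr k)\<^sup>2 = (w powr k) powr 2" by simp
    also have "\<dots> = (w\<^sup>2) powr k" by (simp only: sq powr_powr mult.commute)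
    finally show ?thesis .
  qed
  ultimately show ?thesis
    using one_minus_mult_speed_sq[of k "w\<^sup>2" b] assms by (simp add: profile_energy_def)
qed

lemma profile_energy_pos:
  assumes "1 < k" "0 < v" "v < 1" "0 \<le> b" "b \<le> 1"
  shows "0 < profile_energy k b v"
proof -
  define w where "w = v powr (1 / k)"
  have "0 < w" "w < 1" using assms powr_less_mono2[of "1/k" v 1] by (auto simp: w_def)
  then have "0 < (1 - w\<^sup>2) * speed_sq k b (w\<^sup>2)"
    using assms by (intro mult_pos_pos speed_sq_pos) (auto simp: abs_square_less_1 power_le_one)
  moreover have "v = w powr k" using assms by (simp add: w_def powr_powr)
  ultimately show ?thesis
    using profile_energy_sin[of k w b] assms \<open>0 < w\<close> by simp
qed

text \<open>The substitution \<open>v = sin\<^sup>k \<psi>\<close> turns the first-order equation for \<open>v\<close> into \<open>(S\<^sub>b \<circ> \<psi>)' = m\<close>.  The two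
branches of the phase serve the two sides of the peak.\<close>

lemma DERIV_quad_arcsin:
  assumes k: "1 < k" and b: "0 \<le> b" "b \<le> 1" and v: "0 < v x" "v x < 1"
    and der: "(v has_real_derivative m * sqrt (profile_energy k b (v x))) (at x)"
  shows "((\<lambda>x. quad k b (arcsin (v x powr (1 / k)))) has_real_derivative m) (at x)"
    and "((\<lambda>x. quad k b (pi - arcsin (v x powr (1 / k)))) has_real_derivative - m) (at x)"
proof -
  define w where "w = v x powr (1 / k)"
  have w: "0 < w" "w < 1" using k v powr_less_mono2[of "1/k" "v x" 1] by (auto simp: w_def)
  have vw: "v x = w powr k" using v k by (simp add: w_def powr_powr)
  have w2: "w\<^sup>2 < 1" using w by (simp add: abs_square_less_1)
  have sp: "0 < speed_sq k b (w\<^sup>2)" using speed_sq_pos[of k "w\<^sup>2" b] w w2 k b by auto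
  have dw: "((\<lambda>x. arcsin (v x powr (1 / k))) has_real_derivative
      inverse (sqrt (1 - w\<^sup>2)) * ((1 / k) * v x powr (1/k - 1) * (m * sqrt (profile_energy k b (v x))))) (at x)"
    (is "(_ has_real_derivative ?d) _")
  proof -
    have "((\<lambda>x. v x powr (1 / k)) has_real_derivative
       (1 / k) * v x powr (1/k - 1) * (m * sqrt (profile_energy k b (v x)))) (at x)"
      by (rule DERIV_chain2[where f="\<lambda>y. y powr (1/k)", OF has_real_derivative_powr[OF v(1)] der])
    moreover have "(arcsin has_real_derivative inverse (sqrt (1 - w\<^sup>2))) (at (v x powr (1/k)))"
      unfolding w_def[symmetric] using w by (intro DERIV_arcsin) auto
    ultimately show ?thesis
      by (intro DERIV_chain2[where f=arcsin])
  qed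
  have asn: "0 < arcsin w" "arcsin w < pi / 2" "sin (arcsin w) = w"
    using w arcsin_less_mono[of 0 w] arcsin_less_mono[of w 1] by auto
  have kern: "quad_kernel k b t * ?d = m" if t: "(sin t)\<^sup>2 = w\<^sup>2" for t
  proof -
    have "(w\<^sup>2) powr ((k - 1) / 2) = w powr (k - 1)"
    proof -
      have "w\<^sup>2 = w powr 2" "2 * ((k - 1) / 2) = k - 1" using w by simp_all
      then show ?thesis by (simp only: powr_powr)
    qed
    moreover have "v x powr (1/k - 1) = w powr (1 - k)"
    proof -
      have "k * (1/k - 1) = 1 - k" using k by (simp add: field_simps)
      then show ?thesis by (simp add: vw powr_powr)
    qed
    moreover have "w powr (k - 1) * w powr (1 - k) = 1"
      using w by (simp flip: powr_add)
    moreover have "sqrt (profile_energy k b (v x)) = sqrt (1 - w\<^sup>2) * sqrt (speed_sq k b (w\<^sup>2))"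
      using profile_energy_sin[of k w b] k w by (simp add: vw real_sqrt_mult)
    ultimately show ?thesis
      unfolding quad_kernel_def t using k sp w2 by (simp add: field_simps)
  qed
  have "(quad k b has_real_derivative quad_kernel k b (arcsin w)) (at (arcsin (v x powr (1/k))))"
    unfolding w_def[symmetric] using asn by (intro DERIV_quad k b) auto
  from DERIV_chain2[where f="quad k b", OF this dw]
  show "((\<lambda>x. quad k b (arcsin (v x powr (1 / k)))) has_real_derivative m) (at x)"
    using kern[of "arcsin w"] asn by simp
  have dp: "((\<lambda>x. pi - arcsin (v x powr (1 / k))) has_real_derivative - ?d) (at x)"
    using DERIV_diff[OF DERIV_const dw, of pi] by simp
  have "(quad k b has_real_derivative quad_kernel k b (pi - arcsin w)) (at (pi - arcsin (v x powr (1/k))))"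
    unfolding w_def[symmetric] using asn by (intro DERIV_quad k b) auto
  from DERIV_chain2[where f="quad k b", OF this dp]
  show "((\<lambda>x. quad k b (pi - arcsin (v x powr (1 / k)))) has_real_derivative - m) (at x)"
    using kern[of "pi - arcsin w"] asn by simp
qed

text \<open>The hypotheses describe a bump \<open>v\<close> of height \<open>1\<close> that obeys the first-order equation away from its
peak; the conclusion determines \<open>v\<close> completely, since \<open>S\<^sub>b\<close> is strictly increasing.\<close>

lemma quad_profile:
  assumes k: "1 < k" and b: "0 \<le> b" "b \<le> 1" and c: "al < c" "c < ga"
    and cont: "continuous_on {al..ga} v" and v: "v al = 0" "v ga = 0" "v c = 1"
    and pos: "\<And>x. x \<in> {al<..<ga} - {c} \<Longrightarrow> 0 < v x \<and> v x < 1"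
    and left: "\<And>x. x \<in> {al<..<c} \<Longrightarrow> (v has_real_derivative m * sqrt (profile_energy k b (v x))) (at x)"
    and right: "\<And>x. x \<in> {c<..<ga} \<Longrightarrow> (v has_real_derivative - m * sqrt (profile_energy k b (v x))) (at x)"
  obtains \<psi> where "\<And>x. x \<in> {al..ga} \<Longrightarrow> \<psi> x \<in> {0..pi}"
    "\<And>x. x \<in> {al..ga} \<Longrightarrow> v x = sin (\<psi> x) powr k"
    "\<And>x. x \<in> {al..ga} \<Longrightarrow> quad k b (\<psi> x) = m * (x - al)" "\<psi> ga = pi"
proof
  define \<psi> where "\<psi> x = (if x \<le> c then arcsin (v x powr (1/k)) else pi - arcsin (v x powr (1/k)))" for x
  have v01: "0 \<le> v x" "v x \<le> 1" if "x \<in> {al..ga}" for x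
    using pos[of x] v that by (cases "x \<in> {al, ga, c}"; force)+
  have w01: "0 \<le> v x powr (1/k)" "v x powr (1/k) \<le> 1" if "x \<in> {al..ga}" for x
    using v01[OF that] k powr_mono2[of "1/k" "v x" 1] by auto
  have as: "0 \<le> arcsin (v x powr (1/k))" "arcsin (v x powr (1/k)) \<le> pi / 2"
    if "x \<in> {al..ga}" for x
    using w01[OF that] arcsin_le_mono[of 0 "v x powr (1/k)"]
      arcsin_ubound[OF order_trans[OF _ w01(1)[OF that]] w01(2)[OF that]]
    by auto
  show rng: "\<psi> x \<in> {0..pi}" if "x \<in> {al..ga}" for x
    using as[OF that] by (auto simp: \<psi>_def)
  show "v x = sin (\<psi> x) powr k" if "x \<in> {al..ga}" for x
  proof -
    have "- 1 \<le> v x powr (1/k)" using w01(1)[OF that] by linarith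
    then have "sin (\<psi> x) = v x powr (1/k)" using w01(2)[OF that] by (simp add: \<psi>_def)
    then show ?thesis using v01[OF that] k by (simp add: powr_powr)
  qed
  show "\<psi> ga = pi" using c v by (auto simp: \<psi>_def)
  have contw: "continuous_on {al..ga} (\<lambda>x. arcsin (v x powr (1/k)))"
  proof (rule continuous_on_arcsin)
    show "continuous_on {al..ga} (\<lambda>x. v x powr (1/k))"
      using cont v01 k by (intro continuous_on_powr_const) auto
    show "\<forall>x\<in>{al..ga}. -1 \<le> v x powr (1/k) \<and> v x powr (1/k) \<le> 1"
      using w01 by (meson order_trans neg_le_0_iff_le zero_le_one)
  qed
  have "continuous_on ({al..c} \<union> {c..ga}) \<psi>"
    unfolding \<psi>_def
  proof (rule continuous_on_If)
    show "continuous_on {al..c} (\<lambda>x. arcsin (v x powr (1/k)))"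
      using contw by (rule continuous_on_subset) (use c in auto)
    have "continuous_on {c..ga} (\<lambda>x. arcsin (v x powr (1/k)))"
      using contw by (rule continuous_on_subset) (use c in auto)
    then show "continuous_on {c..ga} (\<lambda>x. pi - arcsin (v x powr (1/k)))"
      by (intro continuous_on_diff continuous_on_const)
    show "arcsin (v x powr (1/k)) = pi - arcsin (v x powr (1/k))" if "x \<in> {c..ga}" "x \<le> c" for x
    proof -
      have "x = c" using that by auto
      then show ?thesis using v by simp
    qed
  qed (use c in auto)
  moreover have "{al..c} \<union> {c..ga} = {al..ga}" using c by auto
  ultimately have cpsi: "continuous_on {al..ga} \<psi>" by simp
  have const: "quad k b (\<psi> x) - m * x = quad k b (\<psi> al) - m * al" if x: "x \<in> {al..ga}" for x
  proof (rule constant_finite_exceptions[of "{c}" al ga "\<lambda>x. quad k b (\<psi> x) - m * x", OF _ _ _ x])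
    have "continuous_on {al..ga} (\<lambda>x. quad k b (\<psi> x))"
      using continuous_on_compose2[OF continuous_on_quad[OF k b] cpsi] rng by blast
    then show "continuous_on {al..ga} (\<lambda>x. quad k b (\<psi> x) - m * x)"
      by (intro continuous_intros)
    fix x assume x: "x \<in> {al<..<ga} - {c}"
    have "((\<lambda>x. quad k b (\<psi> x)) has_real_derivative m) (at x)"
    proof (cases "x < c")
      case True
      have "((\<lambda>x. quad k b (arcsin (v x powr (1/k)))) has_real_derivative m) (at x)"
        using DERIV_quad_arcsin(1)[OF k b, of v x m] pos[of x] left[of x] x True by auto
      then show ?thesis
        by (rule has_field_derivative_transform_within_open[where S="{..<c}"])
           (use True in \<open>auto simp: \<psi>_def\<close>)
    next
      case False
      have "((\<lambda>x. quad k b (pi - arcsin (v x powr (1/k)))) has_real_derivative m) (at x)"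
        using DERIV_quad_arcsin(2)[OF k b, of v x "-m"] pos[of x] right[of x] x False by auto
      then show ?thesis
        by (rule has_field_derivative_transform_within_open[where S="{c<..}"])
           (use x False in \<open>auto simp: \<psi>_def\<close>)
    qed
    then show "((\<lambda>x. quad k b (\<psi> x) - m * x) has_real_derivative 0) (at x)"
      by (auto intro!: derivative_eq_intros)
  qed simp
  have "\<psi> al = 0" using c v by (simp add: \<psi>_def)
  then show "quad k b (\<psi> x) = m * (x - al)" if "x \<in> {al..ga}" for x
    using const[OF that] by (simp add: algebra_simps)
qed

text \<open>For \<open>b = 0\<close> the profile equation is \<open>v'\<^sup>2 = 1 - v\<^sup>2\<close>, which \<open>sin\<close> solves on \<open>[0,\<pi>]\<close>; so the length of this
bump gives the value of the integral without computing it.\<close>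

lemma quad_zero:
  assumes "1 < k" shows "quad k 0 pi = pi"
proof -
  have s: "sin x < 1" if "0 < x" "x < pi" "x \<noteq> pi/2" for x :: real
    using sin_monotone_2pi[of x "pi/2"] sin_monotone_2pi[of "pi - x" "pi/2"] that
    by (cases "x < pi/2") auto
  obtain \<psi> where "\<And>x. x \<in> {0..pi} \<Longrightarrow> quad k 0 (\<psi> x) = 1 * (x - 0)" "\<psi> pi = pi"
  proof (rule quad_profile[of k 0 0 "pi/2" pi sin 1])
    show "continuous_on {0..pi} (sin :: real \<Rightarrow> real)" by (intro continuous_intros)
    show "0 < sin x \<and> sin x < 1" if "x \<in> {0<..<pi} - {pi / 2}" for x :: real
      using that s[of x] sin_gt_zero[of x] by auto
    show "(sin has_real_derivative 1 * sqrt (profile_energy k 0 (sin x))) (at x)"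
      if "x \<in> {0<..<pi/2}" for x
    proof -
      have "sqrt (1 - (sin x)\<^sup>2) = cos x"
        using that cos_gt_zero[of x] by (simp flip: cos_squared_eq)
      then show ?thesis using DERIV_sin[of x] by (simp add: profile_energy_def)
    qed
    show "(sin has_real_derivative - 1 * sqrt (profile_energy k 0 (sin x))) (at x)"
      if "x \<in> {pi/2<..<pi}" for x
    proof -
      have "cos x < 0" using that cos_gt_zero_pi[of "pi - x"] by (simp add: cos_diff)
      then have "sqrt (1 - (sin x)\<^sup>2) = - cos x" 
        by (simp flip: cos_squared_eq)
      then show ?thesis using DERIV_sin[of x] by (simp add: profile_energy_def)
    qed
  qed (use assms pi_gt_zero in auto)
  from this(1)[of pi] this(2) show ?thesis by simp
qed

section \<open>Classical solutions and their energy\<close>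

lemma mspace_C0_iff:
  "u \<in> mspace (C0_metric L) \<longleftrightarrow> u \<in> extensional {0..L} \<and> continuous_on {0..L} u"
proof -
  have "bounded (u ` {0..L})" if "continuous_on {0..L} u"
    using compact_continuous_image[OF that compact_Icc] compact_imp_bounded by blast
  then show ?thesis by auto
qed

lemma D_on_eqI:
  assumes "0 < L" "x \<in> {0..L}" "(u has_real_derivative d) (at x within {0..L})"
  shows "D_on L u x = d"
  using assms vector_derivative_within_cbox[of 0 L x u d]
  by (simp add: D_on_def has_real_derivative_iff_has_vector_derivative)

lemma D_on_works:
  assumes "x \<in> {0..L}" "u differentiable_on {0..L}"
  shows "(u has_real_derivative D_on L u x) (at x within {0..L})"
  using assms vector_derivative_works[of u "at x within {0..L}"]
  by (simp add: D_on_def has_real_derivative_iff_has_vector_derivative differentiable_on_def)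

lemma in_C1_spaceI:
  assumes "0 < L" "u \<in> extensional {0..L}" "continuous_on {0..L} du"
    and der: "\<And>x. x \<in> {0..L} \<Longrightarrow> (u has_real_derivative du x) (at x within {0..L})"
  shows "u \<in> C1_space L"
proof -
  have "u differentiable_on {0..L}"
    unfolding differentiable_on_def real_differentiable_def using der by blast
  moreover have "continuous_on {0..L} u"
    by (rule DERIV_continuous_on) (rule der)
  moreover have "continuous_on {0..L} (D_on L u)"
    using assms(3) by (rule continuous_on_eq) (use D_on_eqI[OF assms(1) _ der] in auto)
  moreover have "D_on L u \<in> extensional {0..L}" by (simp add: D_on_def)
  ultimately show ?thesis using assms(2) by (simp add: C1_space_def mspace_C0_iff del: mspace_cfunspace)
qed

lemma is_solutionD:
  assumes "is_solution p L a lam u"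
  shows "u \<in> extensional {0..L}" "u 0 = 0" "u L = 0" "u \<in> C1_space L"
    "x \<in> {0..L} \<Longrightarrow> (u has_real_derivative D_on L u x) (at x within {0..L})"
    "x \<in> {0..L} \<Longrightarrow> (D_on L u has_real_derivative (a * (\<bar>u x\<bar> powr (p - 1) * u x) - lam * u x))
       (at x within {0..L})"
proof -
  have u: "u \<in> C1_space L" "D_on L u \<in> C1_space L"
    using assms by (auto simp: is_solution_def C2_space_def)
  then have d: "u differentiable_on {0..L}" "D_on L u differentiable_on {0..L}"
    by (auto simp: C1_space_def)
  show "u \<in> extensional {0..L}" using u by (simp add: C1_space_def mspace_C0_iff del: mspace_cfunspace)
  show "u 0 = 0" "u L = 0" "u \<in> C1_space L" using assms u by (auto simp: is_solution_def)
  show "(u has_real_derivative D_on L u x) (at x within {0..L})" if "x \<in> {0..L}"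
    using D_on_works[OF that d(1)] .
  show "(D_on L u has_real_derivative (a * (\<bar>u x\<bar> powr (p - 1) * u x) - lam * u x))
       (at x within {0..L})" if "x \<in> {0..L}"
  proof -
    have "D_on L (D_on L u) x = a * (\<bar>u x\<bar> powr (p - 1) * u x) - lam * u x"
      using assms that unfolding is_solution_def by force
    then show ?thesis using D_on_works[OF that d(2)] by simp
  qed
qed

lemma is_solutionI:
  assumes "0 < L" "u \<in> extensional {0..L}" "u 0 = 0" "u L = 0"
    and du: "\<And>x. x \<in> {0..L} \<Longrightarrow> (u has_real_derivative du x) (at x within {0..L})"
    and ddu: "\<And>x. x \<in> {0..L} \<Longrightarrow> (du has_real_derivative ddu x) (at x within {0..L})"
    and cont: "continuous_on {0..L} ddu"
    and ode: "\<And>x. x \<in> {0..L} \<Longrightarrow> - ddu x = lam * u x - a * (\<bar>u x\<bar> powr (p - 1) * u x)"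
  shows "is_solution p L a lam u"
proof -
  have Du: "D_on L u x = du x" if "x \<in> {0..L}" for x
    using D_on_eqI[OF assms(1) that du[OF that]] .
  have DDu: "(D_on L u has_real_derivative ddu x) (at x within {0..L})" if "x \<in> {0..L}" for x
    using ddu[OF that]
    by (rule has_field_derivative_transform_within[where d=1]) (use that Du in auto)
  have "u \<in> C1_space L"
    using in_C1_spaceI[OF assms(1,2) _ du] DERIV_continuous_on[OF ddu] by blast
  moreover have "D_on L u \<in> C1_space L"
    using in_C1_spaceI[OF assms(1) _ cont DDu] by (simp add: D_on_def)
  moreover have "D_on L (D_on L u) x = ddu x" if "x \<in> {0..L}" for x
    using D_on_eqI[OF assms(1) that DDu[OF that]] .
  ultimately show ?thesis
    using assms ode by (auto simp: is_solution_def C2_space_def)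
qed

lemma pos_if_nonzero_interval:
  fixes f :: "real \<Rightarrow> real"
  assumes "continuous_on {a<..<b} f" "\<And>x. x \<in> {a<..<b} \<Longrightarrow> f x \<noteq> 0"
    "z \<in> {a<..<b}" "0 < f z" "x \<in> {a<..<b}"
  shows "0 < f x"
proof (rule ccontr)
  assume "\<not> 0 < f x"
  have "connected (f ` {a<..<b})"
    using assms(1) by (rule connected_continuous_image) (simp add: connected_Ioo)
  then have "0 \<in> f ` {a<..<b}"
    by (rule connectedD_interval[of _ "f x" "f z"]) (use assms \<open>\<not> 0 < f x\<close> in auto)
  then show False using assms(2) by force
qed

locale sublinear_problem =
  fixes p L a :: real
  assumes p: "0 < p" "p < 1" and L: "0 < L" and a: "0 < a"
begin

text \<open>The exponent for which \<open>u = w\<^sup>k\<close> turns the zero-energy equation into \<open>w'\<^sup>2 = A - (\<lambda>/k\<^sup>2) w\<^sup>2\<close>, the equation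
of a cosine.\<close>

definition k :: real where "k = 2 / (1 - p)"

lemma k_gt: "2 < k" "1 < k" "0 < k" "k \<noteq> 0"
proof -
  show "2 < k" using p by (simp add: k_def field_simps)
  then show "1 < k" "0 < k" "k \<noteq> 0" by auto
qed

lemma k_p: "2 - 2 / k = p + 1" "k * p = k - 2"
  using p by (auto simp: k_def field_simps)

lemma nonneg_solutionsD:
  assumes "(lam, u) \<in> nonneg_solutions p L a"
  shows "is_solution p L a lam u" "x \<in> {0..L} \<Longrightarrow> 0 \<le> u x" "\<exists>x\<in>{0..L}. 0 < u x"
    "x \<in> {0..L} \<Longrightarrow> (D_on L u has_real_derivative (a * u x powr p - lam * u x)) (at x within {0..L})"
proof -
  show sol: "is_solution p L a lam u" and nn: "x \<in> {0..L} \<Longrightarrow> 0 \<le> u x" for x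
    using assms by (auto simp: nonneg_solutions_def)
  show "\<exists>x\<in>{0..L}. 0 < u x" using assms nn by (force simp: nonneg_solutions_def)
  have "\<bar>u x\<bar> powr (p - 1) * u x = u x powr p" if "x \<in> {0..L}"
    using nn[OF that] powr_mult_base[of "u x" "p - 1"] by (cases "u x = 0") (auto simp: mult.commute)
  then show "(D_on L u has_real_derivative (a * u x powr p - lam * u x)) (at x within {0..L})" 
    if "x \<in> {0..L}"
    using is_solutionD(6)[OF sol that] that by simp
qed

text \<open>At the zeros of \<open>u\<close> the term \<open>u\<^sup>p\<^sup>+\<^sup>1\<close> is differentiated as a one-sided power, which suffices because \<open>u\<close>
takes values in \<open>[0,\<infinity>)\<close>.\<close>

lemma energy_conservation:
  assumes sol: "(lam, u) \<in> nonneg_solutions p L a" and x: "x \<in> {0..L}"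
  shows "(D_on L u x)\<^sup>2 + lam * (u x)\<^sup>2 - 2 * a / (p + 1) * u x powr (p + 1) = (D_on L u 0)\<^sup>2"
proof -
  note s = nonneg_solutionsD[OF sol] is_solutionD[OF nonneg_solutionsD(1)[OF sol]]
  define W where "W x = u x powr (p + 1)" for x
  define C where "C = 2 * a / (p + 1)"
  have C: "C * (p + 1) = 2 * a" using p by (simp add: C_def)
  let ?E = "\<lambda>x. (D_on L u x)\<^sup>2 + lam * (u x)\<^sup>2 - C * W x"
  have der: "(?E has_real_derivative 0) (at x within {0..L})" if x: "x \<in> {0..L}" for x
  proof -
    have "((\<lambda>s. s powr (p + 1)) has_real_derivative (p + 1) * u x powr p) (at (u x) within (u ` {0..L}))"
    proof (rule DERIV_subset)
      show "((\<lambda>s. s powr (p + 1)) has_real_derivative (p + 1) * u x powr p) (at (u x) within {0..})"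
        using has_real_derivative_powr_nonneg[of "p + 1" "u x"] p s(2)[OF x] by simp
      show "u ` {0..L} \<subseteq> {0..}" using s(2) by auto
    qed
    moreover have Weq: "W = (\<lambda>s. s powr (p + 1)) \<circ> u" by (simp add: W_def fun_eq_iff)
    ultimately have "(W has_real_derivative (p + 1) * u x powr p * D_on L u x) (at x within {0..L})"
      using DERIV_image_chain s(9)[OF x] by blast
    note d = this s(9)[OF x] s(4)[OF x]
    have "(?E has_real_derivative (2 * D_on L u x * (a * u x powr p - lam * u x)
        + lam * (2 * u x * D_on L u x) - C * ((p + 1) * u x powr p * D_on L u x))) (at x within {0..L})"
      using DERIV_diff[OF DERIV_add[OF DERIV_power[OF d(3), of 2] DERIV_cmult[OF DERIV_power[OF d(2), of 2], of lam]]
          DERIV_cmult[OF d(1), of C]]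
      by (rule DERIV_cong) simp
    moreover have "C * ((p + 1) * u x powr p * D_on L u x) = 2 * a * (u x powr p * D_on L u x)"
      using C by (metis mult.assoc)
    moreover have "2 * D_on L u x * (a * u x powr p - lam * u x) + lam * (2 * u x * D_on L u x)
        = 2 * a * (u x powr p * D_on L u x)"
      by (simp add: algebra_simps)
    ultimately show ?thesis by simp
  qed
  have "?E x = ?E 0"
  proof (rule constant_finite_exceptions[of "{}" 0 L ?E, OF _ _ _ x])
    show "continuous_on {0..L} ?E" by (rule DERIV_continuous_on) (rule der)
    show "(?E has_real_derivative 0) (at x)" if "x \<in> {0<..<L} - {}" for x
      using der[of x] that at_within_Icc_at[of 0 x L] by simp
  qed simp
  then show ?thesis using s(6) p by (simp add: W_def C_def)
qed

text \<open>The structure of a solution on an interval of positivity.  By energy conservation \<open>u' = 0\<close> forces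
\<open>u = M\<close> there, and two points of height \<open>M\<close> would enclose a plateau, on which the equation fails because
\<open>b (p + 1) < 2\<close>.  So the peak is unique, \<open>u\<close> is monotone on either side of it, and the phase integral
applies to \<open>u/M\<close>.\<close>

lemma positive_interval_profile:
  assumes sol: "(lam, u) \<in> nonneg_solutions p L a"
    and I: "0 \<le> al" "al < ga" "ga \<le> L" "u al = 0" "u ga = 0"
    and pos: "\<And>x. x \<in> {al<..<ga} \<Longrightarrow> 0 < u x"
  obtains M b c \<psi> where "0 < lam" "0 < M" "0 < b" "b \<le> 1" "b = 1 \<longleftrightarrow> D_on L u 0 = 0"
    "b * lam * M powr (1 - p) = 2 * a / (p + 1)" "al < c" "c < ga" "u c = M" "\<psi> ga = pi"
    "\<And>x. x \<in> {al<..<ga} - {c} \<Longrightarrow> u x < M"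
    "\<And>x. x \<in> {al..ga} \<Longrightarrow> \<psi> x \<in> {0..pi}"
    "\<And>x. x \<in> {al..ga} \<Longrightarrow> u x = M * sin (\<psi> x) powr k"
    "\<And>x. x \<in> {al..ga} \<Longrightarrow> quad k b (\<psi> x) = sqrt lam * (x - al)"
proof -
  note s = nonneg_solutionsD[OF sol] is_solutionD[OF nonneg_solutionsD(1)[OF sol]]
  define du where "du = D_on L u"
  have sub: "x \<in> {0..L}" if "x \<in> {al..ga}" for x using that I by auto
  have du: "(u has_real_derivative du x) (at x)" if "x \<in> {0<..<L}" for x
    using s(9)[of x] that at_within_Icc_at[of 0 x L] by (simp add: du_def)
  have ddu: "(du has_real_derivative (a * u x powr p - lam * u x)) (at x)" if "x \<in> {0<..<L}" for x
    using s(4)[of x] that at_within_Icc_at[of 0 x L] by (simp add: du_def)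
  have cu: "continuous_on {0..L} u" by (rule DERIV_continuous_on) (rule s(9))
  have cdu: "continuous_on {0..L} du" unfolding du_def by (rule DERIV_continuous_on) (rule s(4))
  have cual: "continuous_on {al..ga} u" using cu by (rule continuous_on_subset) (use sub in auto)
  obtain c where c: "c \<in> {al..ga}" and cmax: "\<And>x. x \<in> {al..ga} \<Longrightarrow> u x \<le> u c"
    using continuous_attains_sup[OF compact_Icc _ cual] I by force
  define M where "M = u c"
  have M: "0 < M" using pos[of "(al + ga) / 2"] cmax[of "(al + ga) / 2"] I by (auto simp: M_def)
  have c: "al < c" "c < ga" using c M I unfolding M_def by (cases "c = al"; cases "c = ga"; force)+
  have duc: "du c = 0"
  proof (rule DERIV_local_max)
    show "(u has_real_derivative du c) (at c)" using du c I by auto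
    show "0 < min (c - al) (ga - c)" using c by simp
    show "\<forall>y. \<bar>c - y\<bar> < min (c - al) (ga - c) \<longrightarrow> u y \<le> u c"
      using cmax by (auto simp: abs_less_iff)
  qed
  define C where "C = 2 * a / (p + 1)"
  have C: "0 < C" using a p by (simp add: C_def)
  have en: "(du x)\<^sup>2 + lam * (u x)\<^sup>2 - C * u x powr (p + 1) = (du 0)\<^sup>2" if "x \<in> {0..L}" for x
    using energy_conservation[OF sol that] by (simp add: du_def C_def)
  define P where "P = M powr (1 - p)"
  have P: "0 < P" using M by (simp add: P_def)
  have Mp: "M powr (p + 1) = M\<^sup>2 / P"
  proof -
    have "M powr (p + 1) * P = M powr 2" by (simp add: P_def flip: powr_add)
    also have "\<dots> = M\<^sup>2" using M by simp
    finally show ?thesis using P by (simp add: field_simps)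
  qed
  have en_c: "(du 0)\<^sup>2 = lam * M\<^sup>2 - C * M\<^sup>2 / P"
    using en[of c] c I duc by (simp add: M_def[symmetric] Mp)
  then have "0 \<le> (lam - C / P) * M\<^sup>2" by (metis left_diff_distrib times_divide_eq_left zero_le_power2)
  then have lamCP: "C / P \<le> lam" using M by (simp add: zero_le_mult_iff)
  then have lam: "0 < lam" using C P by (meson divide_pos_pos less_le_trans)
  define b where "b = C / (lam * P)"
  have b: "0 < b" "b \<le> 1" using lam C P lamCP by (auto simp: b_def field_simps)
  have blP: "b * lam * P = C" using lam P by (simp add: b_def)
  have CP: "C / P = b * lam" using blP P by (simp add: field_simps)
  have b1: "b = 1 \<longleftrightarrow> du 0 = 0"
  proof -
    have "(du 0)\<^sup>2 = lam * M\<^sup>2 * (1 - b)"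
    proof -
      have "(du 0)\<^sup>2 = lam * M\<^sup>2 - (C / P) * M\<^sup>2" using en_c by simp
      then show ?thesis unfolding CP by (simp add: algebra_simps)
    qed
    then show ?thesis using lam M by auto
  qed
  have en2: "(du x)\<^sup>2 = lam * M\<^sup>2 * profile_energy k b (u x / M)" if x: "x \<in> {0..L}" for x
  proof -
    have "C * u x powr (p + 1) = C * (M powr (p + 1) * (u x / M) powr (p + 1))"
      using M s(2)[OF x] by (simp flip: powr_mult)
    also have "\<dots> = (C / P) * M\<^sup>2 * (u x / M) powr (p + 1)" by (simp add: Mp)
    finally have "C * u x powr (p + 1) = b * lam * M\<^sup>2 * (u x / M) powr (p + 1)" unfolding CP .
    moreover have "(du 0)\<^sup>2 = lam * M\<^sup>2 - b * lam * M\<^sup>2" using en_c unfolding CP[symmetric] by simp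
    ultimately have "(du x)\<^sup>2 = lam * M\<^sup>2 - b * lam * M\<^sup>2 - lam * (u x)\<^sup>2 + b * lam * M\<^sup>2 * (u x / M) powr (p + 1)"
      using en[OF x] by linarith
    moreover have "(u x)\<^sup>2 = M\<^sup>2 * (u x / M)\<^sup>2" using M by (simp add: power_divide)
    ultimately show ?thesis by (simp add: profile_energy_def k_p algebra_simps)
  qed
  have crit: "du x \<noteq> 0" if "x \<in> {0..L}" "0 < u x" "u x < M" for x
  proof
    assume "du x = 0"
    then have "profile_energy k b (u x / M) = 0" using en2[OF that(1)] lam M by simp
    moreover have "0 < profile_energy k b (u x / M)"
      using that M b k_gt by (intro profile_energy_pos) auto
    ultimately show False by simp
  qed
  \<comment> \<open>a value below \<open>M\<close> between the two points would produce a critical point of height less than \<open>M\<close>\<close>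
  have no_plateau: False if lr: "al < l" "l < r" "r < ga" and eq: "u l = M" "u r = M" for l r
  proof -
    have clr: "continuous_on {l..r} u" using cual by (rule continuous_on_subset) (use lr in auto)
    obtain m where m: "m \<in> {l..r}" "\<And>x. x \<in> {l..r} \<Longrightarrow> u m \<le> u x"
      using continuous_attains_inf[OF compact_Icc _ clr] lr by force
    have "M \<le> u m"
    proof (rule ccontr)
      assume "\<not> M \<le> u m"
      then have um: "u m < M" by simp
      have ml: "l < m" "m < r" using m um eq lr by (auto simp: less_le)
      have "du m = 0"
      proof (rule DERIV_local_min)
        show "(u has_real_derivative du m) (at m)" using du ml lr I by auto
        show "0 < min (m - l) (r - m)" using ml by simp
        show "\<forall>y. \<bar>m - y\<bar> < min (m - l) (r - m) \<longrightarrow> u m \<le> u y"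
          using m(2) by (auto simp: abs_less_iff)
      qed
      moreover have "du m \<noteq> 0" using crit[of m] pos[of m] um ml lr I by auto
      ultimately show False by simp
    qed
    then have uM: "u x = M" if "x \<in> {l..r}" for x
      using m(2)[OF that] cmax[of x] that lr by (auto simp: M_def)
    have du0: "du x = 0" if "x \<in> {l<..<r}" for x
    proof -
      have "((\<lambda>_. M) has_real_derivative du x) (at x)"
        by (rule has_field_derivative_transform_within_open[where S="{l<..<r}" and f=u])
           (use that uM du lr I in auto)
      then show ?thesis using DERIV_unique DERIV_const by blast
    qed
    define m where "m = (l + r) / 2"
    have m: "m \<in> {l<..<r}" using lr by (simp add: m_def)
    have "((\<lambda>_. 0) has_real_derivative (a * u m powr p - lam * u m)) (at m)"
      by (rule has_field_derivative_transform_within_open[where S="{l<..<r}" and f=du])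
         (use m du0 ddu lr I in auto)
    then have "a * u m powr p - lam * u m = 0" using DERIV_unique DERIV_const by blast
    then have *: "a * M powr p = lam * M" using uM[of m] m by simp
    have "M powr p * P = M" using M by (simp add: P_def flip: powr_add)
    then have "a * M = lam * M * P" using * by (metis mult.assoc)
    then have "a = lam * P" using M by simp
    moreover have "b * (lam * P) * (p + 1) = 2 * a" using blP p by (simp add: C_def mult.assoc)
    ultimately have "b * (p + 1) = 2" using a lam P by auto
    moreover have "b * (p + 1) < 2"
    proof -
      have "b * (p + 1) \<le> 1 * (p + 1)" using b p by (intro mult_right_mono) auto
      then show ?thesis by (rule le_less_trans) (use p in simp)
    qed
    ultimately show False by simp
  qed
  have less: "u x < M" if "x \<in> {al<..<ga} - {c}" for x
  proof (rule ccontr)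
    assume "\<not> u x < M"
    moreover have "u x \<le> M" using cmax[of x] that by (simp add: M_def)
    ultimately have ux: "u x = M" by simp
    have uc: "u c = M" by (simp add: M_def)
    show False
    proof (cases "x < c")
      case True
      show False by (rule no_plateau[OF _ True _ ux uc]) (use that c in auto)
    next
      case False
      then have "c < x" using that by auto
      then show False by (rule no_plateau[OF c(1) _ _ uc ux]) (use that in auto)
    qed
  qed
  have nz: "du x \<noteq> 0" if "x \<in> {al<..<ga} - {c}" for x
    using crit[of x] less[OF that] pos[of x] that I by auto
  have mono: "\<exists>z>x. z < y \<and> u y - u x = (y - x) * du z" if xy: "al \<le> x" "x < y" "y \<le> ga" for x y
  proof -
    obtain l z where z: "x < z" "z < y" "(u has_real_derivative l) (at z)" "u y - u x = (y - x) * l"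
    proof -
      have "continuous_on {x..y} u" using cual by (rule continuous_on_subset) (use xy in auto)
      moreover have "u differentiable (at z)" if "x < z" "z < y" for z
        using du[of z] that xy I real_differentiable_def by auto
      ultimately show ?thesis using MVT[OF xy(2), of u] that by blast
    qed
    moreover have "l = du z" using DERIV_unique[OF z(3) du[of z]] z xy I by auto
    ultimately show ?thesis by auto
  qed
  have cdu': "continuous_on {x<..<y} du" if "al \<le> x" "y \<le> ga" for x y
    using cdu by (rule continuous_on_subset) (use that I in auto)
  have up: "0 < du x" if x: "x \<in> {al<..<c}" for x
  proof -
    obtain z where z: "al < z" "z < c" "u c - u al = (c - al) * du z" using mono[of al c] c by auto
    then have "0 < (c - al) * du z" using I M by (simp add: M_def)
    then have "0 < du z" using c by (simp add: zero_less_mult_iff)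
    then show ?thesis
      using pos_if_nonzero_interval[of al c du z x] cdu'[of al c] nz z c x by auto
  qed
  have down: "0 < - du x" if x: "x \<in> {c<..<ga}" for x
  proof -
    obtain z where z: "c < z" "z < ga" "u ga - u c = (ga - c) * du z" using mono[of c ga] c by auto
    then have "(ga - c) * du z < 0" using I M by (simp add: M_def)
    then have "0 < - du z" using c by (simp add: mult_less_0_iff)
    then show ?thesis
      using pos_if_nonzero_interval[of c ga "\<lambda>x. - du x" z x] continuous_on_minus[OF cdu'[of c ga]] nz z c x
      by auto
  qed
  have dv: "((\<lambda>x. u x / M) has_real_derivative
      (if x < c then sqrt lam else - sqrt lam) * sqrt (profile_energy k b (u x / M))) (at x)"
    if x: "x \<in> {al<..<ga} - {c}" for x
  proof -
    have "sqrt ((du x)\<^sup>2) = sqrt lam * M * sqrt (profile_energy k b (u x / M))"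
      using en2[of x] x I M by (simp add: real_sqrt_mult)
    then have "\<bar>du x\<bar> / M = sqrt lam * sqrt (profile_energy k b (u x / M))"
      using M by simp
    moreover have "du x = (if x < c then \<bar>du x\<bar> else - \<bar>du x\<bar>)"
      using up[of x] down[of x] x by auto
    ultimately have "du x / M = (if x < c then sqrt lam else - sqrt lam) * sqrt (profile_energy k b (u x / M))"
      by (smt (verit) minus_divide_left mult_minus_left)
    then show ?thesis using DERIV_cdivide[OF du[of x], of M] x I by auto
  qed
  obtain \<psi> where psi: "\<And>x. x \<in> {al..ga} \<Longrightarrow> \<psi> x \<in> {0..pi}"
    "\<And>x. x \<in> {al..ga} \<Longrightarrow> u x / M = sin (\<psi> x) powr k"
    "\<And>x. x \<in> {al..ga} \<Longrightarrow> quad k b (\<psi> x) = sqrt lam * (x - al)" "\<psi> ga = pi"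
  proof (rule quad_profile[of k b al c ga "\<lambda>x. u x / M" "sqrt lam"])
    show "continuous_on {al..ga} (\<lambda>x. u x / M)"
      using cual M by (intro continuous_on_divide continuous_on_const) auto
    show "u al / M = 0" "u ga / M = 0" "u c / M = 1" using I M by (auto simp: M_def)
    show "0 < u x / M \<and> u x / M < 1" if "x \<in> {al<..<ga} - {c}" for x
      using pos[of x] less[OF that] that M by auto
    show "((\<lambda>x. u x / M) has_real_derivative sqrt lam * sqrt (profile_energy k b (u x / M))) (at x)"
      if "x \<in> {al<..<c}" for x using dv[of x] that c by auto
    show "((\<lambda>x. u x / M) has_real_derivative - sqrt lam * sqrt (profile_energy k b (u x / M))) (at x)"
      if "x \<in> {c<..<ga}" for x using dv[of x] that c by auto
  qed (use k_gt b c in auto)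
  show thesis
  proof (rule that)
    show "b = 1 \<longleftrightarrow> D_on L u 0 = 0" using b1 by (simp add: du_def)
    show "b * lam * M powr (1 - p) = 2 * a / (p + 1)" using blP by (simp add: P_def C_def)
    show "u x = M * sin (\<psi> x) powr k" if "x \<in> {al..ga}" for x
      using psi(2)[OF that] M by (simp add: field_simps)
  qed (use lam M b c psi less M_def in auto)
qed

end

section \<open>Profiles as functions of the parameter\<close>

definition quad_inv :: "real \<Rightarrow> real \<Rightarrow> real \<Rightarrow> real" where
  "quad_inv k b y = inv_into {0..pi} (quad k b) y"

definition profile :: "real \<Rightarrow> real \<Rightarrow> real \<Rightarrow> real" where
  "profile k b y = sin (quad_inv k b y) powr k"

definition profile' :: "real \<Rightarrow> real \<Rightarrow> real \<Rightarrow> real" where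
  "profile' k b y = cos (quad_inv k b y) * sqrt (speed_sq k b ((sin (quad_inv k b y))\<^sup>2))"

lemma inj_on_quad:
  assumes "1 < k" "0 \<le> b" "b \<le> 1" shows "inj_on (quad k b) {0..pi}"
  by (rule linorder_inj_onI) (use quad_strict_mono[OF assms] in \<open>force+\<close>)

lemma quad_inv:
  assumes "1 < k" "0 \<le> b" "b \<le> 1" "0 \<le> y" "y \<le> quad k b pi"
  shows "quad_inv k b y \<in> {0..pi}" "quad k b (quad_inv k b y) = y"
proof -
  have "\<exists>t\<ge>0. t \<le> pi \<and> quad k b t = y"
    by (rule IVT') (use assms continuous_on_quad in auto)
  then have y: "y \<in> quad k b ` {0..pi}" by auto
  show "quad_inv k b y \<in> {0..pi}" "quad k b (quad_inv k b y) = y"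
    unfolding quad_inv_def using inv_into_into[OF y] f_inv_into_f[OF y] by auto
qed

lemma quad_inv_quad:
  assumes "1 < k" "0 \<le> b" "b \<le> 1" "t \<in> {0..pi}"
  shows "quad_inv k b (quad k b t) = t"
  unfolding quad_inv_def using inv_into_f_f[OF inj_on_quad assms(4)] assms by auto

lemma quad_less_iff:
  assumes "1 < k" "0 \<le> b" "b \<le> 1" "s \<in> {0..pi}" "t \<in> {0..pi}"
  shows "quad k b s < quad k b t \<longleftrightarrow> s < t"
  using quad_strict_mono[OF assms(1-3), of s t] quad_strict_mono[OF assms(1-3), of t s] assms
  by (cases s t rule: linorder_cases) auto

abbreviation phase_domain :: "real \<Rightarrow> (real \<times> real) set" where
  "phase_domain k \<equiv> {(b, y). 0 \<le> b \<and> b \<le> 1 \<and> 0 \<le> y \<and> y \<le> quad k b pi}"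

text \<open>Joint continuity of the inverse functions follows from monotonicity and from continuity of
\<open>b \<mapsto> S\<^sub>b(t)\<close> for each fixed \<open>t\<close>: the phase at \<open>(b,y)\<close> exceeds \<open>t\<close> if and only if \<open>S\<^sub>b(t) < y\<close>.\<close>

lemma continuous_on_quad_inv:
  assumes k: "1 < k"
  shows "continuous_on (phase_domain k) (\<lambda>(b, y). quad_inv k b y)"
    (is "continuous_on ?S ?f")
  unfolding continuous_on_def
proof
  fix q0 assume q0: "q0 \<in> ?S"
  have S: "\<forall>\<^sub>F q in at q0 within ?S. q \<in> ?S" by (auto simp: eventually_at_filter)
  have ev: "((\<lambda>q. quad k (fst q) t - snd q) \<longlongrightarrow> quad k (fst q0) t - snd q0) (at q0 within ?S)"
    if t: "t \<in> {0..pi}" for t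
  proof -
    have "continuous_on ?S (\<lambda>q. quad k (fst q) t)"
      by (rule continuous_on_compose2[OF continuous_on_quad_param[OF k]])
         (use t in \<open>auto intro!: continuous_intros\<close>)
    then have "continuous_on ?S (\<lambda>q. quad k (fst q) t - snd q)" by (intro continuous_intros)
    then show ?thesis using q0 unfolding continuous_on_def by blast
  qed
  show "(?f \<longlongrightarrow> ?f q0) (at q0 within ?S)"
  proof (rule order_tendstoI)
    fix t assume t: "t < ?f q0"
    show "\<forall>\<^sub>F q in at q0 within ?S. t < ?f q"
    proof (cases "0 \<le> t")
      case False
      from S show ?thesis 
        by eventually_elim (use False quad_inv(1)[OF k] in force)
    next
      case True
      have t0: "t \<in> {0..pi}" using True t q0 quad_inv(1)[OF k, of "fst q0" "snd q0"] by auto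
      have "quad k (fst q0) t < quad k (fst q0) (?f q0)"
        using t t0 q0 quad_inv(1)[OF k, of "fst q0" "snd q0"]
        by (subst quad_less_iff[OF k]) auto
      then have "quad k (fst q0) t - snd q0 < 0"
        using quad_inv(2)[OF k, of "fst q0" "snd q0"] q0 by auto
      from order_tendstoD(2)[OF ev[OF t0] this] S show ?thesis
      proof eventually_elim
        case (elim q)
        then have "quad k (fst q) t < quad k (fst q) (?f q)"
          using quad_inv(2)[OF k, of "fst q" "snd q"] by auto
        then show ?case using elim quad_inv(1)[OF k, of "fst q" "snd q"] t0
          by (subst (asm) quad_less_iff[OF k]) auto
      qed
    qed
  next
    fix t assume t: "?f q0 < t"
    show "\<forall>\<^sub>F q in at q0 within ?S. ?f q < t"
    proof (cases "t \<le> pi")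
      case False
      from S show ?thesis 
        by eventually_elim (use False quad_inv(1)[OF k] in force)
    next
      case True
      have t0: "t \<in> {0..pi}" using True t q0 quad_inv(1)[OF k, of "fst q0" "snd q0"] by auto
      have "quad k (fst q0) (?f q0) < quad k (fst q0) t"
        using t t0 q0 quad_inv(1)[OF k, of "fst q0" "snd q0"]
        by (subst quad_less_iff[OF k]) auto
      then have "0 < quad k (fst q0) t - snd q0"
        using quad_inv(2)[OF k, of "fst q0" "snd q0"] q0 by auto
      from order_tendstoD(1)[OF ev[OF t0] this] S show ?thesis
      proof eventually_elim
        case (elim q)
        then have "quad k (fst q) (?f q) < quad k (fst q) t"
          using quad_inv(2)[OF k, of "fst q" "snd q"] by auto
        then show ?case using elim quad_inv(1)[OF k, of "fst q" "snd q"] t0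
          by (subst (asm) quad_less_iff[OF k]) auto
      qed
    qed
  qed
qed

lemma continuous_on_profile:
  assumes k: "1 < k"
  shows "continuous_on (phase_domain k) (\<lambda>(b, y). profile k b y)"
    and "continuous_on (phase_domain k) (\<lambda>(b, y). profile' k b y)"
proof -
  let ?S = "(phase_domain k)"
  have q: "continuous_on ?S (\<lambda>q. quad_inv k (fst q) (snd q))"
    using continuous_on_quad_inv[OF k] by (simp add: case_prod_unfold)
  have "continuous_on ?S (\<lambda>q. sin (quad_inv k (fst q) (snd q)) powr k)"
    using k quad_inv(1)[OF k]
    by (intro continuous_on_powr_const continuous_on_sin q) (auto intro!: sin_ge_zero)
  then show "continuous_on ?S (\<lambda>(b, y). profile k b y)"
    by (simp add: case_prod_unfold profile_def)
  have "continuous_on ?S (\<lambda>q. speed_sq k (fst q) ((sin (quad_inv k (fst q) (snd q)))\<^sup>2))"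
    by (rule continuous_on_compose2[OF continuous_on_speed_sq[OF k],
          of _ "\<lambda>q. (fst q, (sin (quad_inv k (fst q) (snd q)))\<^sup>2)", simplified])
       (intro continuous_on_Pair continuous_on_power continuous_on_sin q continuous_on_fst continuous_on_id, auto)
  then have "continuous_on ?S (\<lambda>q. cos (quad_inv k (fst q) (snd q)) *
      sqrt (speed_sq k (fst q) ((sin (quad_inv k (fst q) (snd q)))\<^sup>2)))"
    by (intro continuous_on_mult continuous_on_cos q continuous_on_real_sqrt)
  then show "continuous_on ?S (\<lambda>(b, y). profile' k b y)"
    by (simp add: case_prod_unfold profile'_def)
qed

lemma continuous_on_profile_fixed:
  assumes k: "1 < k" and b: "0 \<le> b" "b \<le> 1"
  shows "continuous_on {0..quad k b pi} (quad_inv k b)"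
    "continuous_on {0..quad k b pi} (profile k b)"
    "continuous_on {0..quad k b pi} (profile' k b)"
proof -
  have "continuous_on {0..quad k b pi} (Pair b)" by (intro continuous_intros)
  note c = continuous_on_compose2[OF _ this]
  have sub: "Pair b ` {0..quad k b pi} \<subseteq> (phase_domain k)"
    using b by auto
  show "continuous_on {0..quad k b pi} (quad_inv k b)"
    using c[OF continuous_on_quad_inv[OF k] sub] by simp
  show "continuous_on {0..quad k b pi} (profile k b)"
    using c[OF continuous_on_profile(1)[OF k] sub] by simp
  show "continuous_on {0..quad k b pi} (profile' k b)"
    using c[OF continuous_on_profile(2)[OF k] sub] by simp
qed

lemma profile_ends:
  assumes "1 < k" "0 \<le> b" "b \<le> 1"
  shows "profile k b 0 = 0" "profile k b (quad k b pi) = 0" "profile k b (quad k b (pi/2)) = 1"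
proof -
  have "quad_inv k b (quad k b (pi/2)) = pi/2" by (rule quad_inv_quad[OF assms]) auto
  then show "profile k b (quad k b (pi/2)) = 1" unfolding profile_def by (simp only: sin_pi_half powr_one_eq_one)
  show "profile k b 0 = 0" "profile k b (quad k b pi) = 0"
    using quad_inv_quad[OF assms, of 0] quad_inv_quad[OF assms, of pi] by (simp_all add: profile_def)
qed

lemma quad_inv_interior:
  assumes "1 < k" "0 \<le> b" "b \<le> 1" "0 < y" "y < quad k b pi"
  shows "0 < quad_inv k b y" "quad_inv k b y < pi"
proof -
  have q: "quad_inv k b y \<in> {0..pi}" "quad k b (quad_inv k b y) = y"
    using quad_inv[OF assms(1-3), of y] assms by auto
  show "0 < quad_inv k b y" "quad_inv k b y < pi"
    using quad_less_iff[OF assms(1-3), of 0 "quad_inv k b y"]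
      quad_less_iff[OF assms(1-3), of "quad_inv k b y" pi] q assms by auto
qed

lemma profile_pos:
  assumes "1 < k" "0 \<le> b" "b \<le> 1" "0 < y" "y < quad k b pi"
  shows "0 < profile k b y"
  using sin_gt_zero[OF quad_inv_interior[OF assms]] by (simp add: profile_def)

lemma DERIV_profile:
  assumes k: "1 < k" and b: "0 \<le> b" "b \<le> 1" and y: "0 < y" "y < quad k b pi"
  shows "(profile k b has_real_derivative profile' k b y) (at y)"
proof -
  define t where "t = quad_inv k b y"
  have t: "0 < t" "t < pi" using quad_inv_interior[OF assms] by (auto simp: t_def)
  have st: "0 < sin t" using t by (rule sin_gt_zero)
  have "continuous_on {0<..<quad k b pi} (quad_inv k b)"
    using continuous_on_profile_fixed(1)[OF k b] by (rule continuous_on_subset) auto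
  then have cont: "isCont (quad_inv k b) y"
    using y by (simp add: continuous_on_eq_continuous_at)
  have dq: "(quad_inv k b has_real_derivative inverse (quad_kernel k b t)) (at y)"
    by (rule DERIV_inverse_function[where f="quad k b" and a=0 and b="quad k b pi"])
       (use DERIV_quad[OF k b t] isCont_quad_kernel(2)[OF k b t] quad_inv(2)[OF k b] y cont in \<open>auto simp: t_def\<close>)
  have "((\<lambda>y. sin (quad_inv k b y)) has_real_derivative cos t * inverse (quad_kernel k b t)) (at y)"
    using DERIV_chain2[where f=sin, OF DERIV_sin dq] by (simp add: t_def)
  then have d: "(profile k b has_real_derivative
      k * sin t powr (k - 1) * (cos t * inverse (quad_kernel k b t))) (at y)"
    unfolding profile_def[abs_def] t_def
    by (rule DERIV_chain2[where f="\<lambda>z. z powr k", rotated])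
       (use st in \<open>auto simp: t_def intro!: has_real_derivative_powr\<close>)
  have "((sin t)\<^sup>2) powr ((k - 1) / 2) = sin t powr (k - 1)"
  proof -
    have "(sin t)\<^sup>2 = sin t powr 2" "2 * ((k - 1) / 2) = k - 1" using st by simp_all
    then show ?thesis by (simp only: powr_powr)
  qed
  then have "k * sin t powr (k - 1) * (cos t * inverse (quad_kernel k b t)) = profile' k b y"
    using k st by (simp add: quad_kernel_def profile'_def t_def[symmetric] field_simps)
  then show ?thesis using d by simp
qed

lemma profile'_sq:
  assumes "1 < k" "0 \<le> b" "b \<le> 1" "0 \<le> y" "y \<le> quad k b pi"
  shows "sqrt (profile_energy k b (profile k b y)) = \<bar>profile' k b y\<bar>"
proof -
  define w where "w = sin (quad_inv k b y)"
  have w: "0 \<le> w" using quad_inv(1)[OF assms] by (auto simp: w_def intro!: sin_ge_zero)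
  have "1 - w\<^sup>2 = (cos (quad_inv k b y))\<^sup>2" by (simp add: w_def cos_squared_eq)
  then have "profile_energy k b (profile k b y) = (cos (quad_inv k b y))\<^sup>2 * speed_sq k b (w\<^sup>2)"
    using profile_energy_sin[OF assms(1) w, of b] by (simp add: profile_def w_def)
  moreover have "0 \<le> speed_sq k b (w\<^sup>2)"
    using speed_sq_nonneg[of k "w\<^sup>2" b] assms by (simp add: w_def abs_square_le_1)
  ultimately show ?thesis
    by (simp add: profile'_def w_def real_sqrt_mult abs_mult)
qed

text \<open>Away from the peak, \<open>profile'\<close> is a square root of the energy expression with a locally constant sign,
and the chain rule gives the second-order equation.  The peak itself is covered later by continuity.\<close>

lemma DERIV_profile':
  assumes k: "1 < k" and b: "0 < b" "b \<le> 1" and y: "0 < y" "y < quad k b pi" "y \<noteq> quad k b (pi/2)"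
  shows "(profile' k b has_real_derivative b * (1 - 1 / k) * profile k b y powr (1 - 2 / k) - profile k b y) (at y)"
proof -
  define g where "g = sgn (cos (quad_inv k b y))"
  have b0: "0 \<le> b" using b by simp
  define U where "U = (if y < quad k b (pi/2) then {0<..<quad k b (pi/2)} else {quad k b (pi/2)<..<quad k b pi})"
  have half: "0 < quad k b (pi/2)" "quad k b (pi/2) < quad k b pi"
    using quad_strict_mono[OF k b0 b(2), of 0 "pi/2"] quad_strict_mono[OF k b0 b(2), of "pi/2" pi] by auto
  have U: "open U" "y \<in> U" "U \<subseteq> {0<..<quad k b pi}" using y half by (auto simp: U_def)
  have cs: "0 < speed_sq k b ((sin (quad_inv k b z))\<^sup>2) \<and> sgn (cos (quad_inv k b z)) = (if y < quad k b (pi/2) then 1 else - 1)"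
    if z: "z \<in> U" for z
  proof -
    have z': "0 < z" "z < quad k b pi" using z U by auto
    define t where "t = quad_inv k b z"
    have t: "0 < t" "t < pi" "quad k b t = z"
      using quad_inv_interior[OF k b0 b(2) z'] quad_inv(2)[OF k b0 b(2), of z] z' by (auto simp: t_def)
    have ct: "sgn (cos t) = (if y < quad k b (pi/2) then 1 else - 1)"
    proof (cases "y < quad k b (pi/2)")
      case True
      then have "t < pi / 2"
        using z t quad_less_iff[OF k b0 b(2), of t "pi/2"] by (auto simp: U_def)
      then show ?thesis using True t cos_gt_zero[of t] by simp
    next
      case False
      then have "pi / 2 < t"
        using z t quad_less_iff[OF k b0 b(2), of "pi/2" t] by (auto simp: U_def)
      then show ?thesis using False t cos_gt_zero_pi[of "pi - t"] by (simp add: cos_diff)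
    qed
    have "0 < speed_sq k b ((sin t)\<^sup>2)"
      using sin_gt_zero[OF t(1,2)] b k by (intro speed_sq_pos) (auto simp: abs_square_le_1)
    then show ?thesis using ct by (simp add: t_def[symmetric])
  qed
  have g: "g = 1 \<or> g = -1" using cs[OF U(2)] by (auto simp: g_def split: if_splits)
  have rep: "profile' k b z = g * sqrt (profile_energy k b (profile k b z))" if z: "z \<in> U" for z
  proof -
    have "sgn (profile' k b z) = g"
      using cs[OF z] cs[OF U(2)] by (simp add: profile'_def g_def sgn_mult)
    then have "profile' k b z = g * \<bar>profile' k b z\<bar>" by (metis mult.commute sgn_mult_abs)
    then show ?thesis using profile'_sq[of k b z] z U k b by auto
  qed
  define v where "v = profile k b y"
  have v: "0 < v" using profile_pos[OF k b0 b(2) y(1,2)] by (simp add: v_def)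
  define e where "e = profile_energy k b v"
  have e: "0 < e" 
  proof -
    have "sqrt e \<noteq> 0" "0 \<le> sqrt e"
      using cs[OF U(2)] profile'_sq[of k b y] y k b
      by (auto simp: e_def v_def profile'_def split: if_splits)
    then show ?thesis by simp
  qed
  have de: "(profile_energy k b has_real_derivative b * ((2 - 2/k) * v powr (1 - 2/k)) - 2 * v) (at v)"
    unfolding profile_energy_def[abs_def]
    using DERIV_diff[OF DERIV_add[OF DERIV_const DERIV_cmult[OF has_real_derivative_powr[OF v, of "2 - 2/k"], of b]]
        DERIV_power[OF DERIV_ident, of 2], of "1 - b"] by simp
  have ds: "(sqrt has_real_derivative inverse (sqrt e) / 2) (at e)"
    using DERIV_real_sqrt[OF e] .
  have "((\<lambda>z. profile_energy k b (profile k b z)) has_real_derivative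
      (b * ((2 - 2/k) * v powr (1 - 2/k)) - 2 * v) * profile' k b y) (at y)"
    using DERIV_chain2[where f="profile_energy k b", OF _ DERIV_profile[OF k b0 b(2) y(1,2)]] de
    by (simp add: v_def)
  then have "((\<lambda>z. sqrt (profile_energy k b (profile k b z))) has_real_derivative
      inverse (sqrt e) / 2 * ((b * ((2 - 2/k) * v powr (1 - 2/k)) - 2 * v) * profile' k b y)) (at y)"
    unfolding e_def v_def by (rule DERIV_chain2[where f=sqrt and g="\<lambda>z. profile_energy k b (profile k b z)" and x=y, OF ds[unfolded e_def v_def]])
  from DERIV_cmult[OF this, of g]
  have "((\<lambda>z. g * sqrt (profile_energy k b (profile k b z))) has_real_derivative
      b * (1 - 1 / k) * v powr (1 - 2 / k) - v) (at y)"
  proof (rule DERIV_cong)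
    have gp: "g * profile' k b y = sqrt e" using rep[OF U(2)] g by (auto simp: e_def v_def)
    have "g * (inverse (sqrt e) / 2 * ((b * ((2 - 2/k) * v powr (1 - 2/k)) - 2 * v) * profile' k b y))
      = inverse (sqrt e) * (g * profile' k b y) * ((b * ((2 - 2/k) * v powr (1 - 2/k)) - 2 * v) / 2)"
      by (simp add: mult_ac)
    also have "\<dots> = b * (1 - 1 / k) * v powr (1 - 2 / k) - v"
      using e unfolding gp by (simp add: field_simps)
    finally show "g * (inverse (sqrt e) / 2 * ((b * ((2 - 2/k) * v powr (1 - 2/k)) - 2 * v) * profile' k b y))
      = b * (1 - 1 / k) * v powr (1 - 2 / k) - v" .
  qed
  then show ?thesis
    unfolding v_def
    by (rule has_field_derivative_transform_within_open[OF _ U(1,2)]) (use rep in simp)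
qed

section \<open>Continuous families in \<open>C\<^sup>1\<close>\<close>

lemma C1_spaceD:
  assumes "u \<in> C1_space L"
  shows "u \<in> mspace (C0_metric L)" "D_on L u \<in> mspace (C0_metric L)"
  using assms by (simp_all add: C1_space_def del: mspace_cfunspace)

lemma C1_dist_le:
  assumes "0 < L" "u \<in> C1_space L" "v \<in> C1_space L"
    and "\<And>x. x \<in> {0..L} \<Longrightarrow> \<bar>u x - v x\<bar> \<le> e"
    and "\<And>x. x \<in> {0..L} \<Longrightarrow> \<bar>D_on L u x - D_on L v x\<bar> \<le> e"
  shows "C1_dist L u v \<le> 2 * e"
proof -
  have ne: "topspace (top_of_set {0..L}) \<noteq> {}" using assms by simp
  have "mdist (C0_metric L) u v \<le> e"
    using assms by (subst cfunspace_mdist_le[OF C1_spaceD(1) C1_spaceD(1) ne]) (auto simp: dist_real_def)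
  moreover have "mdist (C0_metric L) (D_on L u) (D_on L v) \<le> e"
    using assms by (subst cfunspace_mdist_le[OF C1_spaceD(2) C1_spaceD(2) ne]) (auto simp: dist_real_def)
  ultimately show ?thesis by (simp add: C1_dist_def)
qed

lemma abs_diff_le_C1_dist:
  assumes "u \<in> C1_space L" "v \<in> C1_space L" "x \<in> {0..L}"
  shows "\<bar>u x - v x\<bar> \<le> C1_dist L u v"
proof -
  have ne: "topspace (top_of_set {0..L}) \<noteq> {}" using assms by auto
  have "\<forall>x\<in>topspace (top_of_set {0..L}). mdist euclidean_metric (u x) (v x) \<le> mdist (C0_metric L) u v"
    using cfunspace_mdist_le[OF C1_spaceD(1)[OF assms(1)] C1_spaceD(1)[OF assms(2)] ne] by blast
  then have "\<bar>u x - v x\<bar> \<le> mdist (C0_metric L) u v" using assms by (simp add: dist_real_def)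
  then show ?thesis unfolding C1_dist_def using mdist_nonneg by (smt (verit))
qed

text \<open>The tube lemma in the form "projection along a compact factor is closed": pointwise closeness on
\<open>{q\<^sub>0} \<times> [0,L]\<close> extends to a neighbourhood of \<open>q\<^sub>0\<close>.\<close>

lemma tube_neighbourhood:
  fixes F :: "'q \<Rightarrow> real \<Rightarrow> real"
  assumes F: "continuous_map (prod_topology X (top_of_set {0..L})) euclideanreal (\<lambda>(q, x). F q x)"
    and q0: "q0 \<in> topspace X" and e: "0 < e"
  obtains V where "openin X V" "q0 \<in> V" "\<And>q x. q \<in> V \<Longrightarrow> x \<in> {0..L} \<Longrightarrow> \<bar>F q x - F q0 x\<bar> < e"
proof
  let ?P = "prod_topology X (top_of_set {0..L})"
  have "continuous_map ?P ?P (\<lambda>z. (q0, snd z))"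
    using q0 by (intro continuous_map_pairedI continuous_map_snd) auto
  from continuous_map_compose[OF this F]
  have "continuous_map ?P euclideanreal (\<lambda>z. F q0 (snd z))" by (simp add: o_def)
  then have G: "continuous_map ?P euclideanreal (\<lambda>z. \<bar>F (fst z) (snd z) - F q0 (snd z)\<bar>)"
    using F by (intro continuous_map_real_abs continuous_map_diff) (simp_all add: case_prod_unfold)
  define C where "C = {z \<in> topspace ?P. \<bar>F (fst z) (snd z) - F q0 (snd z)\<bar> \<in> {e..}}"
  have "closedin ?P C" unfolding C_def
    by (rule closedin_continuous_map_preimage[OF G]) simp
  moreover have "closed_map ?P X fst"
    by (rule Abstract_Topological_Spaces.closed_map_fst) (simp add: compact_space_subtopology)
  ultimately have "closedin X (fst ` C)" by (simp add: closed_map_def)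
  then show "openin X (topspace X - fst ` C)" by (simp add: openin_diff)
  show "q0 \<in> topspace X - fst ` C" using q0 e by (auto simp: C_def)
  show "\<bar>F q x - F q0 x\<bar> < e" if "q \<in> topspace X - fst ` C" "x \<in> {0..L}" for q x
    using that by (force simp: C_def image_iff)
qed

text \<open>All families of solutions below are given by explicit formulas, so joint continuity of the function
and of its derivative is easy to check; this is the bridge to the \<open>C\<^sup>1\<close> topology.\<close>

lemma continuous_map_into_C1:
  assumes L: "0 < L" and U: "\<And>q. q \<in> topspace X \<Longrightarrow> U q \<in> C1_space L"
    and c0: "continuous_map (prod_topology X (top_of_set {0..L})) euclideanreal (\<lambda>(q, x). U q x)"
    and c1: "continuous_map (prod_topology X (top_of_set {0..L})) euclideanreal (\<lambda>(q, x). D_on L (U q) x)"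
  shows "continuous_map X (C1_topology L) U"
  unfolding mtopology_of_def mspace_C1_metric mdist_C1_metric
    Metric_space.continuous_map_to_metric[OF Metric_space_C1]
proof (intro ballI allI impI)
  fix q0 and e :: real assume q0: "q0 \<in> topspace X" and e: "0 < e"
  obtain V where V: "openin X V" "q0 \<in> V" "\<And>q x. q \<in> V \<Longrightarrow> x \<in> {0..L} \<Longrightarrow> \<bar>U q x - U q0 x\<bar> < e / 3"
    using tube_neighbourhood[OF c0 q0, of "e/3"] e by auto
  obtain W where W: "openin X W" "q0 \<in> W"
    "\<And>q x. q \<in> W \<Longrightarrow> x \<in> {0..L} \<Longrightarrow> \<bar>D_on L (U q) x - D_on L (U q0) x\<bar> < e / 3"
    using tube_neighbourhood[OF c1 q0, of "e/3"] e by auto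
  have "C1_dist L (U q0) (U q) < e" if q: "q \<in> V \<inter> W" for q
  proof -
    have "q \<in> topspace X" using q V(1) openin_subset by blast
    then have "C1_dist L (U q0) (U q) \<le> 2 * (e / 3)"
      using V(3)[of q] W(3)[of q] q q0 U
      by (intro C1_dist_le[OF L]) (auto simp: abs_minus_commute less_imp_le)
    then show ?thesis using e by simp
  qed
  then show "\<exists>V. openin X V \<and> q0 \<in> V \<and>
      (\<forall>q\<in>V. U q \<in> Metric_space.mball (C1_space L) (C1_dist L) (U q0) e)"
    using V W U q0 openin_subset[OF V(1)]
    by (intro exI[of _ "V \<inter> W"]) (auto simp: Metric_space.in_mball[OF Metric_space_C1])
qed

context sublinear_problem begin

abbreviation low_range :: "real set" where
  "low_range \<equiv> {sigma_thr L 1<..Sigma_thr p L 1}"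

section \<open>The curve of positive solutions up to \<open>\<Sigma>\<^sub>1\<close>\<close>

text \<open>The parameter \<open>b\<close> for which the bump has length exactly \<open>L\<close>.\<close>

definition low_b :: "real \<Rightarrow> real" where
  "low_b lam = inv_into {0..1} (\<lambda>b. quad k b pi) (sqrt lam * L)"

text \<open>The maximum \<open>M\<close> recovered from \<open>b\<close>, that is the solution of \<open>b = 2a/((p+1)\<lambda>M\<^sup>1\<^sup>-\<^sup>p)\<close>.\<close>

definition amplitude :: "real \<Rightarrow> real \<Rightarrow> real" where
  "amplitude lam b = (2 * a / ((p + 1) * lam * b)) powr (1 / (1 - p))"

definition low :: "real \<Rightarrow> real \<Rightarrow> real" where
  "low lam = (\<lambda>x\<in>{0..L}. amplitude lam (low_b lam) * profile k (low_b lam) (sqrt lam * x))"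

lemma sigma_eq: "sigma_thr L 1 = (pi / L)\<^sup>2" "Sigma_thr p L j = (k * real j * pi / L)\<^sup>2"
  by (simp_all add: sigma_thr_def Sigma_thr_def k_def power_mult_distrib power_divide)

lemma sqrt_mult_L_bounds:
  "sigma_thr L 1 < lam \<longleftrightarrow> pi < sqrt lam * L" "sigma_thr L 1 \<le> lam \<longleftrightarrow> pi \<le> sqrt lam * L"
  "Sigma_thr p L j \<le> lam \<longleftrightarrow> k * real j * pi \<le> sqrt lam * L"
  "lam \<le> Sigma_thr p L j \<longleftrightarrow> sqrt lam * L \<le> k * real j * pi"
proof -
  have *: "c\<^sup>2 < lam \<longleftrightarrow> c < sqrt lam" "c\<^sup>2 \<le> lam \<longleftrightarrow> c \<le> sqrt lam" "lam \<le> c\<^sup>2 \<longleftrightarrow> sqrt lam \<le> c"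
    if "0 \<le> c" for c
    using real_less_rsqrt[of c lam] real_le_rsqrt[of c lam] real_sqrt_le_iff[of lam "c\<^sup>2"]
      real_sqrt_le_iff[of "c\<^sup>2" lam] real_sqrt_less_iff[of "c\<^sup>2" lam] that by auto
  show "sigma_thr L 1 < lam \<longleftrightarrow> pi < sqrt lam * L" "sigma_thr L 1 \<le> lam \<longleftrightarrow> pi \<le> sqrt lam * L"
  "Sigma_thr p L j \<le> lam \<longleftrightarrow> k * real j * pi \<le> sqrt lam * L"
  "lam \<le> Sigma_thr p L j \<longleftrightarrow> sqrt lam * L \<le> k * real j * pi"
    unfolding sigma_eq using L k_gt by (subst *; simp add: field_simps)+
qed

lemma amplitude:
  assumes "0 < lam" "0 < b"
  shows "0 < amplitude lam b" "amplitude lam b powr (1 - p) = 2 * a / ((p + 1) * lam * b)"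
    "M > 0 \<Longrightarrow> b * lam * M powr (1 - p) = 2 * a / (p + 1) \<Longrightarrow> M = amplitude lam b"
proof -
  have pos: "0 < 2 * a / ((p + 1) * lam * b)" using assms a p by simp
  show "0 < amplitude lam b" using pos by (metis amplitude_def powr_gt_zero less_irrefl)
  show "amplitude lam b powr (1 - p) = 2 * a / ((p + 1) * lam * b)"
  proof -
    have "1 / (1 - p) * (1 - p) = 1" using p by simp
    then show ?thesis
      unfolding amplitude_def powr_powr using powr_one[OF less_imp_le[OF pos]] by (simp only:)
  qed
  assume M: "M > 0" "b * lam * M powr (1 - p) = 2 * a / (p + 1)"
  have "b * lam * M powr (1 - p) * (p + 1) = 2 * a" unfolding M(2) using p by simp
  then have "M powr (1 - p) * ((p + 1) * lam * b) = 2 * a" by (simp only: mult_ac)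
  moreover have "0 < (p + 1) * lam * b" using assms p by simp
  ultimately have "M powr (1 - p) = 2 * a / ((p + 1) * lam * b)"
    by (metis less_irrefl nonzero_eq_divide_eq)
  then have "(M powr (1 - p)) powr (1 / (1 - p)) = amplitude lam b" by (simp add: amplitude_def)
  then show "M = amplitude lam b" using M(1) p by (simp add: powr_powr)
qed

text \<open>The scaling factor matches the coefficient \<open>a\<close> of the nonlinearity with the coefficient
\<open>b (1 - 1/k)\<close> in the profile equation.\<close>

lemma amplitude_balance:
  assumes lam: "0 < lam" and b: "0 < b"
  shows "a * amplitude lam b powr p = amplitude lam b * lam * b * (1 - 1 / k)"
proof -
  define M where "M = amplitude lam b"
  note M = amplitude[OF assms, folded M_def]
    have "M powr (1 - p) * M powr p = M" using M(1) by (simp flip: powr_add)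
    then have "2 * a / ((p + 1) * lam * b) * M powr p = M" by (simp add: M(2))
    moreover define D where "D = (p + 1) * lam * b"
    moreover have "0 < D" using lam b p by (simp add: D_def)
    ultimately have "2 * a * M powr p = M * D" by (simp add: field_simps)
    then have "a * M powr p = M * lam * b * ((p + 1) / 2)" by (simp add: D_def algebra_simps)
    also have "(p + 1) / 2 = 1 - 1 / k" using k_p(1) by simp
    finally show ?thesis by (simp add: M_def)
qed

lemma inj_on_quad_param: "inj_on (\<lambda>b. quad k b pi) {0..1}"
  by (rule linorder_inj_onI) (use quad_strict_mono_param[OF k_gt(2)] in \<open>force+\<close>)

lemma quad_range: "(\<lambda>b. quad k b pi) ` {0..1} = {pi..k * pi}"
proof -
  have c: "continuous_on {0..1} (\<lambda>b. quad k b pi)" using continuous_on_quad_param k_gt by simp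
  have ends: "quad k 0 pi = pi" "quad k 1 pi = k * pi" using quad_zero quad_one k_gt by auto
  have "y \<in> (\<lambda>b. quad k b pi) ` {0..1}" if "pi \<le> y" "y \<le> k * pi" for y
  proof -
    have "\<exists>b\<ge>0. b \<le> 1 \<and> quad k b pi = y"
      by (rule IVT'[of "\<lambda>b. quad k b pi"]) (use c ends that in auto)
    then show ?thesis by auto
  qed
  moreover have "quad k b pi \<in> {pi..k*pi}" if "b \<in> {0..1}" for b
    using quad_strict_mono_param[OF k_gt(2), of 0 b] quad_strict_mono_param[OF k_gt(2), of b 1] ends that
    by (cases "b = 0"; cases "b = 1") auto
  ultimately show ?thesis by auto
qed

lemma low_b:
  assumes "lam \<in> low_range"
  shows "0 < lam" "0 < low_b lam" "low_b lam \<le> 1" "quad k (low_b lam) pi = sqrt lam * L"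
proof -
  have y: "pi < sqrt lam * L" "sqrt lam * L \<le> k * pi"
    using assms sqrt_mult_L_bounds(1)[of lam] sqrt_mult_L_bounds(4)[of lam 1] by auto
  have "0 < sqrt lam * L" using y(1) pi_gt_zero by linarith
  then show "0 < lam" using L by (simp add: zero_less_mult_iff)
  have r: "sqrt lam * L \<in> (\<lambda>b. quad k b pi) ` {0..1}" using y quad_range by auto
  have l: "low_b lam \<in> {0..1}" unfolding low_b_def by (rule inv_into_into[OF r])
  show q: "quad k (low_b lam) pi = sqrt lam * L"
    unfolding low_b_def by (rule f_inv_into_f[OF r, of])
  have "low_b lam \<noteq> 0" using q y quad_zero[OF k_gt(2)] by auto
  then show "0 < low_b lam" "low_b lam \<le> 1" using l by auto
qed

lemma low_b_unique:
  assumes "0 \<le> b" "b \<le> 1" "quad k b pi = sqrt lam * L"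
  shows "b = low_b lam"
  unfolding low_b_def assms(3)[symmetric]
  using inv_into_f_f[OF inj_on_quad_param, of b] assms by simp

lemma continuous_on_low_b: "continuous_on {sigma_thr L 1..Sigma_thr p L 1} low_b"
proof -
  have "continuous_on ((\<lambda>b. quad k b pi) ` {0..1}) (inv_into {0..1} (\<lambda>b. quad k b pi))"
    using continuous_on_quad_param[OF k_gt(2), of pi] inv_into_f_f[OF inj_on_quad_param]
    by (intro continuous_on_inv ballI) auto
  then have c: "continuous_on {pi..k * pi} (inv_into {0..1} (\<lambda>b. quad k b pi))" by (simp add: quad_range)
  show ?thesis unfolding low_b_def[abs_def]
    by (rule continuous_on_compose2[OF c])
       (use sqrt_mult_L_bounds(2) sqrt_mult_L_bounds(4)[of _ 1] in \<open>auto intro!: continuous_intros\<close>)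
qed

text \<open>At the two ends of the interval the inverse function rule does not apply to the phase, and at the peak
the energy expression vanishes, where its square root is not differentiable.  Continuity of the
candidate derivatives removes these exceptions.\<close>

lemma low_solution:
  assumes "lam \<in> low_range"
  shows "(lam, low lam) \<in> nonneg_solutions p L a"
    and "x \<in> {0..L} \<Longrightarrow> D_on L (low lam) x
        = amplitude lam (low_b lam) * sqrt lam * profile' k (low_b lam) (sqrt lam * x)"
    and "x \<in> {0<..<L} \<Longrightarrow> 0 < low lam x"
proof -
  define b where "b = low_b lam"
  define M where "M = amplitude lam b"
  define r where "r = sqrt lam"
  have lam: "0 < lam" and b: "0 < b" "0 \<le> b" "b \<le> 1" and q: "quad k b pi = r * L"
    using low_b[OF assms] by (auto simp: b_def r_def)
  have r: "0 < r" "r * r = lam" using lam by (auto simp: r_def)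
  note M = amplitude[OF lam b(1), folded M_def]
  let ?u = "\<lambda>x. M * profile k b (r * x)"
  let ?du = "\<lambda>x. M * r * profile' k b (r * x)"
  let ?ddu = "\<lambda>x. M * lam * (b * (1 - 1/k) * profile k b (r * x) powr p - profile k b (r * x))"
  have rng: "r * x \<in> {0..quad k b pi}" if "x \<in> {0..L}" for x
    using that r L by (auto simp: q)
  have rng': "0 < r * x" "r * x < quad k b pi" if "x \<in> {0<..<L}" for x
    using that r L by (auto simp: q)
  have nn: "0 \<le> profile k b y" for y by (simp add: profile_def)
  have cr: "continuous_on {0..L} (\<lambda>x. r * x)" by (intro continuous_intros)
  have cp: "continuous_on {0..L} (\<lambda>x. profile k b (r * x))"
    "continuous_on {0..L} (\<lambda>x. profile' k b (r * x))"
    using continuous_on_compose2[OF continuous_on_profile_fixed(2)[OF k_gt(2) b(2,3)] cr]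
      continuous_on_compose2[OF continuous_on_profile_fixed(3)[OF k_gt(2) b(2,3)] cr] rng by blast+
  have cddu: "continuous_on {0..L} ?ddu"
    using cp nn p by (intro continuous_on_mult continuous_on_diff continuous_on_powr_const continuous_on_const) auto
  have dr: "((\<lambda>x. r * x) has_real_derivative r) (at x)" for x
    by (auto intro!: derivative_eq_intros)
  have du: "(?u has_real_derivative ?du x) (at x within {0..L})" if x: "x \<in> {0..L}" for x
  proof (rule has_derivative_finite_exceptions[of "{}", OF _ _ _ _ x])
    show "(?u has_real_derivative ?du x) (at x)" if "x \<in> {0<..<L} - {}" for x
      using DERIV_cmult[OF DERIV_chain2[OF DERIV_profile[OF k_gt(2) b(2,3) rng'[of x]] dr], of M] that
      by (simp add: mult_ac)
  qed (use cp in \<open>auto intro!: continuous_on_mult continuous_on_const\<close>)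
  \<comment> \<open>the exceptional point is the peak, where the phase is \<open>\<pi>/2\<close>\<close>
  have ddu: "(?du has_real_derivative ?ddu x) (at x within {0..L})" if x: "x \<in> {0..L}" for x
  proof (rule has_derivative_finite_exceptions[of "{quad k b (pi/2) / r}", OF _ _ cddu _ x])
    show "(?du has_real_derivative ?ddu x) (at x)" if x: "x \<in> {0<..<L} - {quad k b (pi/2) / r}" for x
    proof -
      have "r * x \<noteq> quad k b (pi/2)" using x r by (auto simp: field_simps)
      then have "(profile' k b has_real_derivative
          b * (1 - 1 / k) * profile k b (r * x) powr (1 - 2 / k) - profile k b (r * x)) (at (r * x))"
        using DERIV_profile'[OF k_gt(2) b(1,3) rng'[of x]] x by blast
      moreover have "1 - 2 / k = p" using k_p(1) by simp
      ultimately have "(profile' k b has_real_derivative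
          b * (1 - 1 / k) * profile k b (r * x) powr p - profile k b (r * x)) (at (r * x))" by simp
      from DERIV_cmult[OF DERIV_chain2[OF this dr], of "M * r"]
      show ?thesis by (rule DERIV_cong) (use r in \<open>simp add: mult_ac\<close>)
    qed
  qed (use cp in \<open>auto intro!: continuous_on_mult continuous_on_const\<close>)
  have low: "low lam x = ?u x" if "x \<in> {0..L}" for x
    using that by (simp add: low_def b_def M_def r_def)
  have du': "(low lam has_real_derivative ?du x) (at x within {0..L})" if x: "x \<in> {0..L}" for x
    using du[OF x] by (rule has_field_derivative_transform_within[where d=1]) (use x low in auto)
  show "D_on L (low lam) x = amplitude lam (low_b lam) * sqrt lam * profile' k (low_b lam) (sqrt lam * x)"
    if x: "x \<in> {0..L}" for x
    using D_on_eqI[OF L x du'[OF x]] by (simp add: b_def M_def r_def)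
  show pos: "0 < low lam x" if "x \<in> {0<..<L}" for x
    using profile_pos[OF k_gt(2) b(2,3) rng'[OF that]] M(1) low[of x] that by simp
  have ends: "low lam 0 = 0" "low lam L = 0"
    using profile_ends[OF k_gt(2) b(2,3)] q L by (simp_all add: low)
  have "is_solution p L a lam (low lam)"
  proof (rule is_solutionI[OF L _ ends du' ddu cddu])
    show "low lam \<in> extensional {0..L}" by (simp add: low_def)
    fix x assume x: "x \<in> {0..L}"
    define v where "v = profile k b (r * x)"
    have v: "0 \<le> v" by (simp add: v_def nn)
    have u: "low lam x = M * v" using low[OF x] by (simp add: v_def)
    have aM: "a * M powr p = M * lam * b * (1 - 1 / k)"
      using amplitude_balance[OF lam b(1)] by (simp add: M_def)
    have "\<bar>low lam x\<bar> powr (p - 1) * low lam x = (M * v) powr p"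
      using M(1) v powr_mult_base[of "M * v" "p - 1"] by (cases "v = 0") (auto simp: u mult.commute)
    also have "\<dots> = M powr p * v powr p" using M(1) v by (simp add: powr_mult)
    finally have "a * (\<bar>low lam x\<bar> powr (p - 1) * low lam x) = M * lam * b * (1 - 1 / k) * v powr p"
      using aM by (metis mult.assoc)
    then show "- ?ddu x = lam * low lam x - a * (\<bar>low lam x\<bar> powr (p - 1) * low lam x)"
      unfolding v_def[symmetric] u by (simp add: algebra_simps)
  qed auto
  moreover have "0 \<le> low lam x" if "x \<in> {0..L}" for x
    using low[OF that] M(1) nn by simp
  moreover have "low lam (L / 2) \<noteq> 0" using pos[of "L/2"] L by auto
  ultimately show "(lam, low lam) \<in> nonneg_solutions p L a"
    using L by (force simp: nonneg_solutions_def)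
qed

section \<open>The bump of zero energy\<close>

text \<open>The cosine on \<open>[-\<pi>/2,\<pi>/2]\<close> and \<open>0\<close> outside, written as a composition of continuous functions.\<close>

definition clamped_cos :: "real \<Rightarrow> real" where
  "clamped_cos z = cos (min \<bar>z\<bar> (pi / 2))"

definition hump :: "real \<Rightarrow> real" where
  "hump z = clamped_cos z powr k"

definition hump' :: "real \<Rightarrow> real" where
  "hump' z = - k * clamped_cos z powr (k - 1) * sin z"

definition hump'' :: "real \<Rightarrow> real" where
  "hump'' z = k * (k - 1) * clamped_cos z powr (k - 2) - k\<^sup>2 * clamped_cos z powr k"

lemma clamped_cos_simps:
  "\<bar>z\<bar> \<le> pi / 2 \<Longrightarrow> clamped_cos z = cos z" "pi / 2 \<le> \<bar>z\<bar> \<Longrightarrow> clamped_cos z = 0"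
  by (simp_all add: clamped_cos_def min_absorb1 min_absorb2)

lemma clamped_cos_bounds: "0 \<le> clamped_cos z" "\<bar>z\<bar> < pi / 2 \<Longrightarrow> 0 < clamped_cos z" "z \<noteq> 0 \<Longrightarrow> clamped_cos z < 1"
proof -
  have "0 \<le> min \<bar>z\<bar> (pi / 2)" "min \<bar>z\<bar> (pi / 2) \<le> pi / 2" by simp_all
  then show "0 \<le> clamped_cos z" unfolding clamped_cos_def using pi_gt_zero by (intro cos_ge_zero) linarith+
  show "0 < clamped_cos z" if "\<bar>z\<bar> < pi / 2" using that by (auto simp: clamped_cos_simps intro!: cos_gt_zero_pi)
  show "clamped_cos z < 1" if "z \<noteq> 0"
    unfolding clamped_cos_def cos_zero[symmetric] using that pi_gt_zero
    by (intro cos_monotone_0_pi) (auto simp: min_def)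
qed

lemma continuous_on_hump:
  "continuous_on S hump" "continuous_on S hump'" "continuous_on S hump''"
proof -
  have c: "continuous_on S clamped_cos" unfolding clamped_cos_def[abs_def] by (intro continuous_intros)
  have "continuous_on S (\<lambda>z. clamped_cos z powr q)" if "0 < q" for q
    using c clamped_cos_bounds(1) that by (intro continuous_on_powr_const) auto
  then show "continuous_on S hump" "continuous_on S hump'" "continuous_on S hump''"
    unfolding hump_def[abs_def] hump'_def[abs_def] hump''_def[abs_def] using k_gt
    by (auto intro!: continuous_on_mult continuous_on_diff continuous_on_minus continuous_on_const continuous_on_sin continuous_on_id)
qed

lemma DERIV_clamped_cos_powr:
  assumes "\<bar>z\<bar> \<noteq> pi / 2"
  shows "((\<lambda>z. clamped_cos z powr q) has_real_derivative - q * clamped_cos z powr (q - 1) * sin z) (at z)"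
proof (cases "\<bar>z\<bar> < pi / 2")
  case True
  then have c: "0 < cos z" by (auto intro!: cos_gt_zero_pi)
  have "((\<lambda>z. cos z powr q) has_real_derivative (q * cos z powr (q - 1)) * (- sin z)) (at z)"
    by (rule DERIV_chain2[where f="\<lambda>w. w powr q", OF has_real_derivative_powr[OF c] DERIV_cos])
  then have "((\<lambda>z. cos z powr q) has_real_derivative - q * clamped_cos z powr (q - 1) * sin z) (at z)"
    using True by (simp add: clamped_cos_simps)
  then show ?thesis
    by (rule has_field_derivative_transform_within_open[where S="{-pi/2<..<pi/2}"])
       (use True in \<open>auto simp: clamped_cos_simps\<close>)
next
  case False
  have "((\<lambda>z::real. 0::real) has_real_derivative 0) (at z)" by simp
  then have "((\<lambda>z. clamped_cos z powr q) has_real_derivative 0) (at z)"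
  proof (rule has_field_derivative_transform_within_open[where S="- {-pi/2..pi/2}"])
    show "open (- {- pi / 2..pi / 2})" by (intro open_Compl closed_atLeastAtMost)
  qed (use False assms in \<open>auto simp: clamped_cos_simps\<close>)
  then show ?thesis using False by (simp add: clamped_cos_simps)
qed

lemma DERIV_hump: "(hump has_real_derivative hump' z) (at z)"
proof -
  have "(hump has_real_derivative hump' z) (at z within {z - 1..z + 1})"
  proof (rule has_derivative_finite_exceptions[of "{pi/2, -pi/2}"])
    show "(hump has_real_derivative hump' x) (at x)" if "x \<in> {z - 1<..<z + 1} - {pi / 2, - pi / 2}" for x
      unfolding hump_def[abs_def] hump'_def by (rule DERIV_clamped_cos_powr) (use that in auto)
  qed (auto intro: continuous_on_hump)
  then show ?thesis using at_within_Icc_at[of "z - 1" z "z + 1"] by simp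
qed

lemma DERIV_hump': "(hump' has_real_derivative hump'' z) (at z)"
proof -
  have "(hump' has_real_derivative hump'' z) (at z within {z - 1..z + 1})"
  proof (rule has_derivative_finite_exceptions[of "{pi/2, -pi/2}"])
    fix x assume x: "x \<in> {z - 1<..<z + 1} - {pi / 2, - pi / 2}"
    have "(hump' has_real_derivative - k * ((- (k - 1) * clamped_cos x powr (k - 1 - 1) * sin x) * sin x
         + cos x * clamped_cos x powr (k - 1))) (at x)"
      using DERIV_cmult[OF DERIV_mult[OF DERIV_clamped_cos_powr[of x "k - 1"] DERIV_sin[of x]], of "- k"] x
      unfolding hump'_def[abs_def] by (auto simp: mult.assoc)
    moreover have "- k * ((- (k - 1) * clamped_cos x powr (k - 1 - 1) * sin x) * sin x
         + cos x * clamped_cos x powr (k - 1)) = hump'' x"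
    proof (cases "\<bar>x\<bar> < pi / 2")
      case True
      then have c: "0 < cos x" "clamped_cos x = cos x" by (auto simp: clamped_cos_simps intro!: cos_gt_zero_pi)
      have e: "cos x powr (k - 1) * cos x = cos x powr k"
        "cos x powr (k - 2) * (cos x)\<^sup>2 = cos x powr k"
        using c powr_add[of "cos x" "k - 1" 1] powr_add[of "cos x" "k - 2" 2] by auto
      have "- k * ((- (k - 1) * clamped_cos x powr (k - 1 - 1) * sin x) * sin x + cos x * clamped_cos x powr (k - 1))
         = k * (k - 1) * (cos x powr (k - 2) * (sin x)\<^sup>2) - k * (cos x powr (k - 1) * cos x)"
        by (simp add: c power2_eq_square algebra_simps)
      also have "cos x powr (k - 2) * (sin x)\<^sup>2 = cos x powr (k - 2) - cos x powr k"
        by (simp add: sin_squared_eq right_diff_distrib e)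
      finally show ?thesis unfolding e(1) by (simp add: hump''_def c power2_eq_square algebra_simps)
    qed (simp add: hump''_def clamped_cos_simps)
    ultimately show "(hump' has_real_derivative hump'' x) (at x)" by simp
  qed (auto intro: continuous_on_hump)
  then show ?thesis using at_within_Icc_at[of "z - 1" z "z + 1"] by simp
qed

lemma hump_ode: "hump'' z = k * (k - 1) * hump z powr p - k\<^sup>2 * hump z"
  by (simp add: hump_def hump''_def powr_powr k_p)

definition bump :: "real \<Rightarrow> real \<Rightarrow> real" where
  "bump lam y = amplitude lam 1 * hump (sqrt lam / k * y)"

definition bump' :: "real \<Rightarrow> real \<Rightarrow> real" where
  "bump' lam y = amplitude lam 1 * (sqrt lam / k) * hump' (sqrt lam / k * y)"

lemma DERIV_bump:
  assumes "0 < lam"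
  shows "(bump lam has_real_derivative bump' lam y) (at y)"
    "(bump' lam has_real_derivative (a * bump lam y powr p - lam * bump lam y)) (at y)"
proof -
  define w where "w = sqrt lam / k"
  define A where "A = amplitude lam 1"
  have A: "0 < A" "a * A powr p = A * lam * (1 - 1 / k)"
    using amplitude(1)[OF assms, of 1] amplitude_balance[OF assms, of 1] by (auto simp: A_def)
  have d: "((\<lambda>y. w * y) has_real_derivative w) (at y)" by (auto intro!: derivative_eq_intros)
  show "(bump lam has_real_derivative bump' lam y) (at y)"
    using DERIV_cmult[OF DERIV_chain2[OF DERIV_hump d], of A]
    unfolding bump_def[abs_def] bump'_def w_def A_def by (simp add: mult_ac)
  have w2: "w\<^sup>2 * k\<^sup>2 = lam" using assms k_gt by (simp add: w_def power_divide)
  have "A * w\<^sup>2 * hump'' z = a * (A * hump z) powr p - lam * (A * hump z)" for z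
  proof -
    have "A * w\<^sup>2 * hump'' z = A * (w\<^sup>2 * k\<^sup>2) * ((1 - 1 / k) * hump z powr p) - A * (w\<^sup>2 * k\<^sup>2) * hump z"
      using k_gt unfolding hump_ode by (simp add: power2_eq_square field_simps)
    also have "\<dots> = (a * A powr p) * hump z powr p - lam * (A * hump z)"
      unfolding w2 A(2) by (simp add: mult_ac)
    also have "\<dots> = a * (A * hump z) powr p - lam * (A * hump z)"
      using A by (simp add: powr_mult hump_def)
    finally show ?thesis .
  qed
  from this[of "w * y"] have "A * w * (hump'' (w * y) * w) = a * bump lam y powr p - lam * bump lam y"
    unfolding bump_def A_def[symmetric] w_def[symmetric] by (simp add: power2_eq_square mult_ac)
  then show "(bump' lam has_real_derivative (a * bump lam y powr p - lam * bump lam y)) (at y)"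
    using DERIV_cmult[OF DERIV_chain2[OF DERIV_hump' d], of "A * w"]
    unfolding bump'_def[abs_def] w_def[symmetric] A_def[symmetric] by simp
qed

lemma T_H: 
  assumes "0 < lam" shows "0 < T_H p lam" "sqrt lam / k * T_H p lam = pi / 2" "T_H p lam = k * pi / (2 * sqrt lam)"
  using assms p by (simp_all add: T_H_def k_def field_simps)

lemma T_H_ivl:
  assumes "0 < lam"
  shows "\<bar>sqrt lam / k * y\<bar> < pi / 2 \<longleftrightarrow> \<bar>y\<bar> < T_H p lam"
proof -
  have "\<bar>sqrt lam / k * y\<bar> = sqrt lam / k * \<bar>y\<bar>" using assms k_gt by (simp add: abs_mult)
  moreover have "0 < sqrt lam / k" using assms k_gt by simp
  ultimately show ?thesis
    unfolding T_H(2)[OF assms, symmetric] by (simp only: mult_less_cancel_left_pos)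
qed

text \<open>The bump is supported exactly in \<open>[-T\<^sub>H, T\<^sub>H]\<close> and has a strict maximum at \<open>0\<close>, so its centre is the
point where it occurs.\<close>

lemma bump_values:
  assumes "0 < lam"
  shows "0 \<le> bump lam y" "T_H p lam \<le> \<bar>y\<bar> \<Longrightarrow> bump lam y = 0" "\<bar>y\<bar> < T_H p lam \<Longrightarrow> 0 < bump lam y"
    "bump lam 0 = amplitude lam 1" "y \<noteq> 0 \<Longrightarrow> bump lam y < amplitude lam 1"
    "T_H p lam \<le> \<bar>y\<bar> \<Longrightarrow> bump' lam y = 0"
proof -
  have A: "0 < amplitude lam 1" using amplitude(1)[OF assms, of 1] by simp
  show "0 \<le> bump lam y" using A by (simp add: bump_def hump_def)
  have z: "clamped_cos (sqrt lam / k * y) = 0" if "T_H p lam \<le> \<bar>y\<bar>"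
    using T_H_ivl[OF assms, of y] that by (intro clamped_cos_simps) linarith
  show "bump lam y = 0" if "T_H p lam \<le> \<bar>y\<bar>" unfolding bump_def hump_def z[OF that] by simp
  show "bump' lam y = 0" if "T_H p lam \<le> \<bar>y\<bar>" unfolding bump'_def hump'_def z[OF that] by simp
  show "0 < bump lam y" if "\<bar>y\<bar> < T_H p lam"
  proof -
    have "0 < clamped_cos (sqrt lam / k * y)" using clamped_cos_bounds(2) T_H_ivl[OF assms, of y] that by blast
    then show ?thesis using A by (simp add: bump_def hump_def)
  qed
  show "bump lam 0 = amplitude lam 1" by (simp add: bump_def hump_def clamped_cos_simps)
  show "bump lam y < amplitude lam 1" if "y \<noteq> 0"
  proof -
    have "sqrt lam / k * y \<noteq> 0" using that assms k_gt by simp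
    then have "clamped_cos (sqrt lam / k * y) powr k < 1 powr k"
      using clamped_cos_bounds k_gt by (intro powr_less_mono2) auto
    then show ?thesis using A by (simp add: bump_def hump_def)
  qed
qed

section \<open>Superpositions of disjoint bumps\<close>

definition superpose :: "real \<Rightarrow> nat \<Rightarrow> (nat \<Rightarrow> real) \<Rightarrow> real \<Rightarrow> real" where
  "superpose lam j x = (\<lambda>t\<in>{0..L}. \<Sum>i=1..j. bump lam (t - x i))"

lemma simplex_spacing:
  assumes "x \<in> bump_simplex p L j lam" "1 \<le> i" "i \<le> l" "l \<le> j"
  shows "2 * T_H p lam * (real l - real i) \<le> x l - x i"
  using assms(3,4)
proof (induction l rule: dec_induct)
  case (step l)
  have "\<forall>m\<in>{2..j}. 2 * T_H p lam \<le> x m - x (m - 1)"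
    using assms(1) by (simp add: bump_simplex_def)
  from bspec[OF this, of "Suc l"] have "2 * T_H p lam \<le> x (Suc l) - x l"
    using assms(2) step by simp
  then show ?case using step by (simp add: algebra_simps)
qed simp

lemma simplex_range:
  assumes lam: "0 < lam" and x: "x \<in> bump_simplex p L j lam" "i \<in> {1..j}"
  shows "T_H p lam \<le> x i" "x i \<le> L - T_H p lam" 
proof -
  have "0 \<le> 2 * T_H p lam * (real i - real 1)" "0 \<le> 2 * T_H p lam * (real j - real i)"
    using x T_H(1)[OF lam] by auto
  then have "x 1 \<le> x i" "x i \<le> x j"
    using simplex_spacing[OF x(1), of 1 i] simplex_spacing[OF x(1), of i j] x by auto
  then show "T_H p lam \<le> x i" "x i \<le> L - T_H p lam" using x by (auto simp: bump_simplex_def)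
qed

lemma simplex_less:
  assumes lam: "0 < lam" and x: "x \<in> bump_simplex p L j lam" "i \<in> {1..j}" "l \<in> {1..j}" "i < l"
  shows "x i + 2 * T_H p lam \<le> x l" "x i < x l"
proof -
  have "2 * T_H p lam * 1 \<le> 2 * T_H p lam * (real l - real i)"
    using T_H(1)[OF lam] x by (intro mult_left_mono) auto
  then show "x i + 2 * T_H p lam \<le> x l" using simplex_spacing[OF x(1), of i l] x by auto
  then show "x i < x l" using T_H(1)[OF lam] by linarith
qed

lemma fit_iff: "0 < lam \<Longrightarrow> 2 * real j * T_H p lam \<le> L \<longleftrightarrow> Sigma_thr p L j \<le> lam"
  unfolding sqrt_mult_L_bounds(3) T_H(3) by (simp add: field_simps)

lemma simplex_imp_Sigma_le:
  assumes lam: "0 < lam" and "1 \<le> j" and x: "x \<in> bump_simplex p L j lam"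
  shows "Sigma_thr p L j \<le> lam"
proof -
  have "2 * T_H p lam * (real j - real 1) \<le> x j - x 1"
    using assms by (intro simplex_spacing) auto
  also have "\<dots> \<le> L - 2 * T_H p lam" using x by (auto simp: bump_simplex_def)
  finally show ?thesis using fit_iff[OF lam, of j] by (simp add: algebra_simps)
qed

text \<open>The first bump begins at \<open>0\<close> and consecutive bumps touch.\<close>

lemma leftmost_packing:
  assumes lam: "0 < lam" and "1 \<le> j" and "Sigma_thr p L j \<le> lam"
  shows "(\<lambda>i\<in>{1..j}. T_H p lam * (2 * real i - 1)) \<in> bump_simplex p L j lam"
  using fit_iff[OF lam, of j] assms
  by (auto simp: bump_simplex_def of_nat_diff algebra_simps)

abbreviation window :: "real \<Rightarrow> real \<Rightarrow> real set" where
  "window lam c \<equiv> {c - T_H p lam<..<c + T_H p lam}"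

text \<open>At each point at most one bump is active.  This is what makes the sum solve the nonlinear equation:
the nonlinearity never sees two nonzero summands.\<close>

lemma superpose_single:
  assumes lam: "0 < lam" and j: "1 \<le> j" and x: "x \<in> bump_simplex p L j lam"
  obtains i where "i \<in> {1..j}" "\<And>l. l \<in> {1..j} - {i} \<Longrightarrow> T_H p lam \<le> \<bar>t - x l\<bar>"
proof (cases "\<exists>i\<in>{1..j}. \<bar>t - x i\<bar> < T_H p lam")
  case True
  then obtain i where i: "i \<in> {1..j}" "\<bar>t - x i\<bar> < T_H p lam" by auto
  have "T_H p lam \<le> \<bar>t - x l\<bar>" if l: "l \<in> {1..j} - {i}" for l
    using simplex_less(1)[OF lam x, of i l] simplex_less(1)[OF lam x, of l i] i l
    by (cases i l rule: linorder_cases) (auto simp: abs_if split: if_splits)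
  then show ?thesis using that i by blast
next
  case False
  then show ?thesis using that[of 1] j by force
qed

lemma superpose_solution:
  assumes lam: "0 < lam" and j: "1 \<le> j" and x: "x \<in> bump_simplex p L j lam"
  shows "(lam, superpose lam j x) \<in> nonneg_solutions p L a"
    and "t \<in> {0..L} \<Longrightarrow> D_on L (superpose lam j x) t = (\<Sum>i=1..j. bump' lam (t - x i))"
proof -
  let ?u = "\<lambda>t. \<Sum>i=1..j. bump lam (t - x i)"
  let ?du = "\<lambda>t. \<Sum>i=1..j. bump' lam (t - x i)"
  let ?ddu = "\<lambda>t. \<Sum>i=1..j. a * bump lam (t - x i) powr p - lam * bump lam (t - x i)"
  have d: "((\<lambda>t. t - c) has_real_derivative 1) (at t)" for c t :: real
    by (auto intro!: derivative_eq_intros)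
  have du0: "(?u has_real_derivative ?du t) (at t)" for t
    using DERIV_chain2[OF DERIV_bump(1)[OF lam] d] by (intro DERIV_sum) simp
  have ddu0: "(?du has_real_derivative ?ddu t) (at t)" for t
    using DERIV_chain2[OF DERIV_bump(2)[OF lam] d] by (intro DERIV_sum) simp
  have sup: "superpose lam j x t = ?u t" if "t \<in> {0..L}" for t
    using that by (simp add: superpose_def)
  have du: "(superpose lam j x has_real_derivative ?du t) (at t within {0..L})" if t: "t \<in> {0..L}" for t
    using has_field_derivative_at_within[OF du0[of t]]
    by (rule has_field_derivative_transform_within[where d=1]) (use t sup in auto)
  show "t \<in> {0..L} \<Longrightarrow> D_on L (superpose lam j x) t = ?du t" for t
    using D_on_eqI[OF L _ du] .
  have ends: "superpose lam j x 0 = 0" "superpose lam j x L = 0"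
  proof -
    have "T_H p lam \<le> \<bar>0 - x i\<bar>" "T_H p lam \<le> \<bar>L - x i\<bar>" if "i \<in> {1..j}" for i
      using simplex_range[OF lam x that] by linarith+
    then show "superpose lam j x 0 = 0" "superpose lam j x L = 0"
      using L by (simp_all add: sup bump_values(2)[OF lam])
  qed
  have "is_solution p L a lam (superpose lam j x)"
  proof (rule is_solutionI[OF L _ ends du has_field_derivative_at_within[OF ddu0]])
    show "superpose lam j x \<in> extensional {0..L}" by (simp add: superpose_def)
    have cb: "continuous_on {0..L} (\<lambda>t. bump lam (t - x i))" for i
      using DERIV_chain2[OF DERIV_bump(1)[OF lam] d]
      by (intro continuous_at_imp_continuous_on ballI DERIV_isCont) blast
    show "continuous_on {0..L} ?ddu"
      using p bump_values(1)[OF lam]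
      by (intro continuous_on_sum continuous_on_diff continuous_on_mult continuous_on_const cb continuous_on_powr_const)
    fix t assume t: "t \<in> {0..L}"
    obtain i where i: "i \<in> {1..j}" "\<And>l. l \<in> {1..j} - {i} \<Longrightarrow> T_H p lam \<le> \<bar>t - x l\<bar>"
      using superpose_single[OF lam j x] by blast
    define v where "v = bump lam (t - x i)"
    have v: "0 \<le> v" by (simp add: v_def bump_values(1)[OF lam])
    have z: "bump lam (t - x l) = 0" if "l \<in> {1..j} - {i}" for l
      using bump_values(2)[OF lam i(2)[OF that]] .
    have "superpose lam j x t = v + (\<Sum>l\<in>{1..j} - {i}. bump lam (t - x l))"
      unfolding sup[OF t] v_def by (rule sum.remove) (use i in auto)
    then have u: "superpose lam j x t = v" using z by simp
    have "?ddu t = (a * v powr p - lam * v) + (\<Sum>l\<in>{1..j} - {i}. a * bump lam (t - x l) powr p - lam * bump lam (t - x l))"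
      unfolding v_def by (rule sum.remove) (use i in auto)
    then have dd: "?ddu t = a * v powr p - lam * v" using z by simp
    have "\<bar>v\<bar> powr (p - 1) * v = v powr p"
      using v powr_mult_base[of v "p - 1"] by (cases "v = 0") (auto simp: mult.commute)
    then show "- ?ddu t = lam * superpose lam j x t - a * (\<bar>superpose lam j x t\<bar> powr (p - 1) * superpose lam j x t)"
      unfolding dd u by simp
  qed
  moreover have "0 \<le> superpose lam j x t" if "t \<in> {0..L}" for t
    using sup[OF that] bump_values(1)[OF lam] by (simp add: sum_nonneg)
  moreover have "superpose lam j x (x 1) \<noteq> 0"
  proof -
    have "x 1 \<in> {0..L}" using simplex_range[OF lam x, of 1] j T_H(1)[OF lam] by auto
    moreover have "bump lam (x 1 - x 1) \<le> ?u (x 1)"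
      using j bump_values(1)[OF lam] by (intro member_le_sum[of 1 _ "\<lambda>i. bump lam (x 1 - x i)"]) auto
    moreover have "0 < bump lam (x 1 - x 1)" using bump_values(3)[OF lam] T_H(1)[OF lam] by simp
    ultimately show ?thesis using sup[of "x 1"] by simp
  qed
  moreover have "x 1 \<in> {0..L}" using simplex_range[OF lam x, of 1] j T_H(1)[OF lam] by auto
  ultimately show "(lam, superpose lam j x) \<in> nonneg_solutions p L a"
    unfolding nonneg_solutions_def by blast
qed

lemma superpose_near:
  assumes lam: "0 < lam" and j: "1 \<le> j" and x: "x \<in> bump_simplex p L j lam"
    and i: "i \<in> {1..j}" "\<bar>t - x i\<bar> < T_H p lam"
  shows "t \<in> {0<..<L}" "superpose lam j x t = bump lam (t - x i)"
proof -
  show t: "t \<in> {0<..<L}" using simplex_range[OF lam x i(1)] i(2) by (auto simp: abs_if split: if_splits)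
  obtain i' where i': "\<And>l. l \<in> {1..j} - {i'} \<Longrightarrow> T_H p lam \<le> \<bar>t - x l\<bar>"
    using superpose_single[OF lam j x] by blast
  then have "i = i'" using i by force
  then have "bump lam (t - x l) = 0" if "l \<in> {1..j} - {i}" for l
    using i' that bump_values(2)[OF lam] by blast
  moreover have "(\<Sum>l=1..j. bump lam (t - x l)) = bump lam (t - x i) + (\<Sum>l\<in>{1..j} - {i}. bump lam (t - x l))"
    by (rule sum.remove) (use i in auto)
  ultimately show "superpose lam j x t = bump lam (t - x i)" using t by (simp add: superpose_def)
qed

lemma bumps_superpose:
  assumes lam: "0 < lam" and j: "1 \<le> j" and x: "x \<in> bump_simplex p L j lam"
  shows "bumps L (superpose lam j x) = (\<lambda>i. (window lam (x i))) ` {1..j}"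
  unfolding bumps_def
proof (rule components_open_unique)
  show "pairwise disjnt ((\<lambda>i. (window lam (x i))) ` {1..j})"
  proof (rule pairwiseI, clarify)
    fix i l assume il: "i \<in> {1..j}" "l \<in> {1..j}"
      "(window lam (x i)) \<noteq> (window lam (x l))"
    then show "disjnt (window lam (x i)) (window lam (x l))"
      using simplex_less(1)[OF lam x, of i l] simplex_less(1)[OF lam x, of l i]
      by (cases i l rule: linorder_cases) (auto simp: disjnt_iff)
  qed
  show "\<Union> ((\<lambda>i. (window lam (x i))) ` {1..j}) = {t \<in> {0<..<L}. 0 < superpose lam j x t}"
  proof (intro equalityI subsetI)
    fix t assume "t \<in> \<Union> ((\<lambda>i. (window lam (x i))) ` {1..j})"
    then obtain i where i: "i \<in> {1..j}" "\<bar>t - x i\<bar> < T_H p lam" by (auto simp: abs_if)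
    show "t \<in> {t \<in> {0<..<L}. 0 < superpose lam j x t}"
      using superpose_near[OF lam j x i] bump_values(3)[OF lam i(2)] by simp
  next
    fix t assume t: "t \<in> {t \<in> {0<..<L}. 0 < superpose lam j x t}"
    then have "(\<Sum>i=1..j. bump lam (t - x i)) \<noteq> 0" by (auto simp: superpose_def)
    then obtain i where i: "i \<in> {1..j}" "bump lam (t - x i) \<noteq> 0"
      by (rule sum.not_neutral_contains_not_neutral)
    then have "\<bar>t - x i\<bar> < T_H p lam"
      using bump_values(2)[OF lam, of "t - x i"] by linarith
    then have "t \<in> (window lam (x i))" by (simp add: abs_diff_less_iff)
    then show "t \<in> \<Union> ((\<lambda>i. (window lam (x i))) ` {1..j})"
      using i(1) by blast
  qed
  show "open X \<and> connected X \<and> X \<noteq> {}"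
    if "X \<in> (\<lambda>i. (window lam (x i))) ` {1..j}" for X
    using that T_H(1)[OF lam] connected_Ioo by (auto simp: not_le)
qed

lemma bump_point_superpose:
  assumes lam: "0 < lam" and j: "1 \<le> j" and x: "x \<in> bump_simplex p L j lam" and i: "i \<in> {1..j}"
  shows "bump_point (superpose lam j x) (window lam (x i)) = x i"
  unfolding bump_point_def
proof (rule the_equality)
  note v = superpose_near(2)[OF lam j x i]
  have T: "0 < T_H p lam" using T_H(1)[OF lam] .
  have u: "superpose lam j x t = bump lam (t - x i)" if "t \<in> (window lam (x i))" for t
    using v[of t] that by (auto simp: abs_if)
  have le: "bump lam y \<le> amplitude lam 1" for y
    using bump_values(4,5)[OF lam] by (cases "y = 0") (auto simp: less_imp_le)
  show "occurs_at (superpose lam j x) (window lam (x i)) (x i)"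
    using T u le bump_values(4)[OF lam] by (auto simp: occurs_at_def)
  fix y assume "occurs_at (superpose lam j x) (window lam (x i)) y"
  then have y: "y \<in> (window lam (x i))" "superpose lam j x (x i) \<le> superpose lam j x y"
    using T by (auto simp: occurs_at_def)
  then have "amplitude lam 1 \<le> bump lam (y - x i)"
    using u[of "x i"] u[of y] T bump_values(4)[OF lam] by auto
  then show "y = x i" using bump_values(5)[OF lam, of "y - x i"] by force
qed

lemma inj_on_simplex:
  assumes lam: "0 < lam" and x: "x \<in> bump_simplex p L j lam"
  shows "inj_on x {1..j}"
  by (rule linorder_inj_onI) (use simplex_less(2)[OF lam x] in \<open>force+\<close>)

lemma card_bumps_superpose:
  assumes lam: "0 < lam" and j: "1 \<le> j" and x: "x \<in> bump_simplex p L j lam"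
  shows "card (bumps L (superpose lam j x)) = j"
proof -
  have "inj_on (\<lambda>i. (window lam (x i))) {1..j}"
  proof (rule inj_onI)
    fix i l assume il: "i \<in> {1..j}" "l \<in> {1..j}"
      "(window lam (x i)) = (window lam (x l))"
    then have "x i = x l" using T_H(1)[OF lam] by (simp add: greaterThanLessThan_eq_iff)
    then show "i = l" using inj_on_simplex[OF lam x] il by (auto dest: inj_onD)
  qed
  then show ?thesis by (simp add: bumps_superpose[OF assms] card_image)
qed

lemma bump_vector_superpose:
  assumes lam: "0 < lam" and j: "1 \<le> j" and x: "x \<in> bump_simplex p L j lam"
  shows "bump_vector L j (superpose lam j x) = x"
proof -
  have "bump_point (superpose lam j x) ` bumps L (superpose lam j x) = x ` {1..j}"
    unfolding bumps_superpose[OF assms] image_image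
    by (intro image_cong refl bump_point_superpose[OF assms])
  also have "\<dots> = set (map x [1..<Suc j])" by (simp add: atLeastLessThanSuc_atLeastAtMost del: upt_Suc)
  finally have s: "bump_point (superpose lam j x) ` bumps L (superpose lam j x) = set (map x [1..<Suc j])" .
  have "sorted_wrt (<) (map x [1..<Suc j])"
    unfolding sorted_wrt_map
    by (rule sorted_wrt_mono_rel[OF _ sorted_wrt_upt]) (use simplex_less(2)[OF lam x] in auto)
  then have l: "sorted_list_of_set (set (map x [1..<Suc j])) = map x [1..<Suc j]"
    by (intro sorted_list_of_set.idem_if_sorted_distinct) (auto simp: strict_sorted_iff simp del: upt_Suc)
  show ?thesis
  proof
    fix i show "bump_vector L j (superpose lam j x) i = x i"
      using x unfolding bump_vector_def s l bump_simplex_def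
      by (cases "i \<in> {1..j}") (auto simp: extensional_def simp del: upt_Suc)
  qed
qed

lemma solution_continuous:
  assumes "(lam, u) \<in> nonneg_solutions p L a"
  shows "continuous_on {0..L} u"
  by (rule DERIV_continuous_on) (rule is_solutionD(5)[OF nonneg_solutionsD(1)[OF assms]])

section \<open>Classification of the solutions\<close>

text \<open>A bump is an open interval, and at an end point \<open>u\<close> must vanish: otherwise the end point could be
added to the interval, against maximality of the component.\<close>

lemma bump_interval:
  assumes sol: "(lam, u) \<in> nonneg_solutions p L a" and I: "I \<in> bumps L u"
  obtains al ga where "I = {al<..<ga}" "0 \<le> al" "al < ga" "ga \<le> L" "u al = 0" "u ga = 0"
    "\<And>x. x \<in> {al<..<ga} \<Longrightarrow> 0 < u x"
proof -
  define S where "S = {x \<in> {0<..<L}. 0 < u x}"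
  have I: "I \<in> components S" using I by (simp add: bumps_def S_def)
  have "continuous_on {0<..<L} u"
    using solution_continuous[OF sol] by (rule continuous_on_subset) auto
  then have "open ({0<..<L} \<inter> u -` {0<..})"
    by (rule continuous_open_preimage) auto
  moreover have "{0<..<L} \<inter> u -` {0<..} = S" by (auto simp: S_def)
  ultimately have "open S" by simp
  then have oI: "open I" using I open_components by blast
  have sub: "I \<subseteq> S" using I in_components_subset by blast
  have ne: "I \<noteq> {}" using I in_components_nonempty by blast
  have con: "connected I" using I in_components_connected by blast
  have bdd: "bdd_below I" "bdd_above I"
    using sub by (auto simp: S_def intro!: bdd_belowI[of _ 0] bdd_aboveI[of _ L])
  define al ga where "al = Inf I" and "ga = Sup I"
  have bet: "x \<in> I" if ax: "al < x" and xg: "x < ga" for x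
  proof -
    obtain y where "y \<in> I" "y < x"
      using ax cInf_less_iff[OF ne bdd(1), of x] unfolding al_def by blast
    moreover obtain z where "z \<in> I" "x < z"
      using xg less_cSup_iff[OF ne bdd(2), of x] unfolding ga_def by blast
    ultimately show "x \<in> I" using connectedD_interval[OF con, of y z x] by auto
  qed
  have strict: "al < x \<and> x < ga" if x: "x \<in> I" for x
  proof -
    obtain e where e: "0 < e" "\<And>y. \<bar>y - x\<bar> < e \<Longrightarrow> y \<in> I"
      using oI x unfolding open_dist dist_real_def by blast
    have "x - e / 2 \<in> I" "x + e / 2 \<in> I" using e by auto
    then have "al \<le> x - e / 2" "x + e / 2 \<le> ga"
      using cInf_lower[OF _ bdd(1)] cSup_upper[OF _ bdd(2)] by (auto simp: al_def ga_def)
    then show ?thesis using e(1) by auto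
  qed
  have Ieq: "I = {al<..<ga}" using bet strict by auto
  then have lt: "al < ga" using ne by auto
  have b0: "0 \<le> al" "ga \<le> L"
  proof -
    have "0 \<le> x" "x \<le> L" if "x \<in> I" for x using sub that by (auto simp: S_def)
    then show "0 \<le> al" "ga \<le> L"
      unfolding al_def ga_def using cInf_greatest[OF ne, of 0] cSup_least[OF ne, of L] by blast+
  qed
  have notin: "e \<notin> S" if e: "e = al \<or> e = ga" for e
  proof
    assume "e \<in> S"
    have "insert e I = (if e = al then {al..<ga} else {al<..ga})" using Ieq lt e by auto
    then have "connected (insert e I)" by (simp add: connected_Ico connected_Ioc)
    then have "insert e I \<subseteq> I"
      using I \<open>e \<in> S\<close> sub ne by (intro components_maximal[OF I]) auto
    then show False using Ieq e by auto
  qed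
  have z: "u e = 0" if e: "e = al \<or> e = ga" for e
  proof -
    have "e \<in> {0..L}" using e b0 lt by auto
    then have "0 \<le> u e" using nonneg_solutionsD(2)[OF sol] by blast
    moreover have "u 0 = 0" "u L = 0" using is_solutionD(2,3)[OF nonneg_solutionsD(1)[OF sol]] by auto
    ultimately show ?thesis
      using notin[OF e] \<open>e \<in> {0..L}\<close> by (cases "e = 0"; cases "e = L") (auto simp: S_def)
  qed
  show ?thesis
  proof (rule that[OF Ieq b0(1) lt b0(2)])
    show "u al = 0" "u ga = 0" using z by simp_all
    show "0 < u x" if "x \<in> {al<..<ga}" for x using subsetD[OF sub, of x] that Ieq by (simp add: S_def)
  qed
qed

lemma bumps_nonempty:
  assumes sol: "(lam, u) \<in> nonneg_solutions p L a"
  shows "bumps L u \<noteq> {}"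
proof -
  obtain x where x: "x \<in> {0..L}" "0 < u x" using nonneg_solutionsD(3)[OF sol] by blast
  moreover have "u 0 = 0" "u L = 0" using is_solutionD(2,3)[OF nonneg_solutionsD(1)[OF sol]] by auto
  ultimately have "x \<in> {x \<in> {0<..<L}. 0 < u x}" by (auto simp: less_le)
  then show ?thesis unfolding bumps_def components_eq_empty by blast
qed

text \<open>The lower bound holds because the maximum is \<open>amplitude lam b\<close> with \<open>b \<le> 1\<close>, and the amplitude decreases
in \<open>b\<close>.\<close>

lemma bump_maximum:
  assumes sol: "(lam, u) \<in> nonneg_solutions p L a" and I: "I \<in> bumps L u"
  shows "\<exists>!x. occurs_at u I x" "(2 * a / ((p + 1) * lam)) powr (1 / (1 - p)) \<le> u (bump_point u I)" "0 < lam"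
proof -
  obtain al ga where ag: "I = {al<..<ga}" "0 \<le> al" "al < ga" "ga \<le> L" "u al = 0" "u ga = 0"
    "\<And>x. x \<in> {al<..<ga} \<Longrightarrow> 0 < u x"
    using bump_interval[OF sol I] by metis
  obtain M b c \<psi> where pr: "0 < lam" "0 < M" "0 < b" "b \<le> 1" "b = 1 \<longleftrightarrow> D_on L u 0 = 0"
    "b * lam * M powr (1 - p) = 2 * a / (p + 1)" "al < c" "c < ga" "u c = M" "\<psi> ga = pi"
    "\<And>x. x \<in> {al<..<ga} - {c} \<Longrightarrow> u x < M"
    "\<And>x. x \<in> {al..ga} \<Longrightarrow> \<psi> x \<in> {0..pi}"
    "\<And>x. x \<in> {al..ga} \<Longrightarrow> u x = M * sin (\<psi> x) powr k"
    "\<And>x. x \<in> {al..ga} \<Longrightarrow> quad k b (\<psi> x) = sqrt lam * (x - al)"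
    using positive_interval_profile[OF sol ag(2-7)] by blast
  have oc: "occurs_at u I x \<longleftrightarrow> x = c" for x
  proof
    assume "occurs_at u I x"
    then have x: "x \<in> {al<..<ga}" "\<forall>y\<in>{al<..<ga}. u y \<le> u x" by (simp_all add: occurs_at_def ag(1))
    have "c \<in> {al<..<ga}" using pr(7,8) by simp
    then have "M \<le> u x" using x(2) pr(9) by blast
    then show "x = c" using pr(11)[of x] x(1) by (cases "x = c") auto
  next
    have "u y \<le> u c" if "y \<in> {al<..<ga}" for y
      using pr(9) pr(11)[of y] that by (cases "y = c") auto
    moreover assume "x = c"
    ultimately show "occurs_at u I x" using pr(7,8) unfolding occurs_at_def ag(1) by simp
  qed
  then show "\<exists>!x. occurs_at u I x" by auto
  have "bump_point u I = c" by (simp add: bump_point_def oc)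
  moreover have "M = amplitude lam b" using amplitude(3)[OF pr(1,3,2,6)] .
  moreover have "2 * a / ((p + 1) * lam) \<le> 2 * a / ((p + 1) * lam * b)"
    using pr(1,3,4) a p by (intro divide_left_mono) (auto simp: mult_le_cancel_left1)
  then have "(2 * a / ((p + 1) * lam)) powr (1 / (1 - p)) \<le> amplitude lam b"
    unfolding amplitude_def using pr(1) a p by (intro powr_mono2) auto
  ultimately show "(2 * a / ((p + 1) * lam)) powr (1 / (1 - p)) \<le> u (bump_point u I)"
    using pr(9) by simp
  show "0 < lam" by fact
qed

text \<open>The length of the bump determines \<open>b\<close>, then \<open>b\<close> determines the maximum and the phase.\<close>

lemma positive_solution_is_low:
  assumes sol: "(lam, u) \<in> nonneg_solutions p L a" and I: "{0<..<L} \<in> bumps L u"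
  shows "lam \<in> low_range" "u = low lam"
proof -
  note s = is_solutionD[OF nonneg_solutionsD(1)[OF sol]]
  have pos: "0 < u x" if "x \<in> {0<..<L}" for x
    using I in_components_subset[of "{0<..<L}"] that by (force simp: bumps_def)
  obtain M b c \<psi> where pr: "0 < lam" "0 < M" "0 < b" "b \<le> 1" "b = 1 \<longleftrightarrow> D_on L u 0 = 0"
    "b * lam * M powr (1 - p) = 2 * a / (p + 1)" "0 < c" "c < L" "u c = M" "\<psi> L = pi"
    "\<And>x. x \<in> {0<..<L} - {c} \<Longrightarrow> u x < M"
    "\<And>x. x \<in> {0..L} \<Longrightarrow> \<psi> x \<in> {0..pi}"
    "\<And>x. x \<in> {0..L} \<Longrightarrow> u x = M * sin (\<psi> x) powr k"
    "\<And>x. x \<in> {0..L} \<Longrightarrow> quad k b (\<psi> x) = sqrt lam * (x - 0)"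
    using positive_interval_profile[OF sol order_refl L order_refl s(2,3) pos] by blast
  have q: "quad k b pi = sqrt lam * L" using pr(14)[of L] pr(10) L by simp
  have b: "b = low_b lam" using low_b_unique[OF _ pr(4) q] pr(3) by simp
  have "pi < quad k b pi" using quad_strict_mono_param[OF k_gt(2), of 0 b] quad_zero[OF k_gt(2)] pr(3,4) by simp
  moreover have "quad k b pi \<le> k * pi" 
  proof -
    have "quad k b pi \<in> {pi..k * pi}" unfolding quad_range[symmetric] using pr(3,4) by auto
    then show ?thesis by simp
  qed
  ultimately show "lam \<in> low_range"
    using sqrt_mult_L_bounds(1)[of lam] sqrt_mult_L_bounds(4)[of lam 1] q by auto
  have M: "M = amplitude lam b" using amplitude(3)[OF pr(1,3,2,6)] .
  show "u = low lam"
  proof (rule extensionalityI[OF s(1)])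
    show "low lam \<in> extensional {0..L}" by (simp add: low_def)
    fix x assume x: "x \<in> {0..L}"
    have "quad_inv k b (sqrt lam * x) = \<psi> x"
      using quad_inv_quad[OF k_gt(2) less_imp_le[OF pr(3)] pr(4) pr(12)[OF x]] pr(14)[OF x] by simp
    then show "u x = low lam x"
      using x pr(13)[OF x] M b by (simp add: low_def profile_def)
  qed
qed

text \<open>An interior zero would be a minimum, so the slope there would vanish and the energy would be \<open>0\<close>.\<close>

lemma single_bump_if_nonzero_slope:
  assumes sol: "(lam, u) \<in> nonneg_solutions p L a" and du0: "D_on L u 0 \<noteq> 0"
  shows "{0<..<L} \<in> bumps L u"
proof -
  note s = is_solutionD[OF nonneg_solutionsD(1)[OF sol]]
  have nz: "u x \<noteq> 0" if x: "x \<in> {0<..<L}" for x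
  proof
    assume ux: "u x = 0"
    have "D_on L u x = 0"
    proof (rule DERIV_local_min)
      show "(u has_real_derivative D_on L u x) (at x)"
        using s(5)[of x] x at_within_Icc_at[of 0 x L] by simp
      show "0 < min x (L - x)" using x by simp
      show "\<forall>y. \<bar>x - y\<bar> < min x (L - x) \<longrightarrow> u x \<le> u y"
        using nonneg_solutionsD(2)[OF sol] by (auto simp: ux abs_less_iff)
    qed
    then show False using energy_conservation[OF sol, of x] x ux du0 p by simp
  qed
  obtain I where I: "I \<in> bumps L u" using bumps_nonempty[OF sol] by blast
  obtain al ga where ag: "I = {al<..<ga}" "0 \<le> al" "al < ga" "ga \<le> L" "u al = 0" "u ga = 0"
    using bump_interval[OF sol I] by metis
  have "al = 0" "ga = L" using nz[of al] nz[of ga] ag by force+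
  then show ?thesis using I ag(1) by simp
qed

text \<open>Here \<open>b = 1\<close>, and \<open>S\<^sub>1(t) = k t\<close> makes the phase linear in \<open>x\<close>.\<close>

lemma flat_bump:
  assumes sol: "(lam, u) \<in> nonneg_solutions p L a" and du0: "D_on L u 0 = 0" and I: "I \<in> bumps L u"
  obtains c where "I = (window lam c)" "T_H p lam \<le> c" "c \<le> L - T_H p lam"
    "\<And>x. x \<in> I \<Longrightarrow> u x = bump lam (x - c)"
proof -
  obtain al ga where ag: "I = {al<..<ga}" "0 \<le> al" "al < ga" "ga \<le> L" "u al = 0" "u ga = 0"
    "\<And>x. x \<in> {al<..<ga} \<Longrightarrow> 0 < u x"
    using bump_interval[OF sol I] by metis
  obtain M b c \<psi> where pr: "0 < lam" "0 < M" "0 < b" "b \<le> 1" "b = 1 \<longleftrightarrow> D_on L u 0 = 0"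
    "b * lam * M powr (1 - p) = 2 * a / (p + 1)" "al < c" "c < ga" "u c = M" "\<psi> ga = pi"
    "\<And>x. x \<in> {al<..<ga} - {c} \<Longrightarrow> u x < M"
    "\<And>x. x \<in> {al..ga} \<Longrightarrow> \<psi> x \<in> {0..pi}"
    "\<And>x. x \<in> {al..ga} \<Longrightarrow> u x = M * sin (\<psi> x) powr k"
    "\<And>x. x \<in> {al..ga} \<Longrightarrow> quad k b (\<psi> x) = sqrt lam * (x - al)"
    using positive_interval_profile[OF sol ag(2-7)] by blast
  have b: "b = 1" using pr(5) du0 by simp
  have M: "M = amplitude lam 1" using amplitude(3)[OF pr(1) _ pr(2,6)] b by simp
  define w where "w = sqrt lam / k"
  define T where "T = T_H p lam"
  have w: "0 < w" "w * T = pi / 2" "0 < T"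
    using pr(1) k_gt T_H(1,2)[OF pr(1)] by (auto simp: w_def T_def)
  have psi: "\<psi> x = w * (x - al)" if x: "x \<in> {al..ga}" for x
  proof -
    have "k * \<psi> x = sqrt lam * (x - al)"
      using pr(12)[OF x] pr(14)[OF x] quad_one[OF k_gt(2), of "\<psi> x"] b by auto
    then show ?thesis using k_gt by (simp add: w_def field_simps)
  qed
  have "w * (ga - al) = w * (2 * T)" using psi[of ga] pr(10) ag w by simp
  then have ga: "ga = al + 2 * T" using w by simp
  show ?thesis
  proof (rule that[of "al + T"])
    have "al + T - T = al" "al + T + T = ga" using ga by simp_all
    then show "I = {al + T - T_H p lam<..<al + T + T_H p lam}" using ag(1) by (simp only: T_def)
    show "T_H p lam \<le> al + T" "al + T \<le> L - T_H p lam" using ag ga by (simp_all add: T_def)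
    fix x assume "x \<in> I"
    then have x: "x \<in> {al..ga}" "\<bar>x - (al + T)\<bar> < T" using ag(1) ga by auto
    have "\<bar>w * (x - (al + T))\<bar> < pi / 2"
      using T_H_ivl[OF pr(1), of "x - (al + T)"] x(2) unfolding w_def T_def by blast
    then have "clamped_cos (w * (x - (al + T))) = cos (w * (x - (al + T)))" by (intro clamped_cos_simps) simp
    moreover have "w * (x - (al + T)) = w * (x - al) - pi / 2" using w(2) by (simp add: algebra_simps)
    ultimately have "clamped_cos (w * (x - (al + T))) = sin (\<psi> x)" by (simp only: psi[OF x(1)] cos_diff) simp
    then show "u x = bump lam (x - (al + T))"
      unfolding bump_def hump_def w_def[symmetric] using pr(13)[OF x(1)] M by simp
  qed
qed

text \<open>The map \<open>c \<mapsto> \<lfloor>c/d\<rfloor>\<close> is injective on a \<open>d\<close>-separated set.\<close>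

lemma finite_separated_in_interval:
  fixes C :: "real set"
  assumes d: "0 < d" and C: "C \<subseteq> {lo..hi}"
    and sep: "\<And>x y. x \<in> C \<Longrightarrow> y \<in> C \<Longrightarrow> x < y \<Longrightarrow> x + d \<le> y"
  shows "finite C"
proof (rule inj_on_finite)
  show "inj_on (\<lambda>c. \<lfloor>c / d\<rfloor>) C"
  proof (rule linorder_inj_onI)
    fix x y assume "x < y" "x \<in> C" "y \<in> C"
    then have "(x + d) / d \<le> y / d" using sep[of x y] d by (intro divide_right_mono) auto
    then have "x / d + 1 \<le> y / d" using d by (simp add: add_divide_distrib)
    then have "\<lfloor>x / d\<rfloor> + 1 \<le> \<lfloor>y / d\<rfloor>" by linarith
    then show "\<lfloor>x / d\<rfloor> \<noteq> \<lfloor>y / d\<rfloor>" by simp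
  qed auto
  show "(\<lambda>c. \<lfloor>c / d\<rfloor>) ` C \<subseteq> {\<lfloor>lo / d\<rfloor>..\<lfloor>hi / d\<rfloor>}"
    using d subsetD[OF C] by (auto intro!: floor_mono divide_right_mono)
qed simp

lemma flat_solution_is_superposition:
  assumes sol: "(lam, u) \<in> nonneg_solutions p L a" and du0: "D_on L u 0 = 0"
  obtains j x where "1 \<le> j" "x \<in> bump_simplex p L j lam" "u = superpose lam j x"
proof -
  note s = is_solutionD[OF nonneg_solutionsD(1)[OF sol]]
  define T where "T = T_H p lam"
  define C where "C = {c. {c - T<..<c + T} \<in> bumps L u}"
  obtain I0 where I0: "I0 \<in> bumps L u" using bumps_nonempty[OF sol] by blast
  have lam: "0 < lam" using bump_maximum(3)[OF sol I0] .
  have T: "0 < T" using T_H(1)[OF lam] by (simp add: T_def)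
  have cen: "T \<le> c \<and> c \<le> L - T \<and> (\<forall>x\<in>{c - T<..<c + T}. u x = bump lam (x - c))" if c: "c \<in> C" for c
  proof -
    have "{c - T<..<c + T} \<in> bumps L u" using c by (simp add: C_def)
    then obtain c' where c': "{c - T<..<c + T} = {c' - T<..<c' + T}" "T \<le> c'" "c' \<le> L - T"
      "\<And>x. x \<in> {c - T<..<c + T} \<Longrightarrow> u x = bump lam (x - c')"
      using flat_bump[OF sol du0, folded T_def] by metis
    moreover have "c = c'" using c'(1) T by (simp add: greaterThanLessThan_eq_iff)
    ultimately show ?thesis by auto
  qed
  have exC: "\<exists>c\<in>C. I = {c - T<..<c + T}" if "I \<in> bumps L u" for I
    using flat_bump[OF sol du0 that, folded T_def] that by (auto simp: C_def)
  have sep: "x + 2 * T \<le> y" if xy: "x \<in> C" "y \<in> C" "x < y" for x y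
  proof (rule ccontr)
    assume "\<not> x + 2 * T \<le> y"
    then have "(x + y) / 2 \<in> {x - T<..<x + T} \<inter> {y - T<..<y + T}" using xy by (auto simp: field_simps)
    then have "{x - T<..<x + T} = {y - T<..<y + T}"
      using xy(1,2) components_nonoverlap unfolding C_def bumps_def mem_Collect_eq by (metis empty_iff)
    then show False using T xy by (simp add: greaterThanLessThan_eq_iff)
  qed
  have finC: "finite C"
    by (rule finite_separated_in_interval[of "2 * T" C 0 L]) (use T cen sep in force)+
  define xs where "xs = sorted_list_of_set C"
  define j where "j = card C"
  have xs: "set xs = C" "length xs = j" "sorted_wrt (<) xs"
    using finC by (auto simp: xs_def j_def)
  have "C \<noteq> {}" using exC[OF I0] by auto
  then have j: "1 \<le> j" using finC by (simp add: j_def Suc_le_eq card_gt_0_iff)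
  \<comment> \<open>the bumps are numbered from \<open>1\<close>, the entries of the sorted list from \<open>0\<close>\<close>
  define x where "x = (\<lambda>i\<in>{1..j}. xs ! (i - 1))"
  have xC: "x i \<in> C" if "i \<in> {1..j}" for i
    using that xs nth_mem[of "i - 1" xs] by (auto simp: x_def)
  have bij: "bij_betw x {1..j} C"
    unfolding bij_betw_def
  proof
    show "inj_on x {1..j}"
    proof (rule inj_onI)
      fix i l assume "i \<in> {1..j}" "l \<in> {1..j}" "x i = x l"
      then have "i - 1 = l - 1"
        using xs nth_eq_iff_index_eq[of xs "i - 1" "l - 1"] by (auto simp: x_def strict_sorted_iff)
      then show "i = l" using \<open>i \<in> {1..j}\<close> \<open>l \<in> {1..j}\<close> by auto
    qed
    show "x ` {1..j} = C"
    proof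
      show "C \<subseteq> x ` {1..j}"
      proof
        fix c assume "c \<in> C"
        then obtain n where "n < j" "c = xs ! n" using xs by (metis in_set_conv_nth)
        then show "c \<in> x ` {1..j}" by (intro image_eqI[of _ _ "Suc n"]) (auto simp: x_def)
      qed
    qed (use xC in auto)
  qed
  have simp: "x \<in> bump_simplex p L j lam"
    unfolding bump_simplex_def T_def[symmetric]
  proof (intro CollectI conjI ballI)
    show "x \<in> extensional {1..j}" by (simp add: x_def)
    show "T \<le> x 1" "x j \<le> L - T" using cen[OF xC[of 1]] cen[OF xC[of j]] j by auto
    fix i assume i: "i \<in> {2..j}"
    have "xs ! (i - 1 - 1) < xs ! (i - 1)"
      using i xs by (intro sorted_wrt_nth_less[OF xs(3)]) auto
    then have "x (i - 1) < x i" using i by (auto simp: x_def)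
    moreover have "i \<in> {1..j}" "i - 1 \<in> {1..j}" using i by auto
    ultimately show "2 * T \<le> x i - x (i - 1)" using sep[OF xC xC, of "i - 1" i] by linarith
  qed
  have "u = superpose lam j x"
  proof (rule extensionalityI[OF s(1)])
    show "superpose lam j x \<in> extensional {0..L}" by (simp add: superpose_def)
    fix t assume t: "t \<in> {0..L}"
    show "u t = superpose lam j x t"
    proof (cases "u t = 0")
      case True
      have "bump lam (t - x i) = 0" if i: "i \<in> {1..j}" for i
      proof (rule bump_values(2)[OF lam], rule ccontr)
        assume "\<not> T_H p lam \<le> \<bar>t - x i\<bar>"
        then have "\<bar>t - x i\<bar> < T" by (simp add: T_def)
        moreover from this have "t \<in> {x i - T<..<x i + T}" by (simp add: abs_diff_less_iff)
        ultimately have "0 < u t"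
          using cen[OF xC[OF i]] bump_values(3)[OF lam, of "t - x i"] by (simp add: T_def)
        then show False using True by simp
      qed
      then show ?thesis using True t by (simp add: superpose_def)
    next
      case False
      then have "t \<in> {x \<in> {0<..<L}. 0 < u x}"
        using t s(2,3) nonneg_solutionsD(2)[OF sol t] by (auto simp: less_le)
      then obtain I where I: "I \<in> bumps L u" "t \<in> I"
        unfolding bumps_def using Union_components by blast
      then obtain c where c: "c \<in> C" "t \<in> {c - T<..<c + T}" using exC by blast
      then obtain i where i: "i \<in> {1..j}" "x i = c" using bij unfolding bij_betw_def by blast
      have "\<bar>t - x i\<bar> < T_H p lam" using c i by (simp add: T_def abs_diff_less_iff)
      then show ?thesis
        using superpose_near(2)[OF lam j simp i(1)] cen[OF c(1)] c(2) i(2) by simp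
    qed
  qed
  then show ?thesis using that j simp by blast
qed

end

section \<open>General topology\<close>

lemma connectedin_by_common_point:
  assumes "\<And>x. x \<in> S \<Longrightarrow> \<exists>C. connectedin X C \<and> b \<in> C \<and> x \<in> C \<and> C \<subseteq> S"
  shows "connectedin X S"
proof (cases "S = {}")
  case False
  let ?U = "{C. connectedin X C \<and> b \<in> C \<and> C \<subseteq> S}"
  have "\<Union>?U = S" using assms by blast
  moreover have "connectedin X (\<Union>?U)" by (rule connectedin_Union) auto
  ultimately show ?thesis by simp
qed simp

text \<open>Each block is clopen, because its complement is a union of open blocks; a connected set that meets a
clopen set lies inside it.\<close>

lemma connected_components_of_open_partition:
  assumes con: "\<And>C. C \<in> \<U> \<Longrightarrow> connectedin X C" and op: "\<And>C. C \<in> \<U> \<Longrightarrow> openin X C"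
    and ne: "{} \<notin> \<U>" and disj: "pairwise disjnt \<U>" and un: "\<Union>\<U> = topspace X"
  shows "connected_components_of X = \<U>"
proof -
  have comp: "connected_component_of_set X x = C" if C: "C \<in> \<U>" "x \<in> C" for C x
  proof (rule connected_component_of_unique)
    have "topspace X - C = \<Union>(\<U> - {C})"
    proof -
      have "C \<inter> D = {}" if "D \<in> \<U> - {C}" for D
        using disj C that by (auto simp: pairwise_def disjnt_def)
      then show ?thesis unfolding un[symmetric] using C by blast
    qed
    moreover have "openin X (\<Union>(\<U> - {C}))" using op by blast
    moreover have "C \<subseteq> topspace X" using un C by blast
    ultimately have "closedin X C" by (simp add: closedin_def)
    then show "C' \<subseteq> C" if "x \<in> C' \<and> connectedin X C'" for C'
      using connectedin_clopen_cases[of X C' C] op[OF C(1)] that C by (auto simp: disjnt_iff)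
  qed (use C con in auto)
  show ?thesis
  proof (intro equalityI subsetI)
    fix C assume "C \<in> connected_components_of X"
    then obtain x where "x \<in> topspace X" "C = connected_component_of_set X x"
      by (auto simp: connected_components_of_def)
    then show "C \<in> \<U>" using un comp by blast
  next
    fix C assume C: "C \<in> \<U>"
    then obtain x where x: "x \<in> C" using ne by fastforce
    then have "x \<in> topspace X" using un C by blast
    then show "C \<in> connected_components_of X"
      using comp[OF C x] unfolding connected_components_of_def by blast
  qed
qed

lemma continuous_map_compose_real2:
  fixes F :: "real \<times> real \<Rightarrow> real"
  assumes "continuous_on S F" "continuous_map P euclideanreal f" "continuous_map P euclideanreal g"
    "\<And>z. z \<in> topspace P \<Longrightarrow> (f z, g z) \<in> S"
  shows "continuous_map P euclideanreal (\<lambda>z. F (f z, g z))"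
proof -
  have "continuous_map P (prod_topology euclideanreal euclideanreal) (\<lambda>z. (f z, g z))"
    using assms by (intro continuous_map_pairedI)
  then have "continuous_map P (top_of_set S) (\<lambda>z. (f z, g z))"
    using assms(4) by (intro continuous_map_into_subtopology) auto
  from continuous_map_compose[OF this, of euclideanreal F] assms(1)
  show ?thesis by (simp add: o_def)
qed

lemma powr_at_top:
  fixes f :: "'b \<Rightarrow> real"
  assumes "filterlim f at_top F" "0 < e"
  shows "filterlim (\<lambda>x. f x powr e) at_top F"
proof -
  have "filterlim (\<lambda>x. exp (e * ln (f x))) at_top F"
    using assms by (intro filterlim_compose[OF exp_at_top] filterlim_tendsto_pos_mult_at_top[OF tendsto_const]
        filterlim_compose[OF ln_at_top])
  moreover have ev: "\<forall>\<^sub>F x in F. exp (e * ln (f x)) = f x powr e"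
    using filterlim_at_top_dense[THEN iffD1, OF assms(1), rule_format, of 0]
    by eventually_elim (simp add: powr_def)
  ultimately show ?thesis
    by (simp only: filterlim_cong[OF refl refl ev])
qed

context sublinear_problem begin

section \<open>The branches and their slices\<close>

abbreviation sol_space where "sol_space \<equiv> nonneg_solution_space p L a"

definition branch :: "nat \<Rightarrow> (real \<times> (real \<Rightarrow> real)) set" where
  "branch j = {(lam, u). (lam, u) \<in> nonneg_solutions p L a \<and> card (bumps L u) = j}"

text \<open>The solutions of zero energy with \<open>j\<close> bumps.\<close>

definition packed :: "nat \<Rightarrow> (real \<times> (real \<Rightarrow> real)) set" where
  "packed j = {(lam, superpose lam j x) | lam x. 0 < lam \<and> x \<in> bump_simplex p L j lam}"

definition low_curve :: "(real \<times> (real \<Rightarrow> real)) set" where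
  "low_curve = (\<lambda>lam. (lam, low lam)) ` low_range"

lemma topspace_sol_space: "topspace sol_space = nonneg_solutions p L a"
proof -
  have "(lam, u) \<in> nonneg_solutions p L a \<Longrightarrow> u \<in> C1_space L" for lam u
    using is_solutionD(4)[OF nonneg_solutionsD(1)] .
  then have "nonneg_solutions p L a \<subseteq> UNIV \<times> C1_space L" by auto
  moreover have "topspace (C1_topology L) = C1_space L"
    by (simp add: mspace_C1_metric)
  ultimately show ?thesis by (auto simp: nonneg_solution_space_def)
qed

lemma bumps_positive:
  assumes "\<And>x. x \<in> {0<..<L} \<Longrightarrow> 0 < u x" shows "bumps L u = {{0<..<L}}"
  unfolding bumps_def
  by (rule components_open_unique) (use assms L in \<open>auto simp: connected_Ioo\<close>)

lemma thr_mono: "sigma_thr L 1 < Sigma_thr p L 1" "i < j \<Longrightarrow> Sigma_thr p L i < Sigma_thr p L j"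
  "1 \<le> j \<Longrightarrow> 0 < Sigma_thr p L j" "1 \<le> j \<Longrightarrow> sigma_thr L 1 < Sigma_thr p L j" "0 < sigma_thr L 1"
proof -
  have k: "1 < k" using k_gt by simp
  show "sigma_thr L 1 < Sigma_thr p L j" if "1 \<le> j" for j
  proof -
    have "1 * 1 < k * real j" using k that by (intro mult_less_le_imp_less) auto
    then show ?thesis unfolding sigma_eq using L
      by (intro power_strict_mono divide_strict_right_mono) auto
  qed
  from this[of 1] show "sigma_thr L 1 < Sigma_thr p L 1" by simp
  show "Sigma_thr p L i < Sigma_thr p L j" if "i < j"
    unfolding sigma_eq using L k that
    by (intro power_strict_mono divide_strict_right_mono) auto
  show "0 < Sigma_thr p L j" if "1 \<le> j" unfolding sigma_eq using L k that by simp
  show "0 < sigma_thr L 1" unfolding sigma_eq using L by simp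
qed

text \<open>The energy is zero or positive.  Zero energy yields the superpositions; positive energy yields the curve
and forces a single bump.\<close>

lemma branch_eq:
  assumes "1 \<le> j"
  shows "branch j = (if j = 1 then low_curve \<union> packed 1 else packed j)"
proof -
  have low: "low_curve \<subseteq> branch 1"
    using low_solution(1) bumps_positive[OF low_solution(3)] by (auto simp: low_curve_def branch_def)
  have pack: "packed j \<subseteq> branch j" if "1 \<le> j" for j
    using superpose_solution(1) card_bumps_superpose that by (auto simp: packed_def branch_def)
  have "branch j \<subseteq> (if j = 1 then low_curve \<union> packed 1 else packed j)"
  proof (clarify, unfold branch_def mem_Collect_eq case_prod_conv, elim conjE)
    fix lam u assume sol: "(lam, u) \<in> nonneg_solutions p L a" and card: "card (bumps L u) = j"
    show "(lam, u) \<in> (if j = 1 then low_curve \<union> packed 1 else packed j)"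
    proof (cases "D_on L u 0 = 0")
      case True
      then obtain i x where x: "1 \<le> i" "x \<in> bump_simplex p L i lam" "u = superpose lam i x"
        using flat_solution_is_superposition[OF sol] by blast
      have lam: "0 < lam" using bump_maximum(3)[OF sol] bumps_nonempty[OF sol] by blast
      have "i = j" using card_bumps_superpose[OF lam x(1,2)] card x(3) by simp
      then show ?thesis using x lam by (auto simp: packed_def)
    next
      case False
      note I = single_bump_if_nonzero_slope[OF sol False]
      note l = positive_solution_is_low[OF sol I]
      have "(lam, u) \<in> low_curve" using l by (auto simp: low_curve_def)
      moreover from this have "j = 1" using low card by (auto simp: branch_def)
      ultimately show ?thesis by simp
    qed
  qed
  then show ?thesis using low pack[OF assms] assms by (auto split: if_splits)
qed

lemma packed_Sigma_le: "1 \<le> j \<Longrightarrow> (lam, u) \<in> packed j \<Longrightarrow> Sigma_thr p L j \<le> lam"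
  using simplex_imp_Sigma_le by (auto simp: packed_def)

lemma packed_at_threshold:
  assumes "1 \<le> j" "Sigma_thr p L j \<le> lam"
  shows "\<exists>x \<in> bump_simplex p L j lam. (lam, superpose lam j x) \<in> packed j"
  using leftmost_packing[OF _ assms] thr_mono(3)[OF assms(1)] assms(2)
  by (fastforce simp: packed_def)

text \<open>The curve and the superpositions of one bump overlap at most for \<open>\<lambda> = \<Sigma>\<^sub>1\<close>.  There a single bump of width \<open>L\<close> is
positive on all of \<open>(0,L)\<close>, so it is the solution on the curve.\<close>

lemma slice_low:
  assumes lam: "lam \<in> low_range"
  shows "slice (branch 1) lam = {low lam}"
proof -
  have "u = low lam" if u: "(lam, u) \<in> packed 1" for u
  proof -
    obtain x where x: "0 < lam" "x \<in> bump_simplex p L 1 lam" "u = superpose lam 1 x"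
      using u by (auto simp: packed_def)
    have sol: "(lam, u) \<in> nonneg_solutions p L a" using superpose_solution(1)[OF x(1) _ x(2)] x(3) by simp
    have "lam = Sigma_thr p L 1" using packed_Sigma_le[OF _ u] lam by simp
    then have "sqrt lam * L = k * pi"
      using sqrt_mult_L_bounds(3)[of 1 lam] sqrt_mult_L_bounds(4)[of lam 1] by simp
    then have "2 * T_H p lam = L" using x(1) by (simp add: T_H(3) field_simps)
    moreover have "T_H p lam \<le> x 1" "x 1 \<le> L - T_H p lam" using x(2) by (auto simp: bump_simplex_def)
    ultimately have "x 1 = L / 2" "T_H p lam = L / 2" by simp_all
    then have e: "x 1 - T_H p lam = 0" "x 1 + T_H p lam = L" by simp_all
    have "bumps L u = {(window lam (x 1))}"
      unfolding x(3) using bumps_superpose[OF x(1) _ x(2)] by simp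
    then have "bumps L u = {{0<..<L}}" unfolding e .
    then show ?thesis using positive_solution_is_low(2)[OF sol] by simp
  qed
  moreover have "(lam, low lam) \<in> low_curve" using lam by (auto simp: low_curve_def)
  ultimately show ?thesis
    using branch_eq[of 1] by (auto simp: slice_def low_curve_def)
qed

lemma continuous_map_superpose:
  assumes l: "continuous_map X euclideanreal l" "\<And>q. q \<in> topspace X \<Longrightarrow> 0 < l q"
    and x: "\<And>i. i \<in> {1..j} \<Longrightarrow> continuous_map X euclideanreal (\<lambda>q. x q i)"
      "\<And>q. q \<in> topspace X \<Longrightarrow> x q \<in> bump_simplex p L j (l q)" and j: "1 \<le> j"
  shows "continuous_map X (C1_topology L) (\<lambda>q. superpose (l q) j (x q))"
proof (rule continuous_map_into_C1[OF L])
  note sol = superpose_solution[OF l(2) j x(2)]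
  show "superpose (l q) j (x q) \<in> C1_space L" if "q \<in> topspace X" for q
    using is_solutionD(4)[OF nonneg_solutionsD(1)[OF sol(1)]] that by blast
  let ?P = "prod_topology X (top_of_set {0..L})"
  let ?S = "{0<..} \<times> (UNIV :: real set)"
  have lp: "continuous_map ?P euclideanreal (\<lambda>z. l (fst z))"
    using continuous_map_compose[OF continuous_map_fst l(1), of "top_of_set {0..L}"] by (simp add: o_def)
  have yp: "continuous_map ?P euclideanreal (\<lambda>z. snd z - x (fst z) i)" if "i \<in> {1..j}" for i
  proof (rule continuous_map_diff)
    show "continuous_map ?P euclideanreal snd"
      using continuous_map_snd[of X "top_of_set {0..L}"] continuous_map_in_subtopology by blast
    show "continuous_map ?P euclideanreal (\<lambda>z. x (fst z) i)"
      using continuous_map_compose[OF continuous_map_fst x(1)[OF that], of "top_of_set {0..L}"] by (simp add: o_def)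
  qed
  have A: "continuous_on ?S (\<lambda>z. amplitude (fst z) 1)"
    unfolding amplitude_def using p a
    by (intro continuous_on_powr_const continuous_on_divide continuous_on_mult continuous_on_const
        continuous_on_fst continuous_on_id) auto
  have w: "continuous_on ?S (\<lambda>z. sqrt (fst z) / k)"
    using k_gt by (intro continuous_on_divide continuous_on_real_sqrt continuous_on_const continuous_on_fst continuous_on_id) auto
  have wy: "continuous_on ?S (\<lambda>z. sqrt (fst z) / k * snd z)"
    by (intro continuous_on_mult w continuous_on_snd continuous_on_id)
  have B: "continuous_on ?S (\<lambda>z. bump (fst z) (snd z))"
    unfolding bump_def
    by (intro continuous_on_mult A continuous_on_compose2[OF continuous_on_hump(1)[of UNIV] wy]) auto
  have B': "continuous_on ?S (\<lambda>z. bump' (fst z) (snd z))"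
    unfolding bump'_def
    by (intro continuous_on_mult A w continuous_on_compose2[OF continuous_on_hump(2)[of UNIV] wy]) auto
  have in_S: "(l (fst z), snd z - x (fst z) i) \<in> ?S" if "z \<in> topspace ?P" for z i
    using l(2) that by auto
  have "continuous_map ?P euclideanreal (\<lambda>z. \<Sum>i=1..j. bump (l (fst z)) (snd z - x (fst z) i))"
    using continuous_map_compose_real2[OF B lp yp in_S] by (intro continuous_map_sum) auto
  then show "continuous_map ?P euclideanreal (\<lambda>(q, t). superpose (l q) j (x q) t)"
    by (rule continuous_map_eq) (auto simp: superpose_def)
  have "continuous_map ?P euclideanreal (\<lambda>z. \<Sum>i=1..j. bump' (l (fst z)) (snd z - x (fst z) i))"
    using continuous_map_compose_real2[OF B' lp yp in_S] by (intro continuous_map_sum) auto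
  then show "continuous_map ?P euclideanreal (\<lambda>(q, t). D_on L (superpose (l q) j (x q)) t)"
    by (rule continuous_map_eq) (auto simp: sol(2))
qed

lemma continuous_map_low:
  "continuous_map (top_of_set low_range) (C1_topology L) low"
proof (rule continuous_map_into_C1[OF L])
  let ?I = "low_range"
  show "low q \<in> C1_space L" if "q \<in> topspace (top_of_set ?I)" for q
    using is_solutionD(4)[OF nonneg_solutionsD(1)[OF low_solution(1)]] that by simp
  have b: "continuous_on (?I \<times> {0..L}) (\<lambda>z. low_b (fst z))"
    by (rule continuous_on_compose2[OF continuous_on_low_b]) (auto intro!: continuous_intros)
  have r: "continuous_on (?I \<times> {0..L}) (\<lambda>z. sqrt (fst z))"
    by (intro continuous_on_real_sqrt continuous_on_fst continuous_on_id)
  have A: "continuous_on (?I \<times> {0..L}) (\<lambda>z. amplitude (fst z) (low_b (fst z)))"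
    unfolding amplitude_def using p a low_b(1,2)
    by (intro continuous_on_powr_const continuous_on_divide continuous_on_mult continuous_on_const
        continuous_on_fst continuous_on_id b) (auto intro!: divide_nonneg_nonneg mult_nonneg_nonneg simp: less_imp_le less_imp_neq[THEN not_sym])
  have pr: "continuous_on (?I \<times> {0..L}) (\<lambda>z. (low_b (fst z), sqrt (fst z) * snd z))"
    by (intro continuous_on_Pair b continuous_on_mult r continuous_on_snd continuous_on_id)
  have rng: "(\<lambda>z. (low_b (fst z), sqrt (fst z) * snd z)) ` (?I \<times> {0..L})
      \<subseteq> (phase_domain k)"
  proof (rule image_subsetI)
    fix z assume z: "z \<in> ?I \<times> {0..L}"
    then have x: "0 \<le> snd z" "snd z \<le> L" and "fst z \<in> ?I" by auto
    note l = low_b[OF \<open>fst z \<in> ?I\<close>]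
    have "sqrt (fst z) * snd z \<le> sqrt (fst z) * L" using x l(1) by (intro mult_left_mono) auto
    then show "(low_b (fst z), sqrt (fst z) * snd z) \<in> (phase_domain k)"
      using l x by simp
  qed
  have P: "continuous_on (?I \<times> {0..L}) (\<lambda>z. profile k (low_b (fst z)) (sqrt (fst z) * snd z))"
    "continuous_on (?I \<times> {0..L}) (\<lambda>z. profile' k (low_b (fst z)) (sqrt (fst z) * snd z))"
    using continuous_on_compose2[OF continuous_on_profile(1)[OF k_gt(2)] pr rng]
      continuous_on_compose2[OF continuous_on_profile(2)[OF k_gt(2)] pr rng]
    by (simp_all only: prod.case)
  have "continuous_on (?I \<times> {0..L}) (\<lambda>(q, x). low q x)"
    by (rule continuous_on_eq[OF continuous_on_mult[OF A P(1)]]) (auto simp: low_def)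
  then show "continuous_map (prod_topology (top_of_set ?I) (top_of_set {0..L})) euclideanreal (\<lambda>(q, x). low q x)"
    by simp
  have "continuous_on (?I \<times> {0..L}) (\<lambda>(q, x). D_on L (low q) x)"
    by (rule continuous_on_eq[OF continuous_on_mult[OF continuous_on_mult[OF A r] P(2)]])
       (auto simp: low_solution(2))
  then show "continuous_map (prod_topology (top_of_set ?I) (top_of_set {0..L})) euclideanreal (\<lambda>(q, x). D_on L (low q) x)"
    by simp
qed

section \<open>Connectedness of the branches\<close>

lemma continuous_map_into_sol_space:
  assumes "continuous_map X euclideanreal l" "continuous_map X (C1_topology L) u"
    "\<And>q. q \<in> topspace X \<Longrightarrow> (l q, u q) \<in> nonneg_solutions p L a"
  shows "continuous_map X sol_space (\<lambda>q. (l q, u q))"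
  unfolding nonneg_solution_space_def
  using assms by (intro continuous_map_into_subtopology continuous_map_pairedI) auto

lemma connectedin_low_curve: "connectedin sol_space low_curve"
proof -
  let ?I = "low_range"
  have "continuous_map (top_of_set ?I) sol_space (\<lambda>lam. (lam, low lam))"
    using low_solution(1) continuous_map_low
    by (intro continuous_map_into_sol_space) (auto intro!: continuous_intros)
  moreover have "connectedin (top_of_set ?I) ?I"
    by (simp add: connectedin_subtopology connected_Ioc)
  ultimately show ?thesis
    unfolding low_curve_def by (rule connectedin_continuous_map_image)
qed

text \<open>The inverse of \<open>T_H p\<close>.  The half-width is the natural parameter, because the inequalities that define
the simplex are linear in it.\<close>

definition lam_of_T :: "real \<Rightarrow> real" where
  "lam_of_T T = (pi / ((1 - p) * T))\<^sup>2"

lemma lam_of_T: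
  assumes "0 < T" shows "0 < lam_of_T T" "T_H p (lam_of_T T) = T" 
  using assms p by (simp_all add: lam_of_T_def T_H_def real_sqrt_divide)

lemma lam_of_T_T_H:
  assumes "0 < lam" shows "lam_of_T (T_H p lam) = lam"
  using assms p by (simp add: lam_of_T_def T_H_def power_divide)

lemma simplex_convex:
  assumes x: "x \<in> bump_simplex p L j lam" and y: "y \<in> bump_simplex p L j mu"
    and j: "1 \<le> j" and lam: "0 < lam" "0 < mu" and s: "0 \<le> s" "s \<le> 1"
  shows "(\<lambda>i\<in>{1..j}. (1 - s) * x i + s * y i)
     \<in> bump_simplex p L j (lam_of_T ((1 - s) * T_H p lam + s * T_H p mu))"
proof -
  define T where "T = (1 - s) * T_H p lam + s * T_H p mu"
  have "0 < T" unfolding T_def using T_H(1)[OF lam(1)] T_H(1)[OF lam(2)] s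
    by (cases "s = 0") (auto intro!: add_nonneg_pos)
  note T = lam_of_T(2)[OF this]
  have comb: "(1 - s) * c + s * d \<le> (1 - s) * c' + s * d'" if "c \<le> c'" "d \<le> d'" for c d c' d'
    using that s by (intro add_mono mult_left_mono) auto
  show ?thesis
    unfolding T_def[symmetric] bump_simplex_def T
  proof (intro CollectI conjI ballI)
    show "T \<le> (\<lambda>i\<in>{1..j}. (1 - s) * x i + s * y i) 1"
      using comb[of "T_H p lam" "x 1" "T_H p mu" "y 1"] x y j by (auto simp: T_def bump_simplex_def)
    show "(\<lambda>i\<in>{1..j}. (1 - s) * x i + s * y i) j \<le> L - T"
      using comb[of "x j" "L - T_H p lam" "y j" "L - T_H p mu"] x y j
      by (auto simp: T_def bump_simplex_def algebra_simps)
    show "2 * T \<le> (\<lambda>i\<in>{1..j}. (1 - s) * x i + s * y i) i - (\<lambda>i\<in>{1..j}. (1 - s) * x i + s * y i) (i - 1)"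
      if i: "i \<in> {2..j}" for i
    proof -
      have "i \<in> {1..j}" "i - 1 \<in> {1..j}" using i by auto
      moreover have "2 * T_H p lam \<le> x i - x (i - 1)" "2 * T_H p mu \<le> y i - y (i - 1)"
        using x y i unfolding bump_simplex_def by blast+
      ultimately show ?thesis
        using comb[of "2 * T_H p lam" "x i - x (i - 1)" "2 * T_H p mu" "y i - y (i - 1)"]
        by (simp add: T_def algebra_simps)
    qed
  qed simp
qed

text \<open>The segment from the parameters of a given solution to those of a solution with \<open>\<lambda> = \<Sigma>\<^sub>j\<close> stays in the
convex parameter set, and the map from parameters to solutions is continuous.\<close>

lemma connectedin_packed:
  assumes j: "1 \<le> j"
  shows "connectedin sol_space (packed j)"
proof -
  obtain y where y: "y \<in> bump_simplex p L j (Sigma_thr p L j)"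
    using packed_at_threshold[OF j order_refl] by blast
  define mu where "mu = Sigma_thr p L j"
  have mu: "0 < mu" using thr_mono(3)[OF j] by (simp add: mu_def)
  show ?thesis
  proof (rule connectedin_by_common_point[where b="(mu, superpose mu j y)"])
    fix z assume "z \<in> packed j"
    then obtain lam x where z: "z = (lam, superpose lam j x)" "0 < lam" "x \<in> bump_simplex p L j lam"
      by (auto simp: packed_def)
    define T where "T s = (1 - s) * T_H p lam + s * T_H p mu" for s
    define X where "X s = (\<lambda>i\<in>{1..j}. (1 - s) * x i + s * y i)" for s
    define h where "h s = (lam_of_T (T s), superpose (lam_of_T (T s)) j (X s))" for s
    have T: "0 < T s" if "s \<in> {0..1}" for s
      unfolding T_def using T_H(1)[OF z(2)] T_H(1)[OF mu] that
      by (cases "s = 0") (auto intro!: add_nonneg_pos)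
    have X: "X s \<in> bump_simplex p L j (lam_of_T (T s))" if "s \<in> {0..1}" for s
      unfolding X_def T_def using that y by (intro simplex_convex[OF z(3) _ j z(2) mu]) (auto simp: mu_def)
    have cT: "continuous_on {0..1} T" unfolding T_def by (intro continuous_intros)
    have nz: "(1 - p) * T s \<noteq> 0" if "s \<in> {0..1}" for s using T[OF that] p by simp
    have cl: "continuous_map (top_of_set {0..1}) euclideanreal (\<lambda>s. lam_of_T (T s))"
      unfolding continuous_map_iff_continuous lam_of_T_def using nz
      by (intro continuous_on_power continuous_on_divide continuous_on_mult continuous_on_const cT) blast
    have "continuous_map (top_of_set {0..1}) sol_space h"
      unfolding h_def
    proof (rule continuous_map_into_sol_space[OF cl continuous_map_superpose[OF cl _ _ _ j]])
      show "continuous_map (top_of_set {0..1}) euclideanreal (\<lambda>s. X s i)" if "i \<in> {1..j}" for i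
      proof -
        have "continuous_on {0..1} (\<lambda>s. (1 - s) * x i + s * y i)" by (intro continuous_intros)
        then show ?thesis using that by (simp add: X_def)
      qed
      show "(lam_of_T (T s), superpose (lam_of_T (T s)) j (X s)) \<in> nonneg_solutions p L a"
        if "s \<in> topspace (top_of_set {0..1})" for s
        using superpose_solution(1)[OF lam_of_T(1)[OF T] j X] that by simp
    qed (use lam_of_T(1)[OF T] X in auto)
    moreover have "connectedin (top_of_set {0..1}) {0..1::real}"
      by (simp add: connectedin_subtopology)
    ultimately have con: "connectedin sol_space (h ` {0..1})"
      by (rule connectedin_continuous_map_image)
    have ext: "x \<in> extensional {1..j}" "y \<in> extensional {1..j}" using z(3) y by (auto simp: bump_simplex_def)
    have "X 0 = x" "X 1 = y"
      unfolding X_def using ext by (auto simp: extensional_def fun_eq_iff)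
    then have h01: "h 0 = z" "h 1 = (mu, superpose mu j y)"
      using lam_of_T_T_H[OF z(2)] lam_of_T_T_H[OF mu] by (simp_all add: h_def T_def z(1))
    have "h 0 \<in> h ` {0..1}" "h 1 \<in> h ` {0..1}" by (intro imageI; simp)+
    then have "z \<in> h ` {0..1}" "(mu, superpose mu j y) \<in> h ` {0..1}" unfolding h01 .
    moreover have "h ` {0..1} \<subseteq> packed j"
    proof (rule image_subsetI)
      show "h s \<in> packed j" if s: "s \<in> {0..1}" for s
        unfolding h_def packed_def using lam_of_T(1)[OF T[OF s]] X[OF s] by blast
    qed
    ultimately show "\<exists>C. connectedin sol_space C \<and> (mu, superpose mu j y) \<in> C \<and> z \<in> C \<and> C \<subseteq> packed j"
      using con by blast
  qed
qed

lemma connectedin_branch: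
  assumes j: "1 \<le> j"
  shows "connectedin sol_space (branch j)"
proof (cases "j = 1")
  case True
  obtain x where x: "(Sigma_thr p L 1, superpose (Sigma_thr p L 1) 1 x) \<in> packed 1"
    using packed_at_threshold[of 1 "Sigma_thr p L 1"] by auto
  have in_low: "Sigma_thr p L 1 \<in> low_range" using thr_mono(1) by simp
  have "superpose (Sigma_thr p L 1) 1 x \<in> slice (branch 1) (Sigma_thr p L 1)"
    using x branch_eq[of 1] by (simp add: slice_def)
  then have "(Sigma_thr p L 1, superpose (Sigma_thr p L 1) 1 x) \<in> low_curve"
    using slice_low[OF in_low] in_low by (auto simp: low_curve_def)
  then have "low_curve \<inter> packed 1 \<noteq> {}" using x by blast
  then show ?thesis
    using connectedin_Un[OF connectedin_low_curve connectedin_packed[of 1]] True branch_eq[of 1] by simp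
next
  case False
  then show ?thesis using branch_eq[OF j] connectedin_packed[OF j] by simp
qed

section \<open>Openness of the branches\<close>

text \<open>The integral of one bump, in a form that shows its continuity in \<open>\<lambda>\<close>; see \<open>integral_superpose\<close>.\<close>

definition mass :: "real \<Rightarrow> real" where
  "mass lam = amplitude lam 1 * (integral {-pi/2..pi/2} hump / (sqrt lam / k))"

lemma mass_pos:
  assumes "0 < lam" shows "0 < mass lam"
proof -
  have "integral {-pi/2..pi/2} (\<lambda>_. 0) < integral {-pi/2..pi/2} hump"
  proof (rule integral_less_real)
    show "0 < hump x" if "x \<in> {-pi/2<..<pi/2}" for x
    proof -
      have "\<bar>x\<bar> < pi / 2" using that by (cases "0 \<le> x") auto
      then have "0 < clamped_cos x" by (rule clamped_cos_bounds(2))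
      then show ?thesis by (simp add: hump_def)
    qed
  qed (use continuous_on_hump in \<open>auto simp: not_le\<close>)
  then show ?thesis using assms k_gt amplitude(1)[OF assms, of 1] by (simp add: mass_def)
qed

lemma integral_superpose:
  assumes lam: "0 < lam" and j: "1 \<le> j" and x: "x \<in> bump_simplex p L j lam"
  shows "integral {0..L} (superpose lam j x) = real j * mass lam"
proof -
  define w where "w = sqrt lam / k"
  have w: "0 < w" using lam k_gt by (simp add: w_def)
  have one: "((\<lambda>t. bump lam (t - x i)) has_integral mass lam) {0..L}" if i: "i \<in> {1..j}" for i
  proof -
    have "(hump has_integral integral {-pi/2..pi/2} hump) (cbox (-pi/2) (pi/2))"
      using integrable_continuous_real[OF continuous_on_hump(1)] by (simp add: integrable_integral)
    from has_integral_affinity'[OF this w, of "- w * x i"]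
    have 1: "((\<lambda>t. hump (w * (t - x i))) has_integral (integral {-pi/2..pi/2} hump /\<^sub>R w))
       (cbox ((- pi/2 - - w * x i) /\<^sub>R w) ((pi/2 - - w * x i) /\<^sub>R w))"
      by (simp add: right_diff_distrib)
    have 2: "(- pi/2 - - w * x i) /\<^sub>R w = x i - T_H p lam" "(pi/2 - - w * x i) /\<^sub>R w = x i + T_H p lam"
    proof -
      have "- pi/2 - - w * x i = w * (x i - T_H p lam)" "pi/2 - - w * x i = w * (x i + T_H p lam)"
        using T_H(2)[OF lam] unfolding w_def[symmetric] by (simp_all add: right_diff_distrib distrib_left)
      then show "(- pi/2 - - w * x i) /\<^sub>R w = x i - T_H p lam" "(pi/2 - - w * x i) /\<^sub>R w = x i + T_H p lam"
        using w by simp_all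
    qed
    have 3: "integral {-pi/2..pi/2} hump /\<^sub>R w = integral {-pi/2..pi/2} hump / w"
      unfolding real_scaleR_def divide_inverse by (rule mult.commute)
    have "((\<lambda>t. hump (w * (t - x i))) has_integral integral {-pi/2..pi/2} hump / w)
       {x i - T_H p lam..x i + T_H p lam}"
      using 1 unfolding 2 3 box_real .
    then have "((\<lambda>t. amplitude lam 1 * hump (w * (t - x i))) has_integral
        amplitude lam 1 * (integral {-pi/2..pi/2} hump / w)) {x i - T_H p lam..x i + T_H p lam}"
      by (rule has_integral_mult_right)
    then have *: "((\<lambda>t. bump lam (t - x i)) has_integral mass lam) {x i - T_H p lam..x i + T_H p lam}"
      by (simp only: bump_def mass_def w_def)
    show ?thesis
    proof (rule has_integral_on_superset[OF *])
      show "bump lam (t - x i) = 0" if "t \<notin> {x i - T_H p lam..x i + T_H p lam}" for t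
        by (rule bump_values(2)[OF lam]) (use that in \<open>auto simp: abs_if\<close>)
      show "{x i - T_H p lam..x i + T_H p lam} \<subseteq> {0..L}" using simplex_range[OF lam x i] by auto
    qed
  qed
  have "((\<lambda>t. \<Sum>i=1..j. bump lam (t - x i)) has_integral (\<Sum>i=1..j. mass lam)) {0..L}"
    using one by (intro has_integral_sum) auto
  then have "(superpose lam j x has_integral real j * mass lam) {0..L}"
    by (rule has_integral_eq[rotated, THEN has_integral_eq_rhs]) (auto simp: superpose_def)
  then show ?thesis by (rule integral_unique)
qed

lemma continuous_map_integral:
  "continuous_map (C1_topology L) euclideanreal (\<lambda>u. integral {0..L} u)"
proof -
  have "continuous_map (Metric_space.mtopology (C1_space L) (C1_dist L)) Met_TC.mtopology (\<lambda>u. integral {0..L} u)"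
    unfolding Metric_space.metric_continuous_map[OF Metric_space_C1 Met_TC.Metric_space_axioms]
  proof (intro conjI ballI allI impI)
    fix u and e :: real assume u: "u \<in> C1_space L" and e: "0 < e"
    show "\<exists>d>0. \<forall>v. v \<in> C1_space L \<and> C1_dist L u v < d \<longrightarrow> dist (integral {0..L} u) (integral {0..L} v) < e"
    proof (intro exI[of _ "e / L"] conjI allI impI)
      show "0 < e / L" using e L by simp
      fix v assume v: "v \<in> C1_space L \<and> C1_dist L u v < e / L"
      have int: "w integrable_on {0..L}" if "w \<in> C1_space L" for w
        using C1_spaceD(1)[OF that] unfolding mspace_C0_iff by (intro integrable_continuous_real) simp
      have "norm (integral {0..L} (\<lambda>x. u x - v x)) \<le> integral {0..L} (\<lambda>_. C1_dist L u v)"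
        using abs_diff_le_C1_dist[of u L v] u v int by (intro integral_norm_bound_integral integrable_diff) auto
      also have "\<dots> = L * C1_dist L u v" using L by simp
      also have "\<dots> < e" using v L by (simp add: field_simps)
      finally show "dist (integral {0..L} u) (integral {0..L} v) < e"
        using u v int by (simp add: dist_real_def integral_diff)
    qed
  qed simp
  then show ?thesis by (simp add: mtopology_of_def mspace_C1_metric mdist_C1_metric)
qed

definition high :: "(real \<times> (real \<Rightarrow> real)) set" where
  "high = {z \<in> topspace sol_space. fst z \<in> {Sigma_thr p L 1<..}}"

definition bump_count :: "real \<times> (real \<Rightarrow> real) \<Rightarrow> real" where
  "bump_count z = integral {0..L} (snd z) / mass (fst z)"

lemma continuous_map_fst_sol: "continuous_map sol_space euclideanreal fst"
  and continuous_map_snd_sol: "continuous_map sol_space (C1_topology L) snd"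
  unfolding nonneg_solution_space_def
  by (intro continuous_map_from_subtopology continuous_map_fst continuous_map_snd)+

lemma openin_high: "openin sol_space high"
  unfolding high_def by (rule openin_continuous_map_preimage[OF continuous_map_fst_sol]) simp

lemma solutions_eq_branches: "z \<in> nonneg_solutions p L a \<longleftrightarrow> (\<exists>j\<ge>1. z \<in> branch j)"
proof
  assume "z \<in> nonneg_solutions p L a"
  then obtain lam u where z: "z = (lam, u)" and sol: "(lam, u) \<in> nonneg_solutions p L a" by (cases z) auto
  show "\<exists>j\<ge>1. z \<in> branch j"
  proof (cases "D_on L u 0 = 0")
    case True
    then obtain i x where x: "1 \<le> i" "x \<in> bump_simplex p L i lam" "u = superpose lam i x"
      using flat_solution_is_superposition[OF sol] by blast
    have lam: "0 < lam" using bump_maximum(3)[OF sol] bumps_nonempty[OF sol] by blast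
    have "z \<in> packed i" using x lam z by (auto simp: packed_def)
    then have "z \<in> branch i" using branch_eq[OF x(1)] by (simp split: if_splits)
    then show ?thesis using x(1) by blast
  next
    case False
    have "z \<in> low_curve"
      using positive_solution_is_low[OF sol single_bump_if_nonzero_slope[OF sol False]] z
      by (auto simp: low_curve_def)
    then have "z \<in> branch 1" using branch_eq[of 1] by simp
    then show ?thesis by blast
  qed
qed (auto simp: branch_def)

lemma high_imp_packed:
  assumes "z \<in> high" obtains j where "1 \<le> j" "z \<in> packed j"
proof -
  obtain j where j: "1 \<le> j" "z \<in> branch j"
    using assms solutions_eq_branches[of z] by (auto simp: high_def topspace_sol_space)
  moreover have "z \<notin> low_curve" using assms by (auto simp: low_curve_def high_def)
  ultimately have "z \<in> packed j" using branch_eq[OF j(1)] by (simp split: if_splits)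
  then show ?thesis using that j(1) by blast
qed

lemma bump_count_packed: "1 \<le> j \<Longrightarrow> z \<in> packed j \<Longrightarrow> bump_count z = real j"
  using integral_superpose mass_pos by (force simp: packed_def bump_count_def)

text \<open>Above \<open>\<Sigma>\<^sub>1\<close> all solutions have zero energy, so the continuous function \<open>bump_count\<close> takes integer values
there and its level sets are open.\<close>

lemma openin_high_branch:
  assumes "1 \<le> j" shows "openin sol_space (high \<inter> packed j)"
proof -
  have f: "continuous_map (subtopology sol_space high) euclideanreal fst"
    and s: "continuous_map (subtopology sol_space high) (C1_topology L) snd"
    by (intro continuous_map_from_subtopology continuous_map_fst_sol continuous_map_snd_sol)+
  have pos: "0 < fst z" if "z \<in> high" for z
    using that thr_mono(3)[of 1] by (auto simp: high_def)
  have m: "continuous_on {0<..} mass"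
    unfolding mass_def amplitude_def using p a k_gt
    by (intro continuous_on_mult continuous_on_powr_const continuous_on_divide continuous_on_real_sqrt
        continuous_on_const continuous_on_id) auto
  have "continuous_map (subtopology sol_space high) (top_of_set {0<..}) fst"
    using pos f by (intro continuous_map_into_subtopology) auto
  from continuous_map_compose[OF this, of euclideanreal mass] m
  have "continuous_map (subtopology sol_space high) euclideanreal (\<lambda>z. mass (fst z))" by (simp add: o_def)
  moreover have "continuous_map (subtopology sol_space high) euclideanreal (\<lambda>z. integral {0..L} (snd z))"
    using continuous_map_compose[OF s continuous_map_integral] by (simp add: o_def)
  moreover have "mass (fst z) \<noteq> 0" if "z \<in> topspace (subtopology sol_space high)" for z
    using mass_pos[OF pos[of z]] that by simp
  ultimately have c: "continuous_map (subtopology sol_space high) euclideanreal bump_count"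
    unfolding bump_count_def[abs_def] by (intro continuous_map_real_divide) auto
  have "openin (subtopology sol_space high)
      {z \<in> topspace (subtopology sol_space high). bump_count z \<in> {real j - 1/2<..<real j + 1/2}}"
    by (rule openin_continuous_map_preimage[OF c]) simp
  moreover have "{z \<in> topspace (subtopology sol_space high). bump_count z \<in> {real j - 1/2<..<real j + 1/2}}
      = high \<inter> packed j"
  proof -
    have "z \<in> packed j \<longleftrightarrow> bump_count z \<in> {real j - 1/2<..<real j + 1/2}" if z: "z \<in> high" for z
    proof
      assume b: "bump_count z \<in> {real j - 1/2<..<real j + 1/2}"
      obtain i where i: "1 \<le> i" "z \<in> packed i" using high_imp_packed[OF z] .
      then have "real i - real j < 1" "real j - real i < 1" using bump_count_packed[OF i] b by auto
      then have "i = j" by linarith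
      then show "z \<in> packed j" using i by simp
    qed (use bump_count_packed[OF assms] in auto)
    moreover have "high \<subseteq> topspace sol_space" by (auto simp: high_def)
    ultimately show ?thesis by auto
  qed
  ultimately show ?thesis using openin_trans_full[OF _ openin_high] by simp
qed

text \<open>For \<open>j = 1\<close> the set \<open>\<lambda> < \<Sigma>\<^sub>2\<close> is used in addition, since \<open>bump_count\<close> is not an integer on the curve below \<open>\<Sigma>\<^sub>1\<close>; in that
set no solution has more than one bump.\<close>

lemma openin_branch:
  assumes j: "1 \<le> j" shows "openin sol_space (branch j)"
proof (cases "j = 1")
  case False
  have "packed j \<subseteq> high"
  proof
    fix z assume z: "z \<in> packed j"
    have "Sigma_thr p L 1 < fst z"
      using packed_Sigma_le[OF j, of "fst z" "snd z"] z thr_mono(2)[of 1 j] j False by simp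
    moreover have "z \<in> branch j" using z branch_eq[OF j] by (simp split: if_splits)
    ultimately show "z \<in> high" by (auto simp: high_def topspace_sol_space branch_def)
  qed
  then show ?thesis using openin_high_branch[OF j] branch_eq[OF j] False by (simp add: Int_absorb1)
next
  case True
  let ?W = "{z \<in> topspace sol_space. fst z \<in> {..<Sigma_thr p L 2}}"
  have "branch 1 = ?W \<union> (high \<inter> packed 1)"
  proof (intro equalityI subsetI)
    fix z assume z: "z \<in> branch 1"
    then have top: "z \<in> topspace sol_space" by (auto simp: branch_def topspace_sol_space)
    have "z \<in> packed 1" if "\<not> fst z < Sigma_thr p L 2"
    proof -
      have "z \<notin> low_curve" using that thr_mono(2)[of 1 2] by (auto simp: low_curve_def)
      then show ?thesis using z branch_eq[of 1] by simp
    qed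
    then show "z \<in> ?W \<union> (high \<inter> packed 1)"
      using top thr_mono(2)[of 1 2] by (auto simp: high_def)
  next
    fix z assume z: "z \<in> ?W \<union> (high \<inter> packed 1)"
    show "z \<in> branch 1"
    proof (cases "z \<in> packed 1")
      case True
      then show ?thesis using branch_eq[of 1] by simp
    next
      case False
      then have z: "z \<in> nonneg_solutions p L a" "fst z < Sigma_thr p L 2"
        using z by (auto simp: topspace_sol_space)
      then obtain j where j: "1 \<le> j" "z \<in> branch j" using solutions_eq_branches by blast
      have "j = 1"
      proof (rule ccontr)
        assume "j \<noteq> 1"
        then have "z \<in> packed j" using branch_eq[OF j(1)] j(2) by simp
        then have "Sigma_thr p L j \<le> fst z" using packed_Sigma_le[OF j(1), of "fst z" "snd z"] by simp
        moreover have "Sigma_thr p L 2 \<le> Sigma_thr p L j"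
          using thr_mono(2)[of 2 j] j(1) \<open>j \<noteq> 1\<close> by (cases "j = 2") auto
        ultimately show False using z(2) by linarith
      qed
      then show ?thesis using j by simp
    qed
  qed
  moreover have "openin sol_space ?W"
    by (rule openin_continuous_map_preimage[OF continuous_map_fst_sol]) simp
  ultimately show ?thesis using openin_high_branch[of 1] True by (simp add: openin_Un)
qed

section \<open>Slices as simplices\<close>

lemma compactin_simplex:
  assumes lam: "0 < lam" and j: "1 \<le> j"
  shows "compactin (powertop_real {1..j}) (bump_simplex p L j lam)"
proof -
  let ?X = "powertop_real {1..j}"
  have top: "topspace ?X = extensional {1..j}" by (simp add: PiE_UNIV_domain extensional_def PiE_def)
  have proj: "continuous_map ?X euclideanreal (\<lambda>x. x i)" if "i \<in> {1..j}" for i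
    using continuous_map_product_projection[OF that, of "\<lambda>_. euclideanreal"] by simp
  define K where "K = insert {x \<in> topspace ?X. x 1 \<in> {T_H p lam..}} (insert {x \<in> topspace ?X. x j \<in> {..L - T_H p lam}}
     ((\<lambda>i. {x \<in> topspace ?X. x i - x (i - 1) \<in> {2 * T_H p lam..}}) ` {2..j}))"
  have "closedin ?X C" if C: "C \<in> K" for C
  proof -
    have "closedin ?X {x \<in> topspace ?X. x 1 \<in> {T_H p lam..}}"
      using j by (intro closedin_continuous_map_preimage[OF proj]) auto
    moreover have "closedin ?X {x \<in> topspace ?X. x j \<in> {..L - T_H p lam}}"
      using j by (intro closedin_continuous_map_preimage[OF proj]) auto
    moreover have "closedin ?X {x \<in> topspace ?X. x i - x (i - 1) \<in> {2 * T_H p lam..}}" if "i \<in> {2..j}" for i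
      using that by (intro closedin_continuous_map_preimage[OF continuous_map_diff[OF proj proj]]) auto
    ultimately show ?thesis using C unfolding K_def by blast
  qed
  then have "closedin ?X (\<Inter>K)" by (intro closedin_Inter) (auto simp: K_def)
  moreover have "\<Inter>K = bump_simplex p L j lam"
    unfolding K_def bump_simplex_def top by auto
  ultimately have cl: "closedin ?X (bump_simplex p L j lam)" by simp
  have "compactin ?X (PiE {1..j} (\<lambda>_. {0..L}))"
    by (simp add: compactin_PiE)
  then show ?thesis
  proof (rule closed_compactin[OF _ _ cl])
    show "bump_simplex p L j lam \<subseteq> PiE {1..j} (\<lambda>_. {0..L})"
    proof
      fix x assume x: "x \<in> bump_simplex p L j lam"
      have "x i \<in> {0..L}" if "i \<in> {1..j}" for i
        using simplex_range[OF lam x that] T_H(1)[OF lam] by simp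
      moreover have "x \<in> extensional {1..j}" using x by (simp add: bump_simplex_def)
      ultimately show "x \<in> PiE {1..j} (\<lambda>_. {0..L})" by (simp add: PiE_def)
    qed
  qed
qed

lemma slice_packed:
  assumes lam: "0 < lam"
  shows "slice (packed j) lam = superpose lam j ` bump_simplex p L j lam"
  using lam by (auto simp: slice_def packed_def)

lemma slice_branch:
  assumes j: "1 \<le> j" and lam: "Sigma_thr p L j < lam"
  shows "slice (branch j) lam = superpose lam j ` bump_simplex p L j lam"
proof -
  have "0 < lam" using thr_mono(3)[OF j] lam by linarith
  moreover have "slice (branch j) lam = slice (packed j) lam"
    using lam branch_eq[OF j] by (cases "j = 1") (auto simp: slice_def low_curve_def)
  ultimately show ?thesis using slice_packed by simp
qed

text \<open>Continuity of the bump points as functions of the solution comes from compactness of the simplex.\<close>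

lemma homeomorphic_map_bump_vector:
  assumes j: "1 \<le> j" and lam: "Sigma_thr p L j < lam"
  shows "homeomorphic_map (subtopology (C1_topology L) (slice (branch j) lam))
     (subtopology (powertop_real {1..j}) (bump_simplex p L j lam)) (bump_vector L j)"
proof -
  let ?S = "bump_simplex p L j lam"
  let ?X = "subtopology (powertop_real {1..j}) ?S"
  let ?Y = "subtopology (C1_topology L) (slice (branch j) lam)"
  have lam0: "0 < lam" using thr_mono(3)[OF j] lam by linarith
  note sl = slice_branch[OF j lam]
  have top: "topspace (powertop_real {1..j}) = extensional {1..j}" by (simp add: PiE_UNIV_domain extensional_def PiE_def)
  have sub: "?S \<subseteq> extensional {1..j}" by (auto simp: bump_simplex_def)
  then have topX: "topspace ?X = ?S" using top by auto
  have "superpose lam j x \<in> C1_space L" if "x \<in> ?S" for x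
    using is_solutionD(4)[OF nonneg_solutionsD(1)[OF superpose_solution(1)[OF lam0 j that]]] .
  then have topY: "topspace ?Y = superpose lam j ` ?S"
    unfolding sl by (auto simp: mspace_C1_metric)
  have c: "continuous_map ?X (C1_topology L) (superpose lam j)"
  proof (rule continuous_map_superpose[OF _ _ _ _ j, of ?X "\<lambda>_. lam" "\<lambda>x. x"])
    show "continuous_map ?X euclideanreal (\<lambda>q. q i)" if "i \<in> {1..j}" for i
      using continuous_map_product_projection[OF that, of "\<lambda>_. euclideanreal"]
      by (intro continuous_map_from_subtopology) simp
  qed (use lam0 topX in auto)
  have "homeomorphic_map ?X ?Y (superpose lam j)"
  proof (rule continuous_imp_homeomorphic_map)
    show "continuous_map ?X ?Y (superpose lam j)"
      using c topX unfolding sl by (intro continuous_map_into_subtopology) auto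
    show "compact_space ?X"
      using compactin_simplex[OF lam0 j] by (simp add: compactin_subspace)
    show "Hausdorff_space ?Y"
      by (rule Hausdorff_space_subtopology)
         (simp add: mtopology_of_def mspace_C1_metric mdist_C1_metric Metric_space.Hausdorff_space_mtopology[OF Metric_space_C1])
    show "superpose lam j ` topspace ?X = topspace ?Y" unfolding topX topY ..
    show "inj_on (superpose lam j) (topspace ?X)"
      unfolding topX by (rule inj_on_inverseI[of _ "bump_vector L j"]) (rule bump_vector_superpose[OF lam0 j])
  qed
  then obtain g where g: "homeomorphic_maps ?X ?Y (superpose lam j) g"
    using homeomorphic_map_maps by blast
  then have "homeomorphic_map ?Y ?X g" using homeomorphic_maps_map by blast
  then show ?thesis
  proof (rule homeomorphic_map_eq)
    fix u assume "u \<in> topspace ?Y"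
    then obtain x where x: "x \<in> ?S" "u = superpose lam j x" unfolding topY by blast
    then have "g u = x" using g topX by (simp add: homeomorphic_maps_def)
    then show "g u = bump_vector L j u" using bump_vector_superpose[OF lam0 j x(1)] x(2) by simp
  qed
qed

lemma T_H_antimono:
  assumes "0 < lam" "lam < mu" shows "T_H p mu < T_H p lam"
proof -
  have "sqrt lam * (1 - p) < sqrt mu * (1 - p)" using assms p by simp
  then show ?thesis unfolding T_H_def using assms p by (intro divide_strict_left_mono) auto
qed

text \<open>The packing of the bumps as far to the left as possible for \<open>\<mu>\<close> begins too close to \<open>0\<close> for \<open>\<lambda> < \<mu>\<close>.\<close>

lemma simplex_strict_mono:
  assumes j: "1 \<le> j" and lam: "Sigma_thr p L j < lam" and mu: "lam < mu"
  shows "bump_simplex p L j lam \<subset> bump_simplex p L j mu"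
proof -
  have lam0: "0 < lam" using thr_mono(3)[OF j] lam by linarith
  have T: "T_H p mu < T_H p lam" using T_H_antimono[OF lam0 mu] .
  have "bump_simplex p L j lam \<subseteq> bump_simplex p L j mu"
    using T unfolding bump_simplex_def by force
  moreover have "(\<lambda>i\<in>{1..j}. T_H p mu * (2 * real i - 1)) \<in> bump_simplex p L j mu"
    using leftmost_packing[OF _ j] lam0 mu lam by simp
  moreover have "(\<lambda>i\<in>{1..j}. T_H p mu * (2 * real i - 1)) \<notin> bump_simplex p L j lam"
    using T j by (auto simp: bump_simplex_def)
  ultimately show ?thesis by blast
qed

section \<open>Blow-up of the curve and conclusion\<close>

lemma sup_norm_low_ge:
  assumes lam: "lam \<in> low_range"
  shows "amplitude lam (low_b lam) \<le> sup_norm L (low lam)"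
proof -
  note b = low_b[OF lam]
  define t where "t = quad k (low_b lam) (pi/2) / sqrt lam"
  have "0 < quad k (low_b lam) (pi/2)" "quad k (low_b lam) (pi/2) < quad k (low_b lam) pi"
    using quad_strict_mono[OF k_gt(2) less_imp_le[OF b(2)] b(3), of 0 "pi/2"]
      quad_strict_mono[OF k_gt(2) less_imp_le[OF b(2)] b(3), of "pi/2" pi] by auto
  then have t: "t \<in> {0..L}" "sqrt lam * t = quad k (low_b lam) (pi/2)"
    using b by (auto simp: t_def field_simps)
  have "low lam t = amplitude lam (low_b lam)"
    using t profile_ends(3)[OF k_gt(2) less_imp_le[OF b(2)] b(3)] by (simp add: low_def)
  moreover have "\<bar>low lam t\<bar> \<le> sup_norm L (low lam)"
    unfolding sup_norm_def
  proof (rule cSUP_upper[OF t(1)])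
    have "continuous_on {0..L} (\<lambda>x. \<bar>low lam x\<bar>)"
      using solution_continuous[OF low_solution(1)[OF lam]] by (rule continuous_on_rabs)
    then show "bdd_above ((\<lambda>x. \<bar>low lam x\<bar>) ` {0..L})"
      by (intro bounded_imp_bdd_above compact_imp_bounded compact_continuous_image compact_Icc)
  qed
  ultimately show ?thesis by simp
qed

lemma sup_norm_low_at_top: "filterlim (\<lambda>lam. sup_norm L (low lam)) at_top (at_right (sigma_thr L 1))"
proof -
  let ?F = "at_right (sigma_thr L 1)"
  have ev: "\<forall>\<^sub>F lam in ?F. lam \<in> low_range"
    unfolding eventually_at_right_field
    by (rule exI[of _ "Sigma_thr p L 1"]) (use thr_mono(1) in auto)
  have "sqrt (sigma_thr L 1) * L = pi" unfolding sigma_eq using L by simp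
  then have "low_b (sigma_thr L 1) = 0"
    using low_b_unique[of 0 "sigma_thr L 1"] quad_zero[OF k_gt(2)] by simp
  then have b: "(low_b \<longlongrightarrow> 0) ?F"
    using continuous_on_Icc_at_rightD[OF continuous_on_low_b thr_mono(1)] by simp
  have "((\<lambda>lam. (p + 1) * lam * low_b lam) \<longlongrightarrow> (p + 1) * sigma_thr L 1 * 0) ?F"
    by (intro tendsto_mult tendsto_const b tendsto_ident_at)
  moreover have "\<forall>\<^sub>F lam in ?F. 0 < (p + 1) * lam * low_b lam"
    using ev by eventually_elim (use low_b(1,2) p in simp)
  ultimately have "filterlim (\<lambda>lam. inverse ((p + 1) * lam * low_b lam)) at_top ?F"
    by (intro filterlim_inverse_at_top) simp_all
  then have "filterlim (\<lambda>lam. 2 * a * inverse ((p + 1) * lam * low_b lam)) at_top ?F"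
    using a by (intro filterlim_tendsto_pos_mult_at_top[OF tendsto_const]) simp_all
  then have "filterlim (\<lambda>lam. (2 * a * inverse ((p + 1) * lam * low_b lam)) powr (1 / (1 - p))) at_top ?F"
    using p by (intro powr_at_top) simp_all
  then have "filterlim (\<lambda>lam. amplitude lam (low_b lam)) at_top ?F"
    unfolding amplitude_def divide_inverse[of "2 * a"] .
  then show ?thesis
    by (rule filterlim_at_top_mono) (use ev sup_norm_low_ge in \<open>auto elim: eventually_mono\<close>)
qed

lemma branch_nonempty: "1 \<le> j \<Longrightarrow> branch j \<noteq> {}"
  using packed_at_threshold[of j "Sigma_thr p L j"] branch_eq[of j] by (auto split: if_splits)

lemma components_eq_branches: "connected_components_of sol_space = branch ` {1..}"
proof (rule connected_components_of_open_partition)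
  show "\<Union> (branch ` {1..}) = topspace sol_space"
    using solutions_eq_branches unfolding topspace_sol_space by blast
  show "pairwise disjnt (branch ` {1..})"
    by (auto simp: pairwise_def disjnt_def branch_def)
  show "{} \<notin> branch ` {1..}" using branch_nonempty by auto
qed (use connectedin_branch openin_branch in auto)

lemma fst_packed: "1 \<le> j \<Longrightarrow> fst ` packed j = {Sigma_thr p L j..}"
  using packed_Sigma_le packed_at_threshold by (force simp: image_iff)

lemma fst_branch_1: "fst ` branch 1 = {sigma_thr L 1<..}"
proof -
  have "fst ` branch 1 = fst ` low_curve \<union> fst ` packed 1" using branch_eq[of 1] by (simp add: image_Un)
  also have "fst ` low_curve = low_range" by (auto simp: low_curve_def image_iff)
  also have "fst ` packed 1 = {Sigma_thr p L 1..}" by (rule fst_packed) simp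
  finally show ?thesis using thr_mono(1) by auto
qed

lemma bumps_branch:
  assumes j: "1 \<le> j" and u: "(lam, u) \<in> branch j"
  shows "finite (bumps L u)" "card (bumps L u) = j"
    "\<And>I. I \<in> bumps L u \<Longrightarrow> \<exists>!x. occurs_at u I x"
    "\<And>I. I \<in> bumps L u \<Longrightarrow> (2 * a / ((p + 1) * lam)) powr (1 / (1 - p)) \<le> u (bump_point u I)"
proof -
  have sol: "(lam, u) \<in> nonneg_solutions p L a" and c: "card (bumps L u) = j"
    using u by (auto simp: branch_def)
  show "card (bumps L u) = j" by fact
  show "finite (bumps L u)" using c j card_ge_0_finite[of "bumps L u"] by simp
  show "\<And>I. I \<in> bumps L u \<Longrightarrow> \<exists>!x. occurs_at u I x"
    "\<And>I. I \<in> bumps L u \<Longrightarrow> (2 * a / ((p + 1) * lam)) powr (1 / (1 - p)) \<le> u (bump_point u I)"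
    using bump_maximum[OF sol] by auto
qed

end

theorem mainTheorem2:
  fixes p L a :: real
  assumes "0 < p" "p < 1" "0 < L" "0 < a"
  shows "\<exists>D :: nat \<Rightarrow> (real \<times> (real \<Rightarrow> real)) set.
    connected_components_of (nonneg_solution_space p L a) = D ` {1..}
    \<and> (\<forall>j\<ge>1. \<forall>(lam, u)\<in>D j.
          finite (bumps L u) \<and> card (bumps L u) = j
          \<and> (\<forall>I\<in>bumps L u. (\<exists>!x. occurs_at u I x)
                \<and> (2 * a / ((p + 1) * lam)) powr (1 / (1 - p)) \<le> u (bump_point u I)))
    \<and> fst ` D 1 = {sigma_thr L 1<..}
    \<and> (\<forall>j\<ge>2. fst ` D j = {Sigma_thr p L j..})
    \<and> (\<forall>i\<ge>1. \<forall>j\<ge>1. i \<noteq> j \<longrightarrow> D i \<inter> D j = {})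
    \<and> (\<exists>w :: real \<Rightarrow> real \<Rightarrow> real.
          (\<forall>lam\<in>{sigma_thr L 1<..Sigma_thr p L 1}. slice (D 1) lam = {w lam})
          \<and> continuous_map (top_of_set {sigma_thr L 1<..Sigma_thr p L 1}) (C1_topology L) w
          \<and> filterlim (\<lambda>lam. sup_norm L (w lam)) at_top (at_right (sigma_thr L 1)))
    \<and> (\<forall>lam>Sigma_thr p L 1.
          homeomorphic_map (subtopology (C1_topology L) (slice (D 1) lam))
            (subtopology (powertop_real {1..1}) (bump_simplex p L 1 lam)) (bump_vector L 1)
          \<and> (\<forall>mu>lam. bump_simplex p L 1 lam \<subset> bump_simplex p L 1 mu))
    \<and> (\<forall>j\<ge>2. \<forall>lam>Sigma_thr p L j.
          homeomorphic_map (subtopology (C1_topology L) (slice (D j) lam))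
            (subtopology (powertop_real {1..j}) (bump_simplex p L j lam)) (bump_vector L j)
          \<and> (\<forall>mu>lam. bump_simplex p L j lam \<subset> bump_simplex p L j mu))"
proof -
  interpret sublinear_problem p L a using assms by unfold_locales
  show ?thesis
  proof (rule exI[of _ branch], intro conjI)
    show "connected_components_of (nonneg_solution_space p L a) = branch ` {1..}"
      by (rule components_eq_branches)
    show "\<forall>j\<ge>1. \<forall>(lam, u)\<in>branch j. finite (bumps L u) \<and> card (bumps L u) = j
          \<and> (\<forall>I\<in>bumps L u. (\<exists>!x. occurs_at u I x)
                \<and> (2 * a / ((p + 1) * lam)) powr (1 / (1 - p)) \<le> u (bump_point u I))"
      using bumps_branch by blast
    show "fst ` branch 1 = {sigma_thr L 1<..}" by (rule fst_branch_1)
    show "\<forall>j\<ge>2. fst ` branch j = {Sigma_thr p L j..}"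
      using branch_eq fst_packed by simp
    show "\<forall>i\<ge>1. \<forall>j\<ge>1. i \<noteq> j \<longrightarrow> branch i \<inter> branch j = {}" by (auto simp: branch_def)
    show "\<exists>w :: real \<Rightarrow> real \<Rightarrow> real.
          (\<forall>lam\<in>{sigma_thr L 1<..Sigma_thr p L 1}. slice (branch 1) lam = {w lam})
          \<and> continuous_map (top_of_set {sigma_thr L 1<..Sigma_thr p L 1}) (C1_topology L) w
          \<and> filterlim (\<lambda>lam. sup_norm L (w lam)) at_top (at_right (sigma_thr L 1))"
      using slice_low continuous_map_low sup_norm_low_at_top by blast
    show "\<forall>lam>Sigma_thr p L 1.
          homeomorphic_map (subtopology (C1_topology L) (slice (branch 1) lam))
            (subtopology (powertop_real {1..1}) (bump_simplex p L 1 lam)) (bump_vector L 1)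
          \<and> (\<forall>mu>lam. bump_simplex p L 1 lam \<subset> bump_simplex p L 1 mu)"
      using homeomorphic_map_bump_vector[of 1] simplex_strict_mono[of 1] by blast
    show "\<forall>j\<ge>2. \<forall>lam>Sigma_thr p L j.
          homeomorphic_map (subtopology (C1_topology L) (slice (branch j) lam))
            (subtopology (powertop_real {1..j}) (bump_simplex p L j lam)) (bump_vector L j)
          \<and> (\<forall>mu>lam. bump_simplex p L j lam \<subset> bump_simplex p L j mu)"
      using homeomorphic_map_bump_vector simplex_strict_mono by simp
  qed
qed

end
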